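(* Let $(V, \mathfrak{m}, \mathbb{K})$ be a commutative artinian local ring with residue field $\mathbb{K}$ of characteristic $p>0$, and suppose given a bijective ring homomorphism $F : V \to V$ inducing the Frobenius morphism on $\mathbb{K}$. Let $R = V[x_1,\dots,x_n]$ be a polynomial ring over $V$, and let $f \in R$ be a nonzerodivisor. Then there are only finitely many Bernstein--Sato roots of $f$.
   Context: For a commutative $V$-algebra $S$, let $\mathcal{D}_S \subseteq \operatorname{End}_V(S)$ be the ring of $V$-linear differential operators on $S$ in Grothendieck's sense: with $S \otimes_V S$ acting on $\operatorname{End}_V(S)$ by $((r\otimes s)\cdot\varphi)(x) = r\varphi(sx)$ and $J = \ker(S\otimes_V S \to S)$ the kernel of multiplication, $\mathcal{D}_S = \{\varphi : J^n\cdot \varphi = 0 \text{ for some } n \gg 0\}$. Let $C(\mathbb{Z}_p, V)$ be the ring (pointwise operations) of continuous functions $\mathbb{Z}_p \to V$, with $V$ discrete. For $\alpha \in \mathbb{Z}_p$, $(\mathfrak{m}:\alpha) = \{\varphi \in C(\mathbb{Z}_p,V) : \varphi(\alpha) \in \mathfrak{m}\}$ is a maximal ideal. Grade $R[t]$ by $\deg R = 0$, $\deg t = 1$, inducing a $\mathbb{Z}$-grading on $\mathcal{D}_{R[t]}$ with degree-zero subring $(\mathcal{D}_{R[t]})_0$. Each $\varphi \in C(\mathbb{Z}_p, V)$ defines an operator $\tilde\varphi \in (\mathcal{D}_{R[t]})_0$ by $\tilde\varphi(r t^a) = \varphi(-1-a) r t^a$ ($r \in R$, $a \ge 0$), so every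 $(\mathcal{D}_{R[t]})_0$-module is a $C(\mathbb{Z}_p,V)$-module. Localizations of $R[t]$ carry the unique $\mathcal{D}_{R[t]}$-module structures extending that on $R[t]$. Let $H_f = R[t,f^{-1},(f-t)^{-1}]/R[t,f^{-1}]$, $\delta_0 = [(f-t)^{-1}] \in H_f$, and $N_f = \big((\mathcal{D}_{R[t]})_0\cdot\delta_0\big)/\big((\mathcal{D}_{R[t]})_0\cdot f\delta_0\big)$. A $p$-adic integer $\alpha \in \mathbb{Z}_p$ is a Bernstein--Sato root of $f$ if the localization $(N_f)_\alpha$ of the $C(\mathbb{Z}_p,V)$-module $N_f$ at $(\mathfrak{m}:\alpha)$ is nonzero. *)

theory Defs
  imports
    "HOL-Analysis.Function_Topology"
    "HOL-Algebra.Algebraic_Closure_Type"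
    "HOL-Algebra.Module"
    "HOL-Library.Poly_Mapping"
    "HOL-Computational_Algebra.Polynomial"
begin


text \<open>
  Commutative rings that serve as coefficients are types of class \<open>comm_ring_1\<close>; the following
  abbreviation is the corresponding HOL-Algebra structure.
\<close>

abbreviation cls_ring :: "'a::comm_ring_1 ring"
  where "cls_ring \<equiv> ring_of_type_algebra"

definition local_ring_with :: "('a, 'b) ring_scheme \<Rightarrow> 'a set \<Rightarrow> bool" where
  "local_ring_with R \<mm> \<longleftrightarrow>
     cring R \<and> maximalideal \<mm> R \<and> (\<forall>\<nn>. maximalideal \<nn> R \<longrightarrow> \<nn> = \<mm>)"

definition artinian_ring :: "('a, 'b) ring_scheme \<Rightarrow> bool" where
  "artinian_ring R \<longleftrightarrow>
     cring R \<and>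
     (\<forall>I :: nat \<Rightarrow> 'a set.
        (\<forall>k. ideal (I k) R \<and> I (Suc k) \<subseteq> I k) \<longrightarrow> (\<exists>N. \<forall>k\<ge>N. I k = I N))"

text \<open>The characteristic is the additive order of \<open>1\<close>; \<open>group.ord\<close> is \<open>0\<close> on elements of infinite order.\<close>

definition ring_characteristic :: "('a, 'b) ring_scheme \<Rightarrow> nat" where
  "ring_characteristic R = group.ord (add_monoid R) \<one>\<^bsub>R\<^esub>"

definition nonzerodivisor :: "'a::comm_ring_1 \<Rightarrow> bool" where
  "nonzerodivisor f \<longleftrightarrow> (\<forall>g. f * g = 0 \<longrightarrow> g = 0)"

text \<open>
  A \<open>V\<close>-algebra is a ring \<open>R\<close> with a ring homomorphism \<open>\<eta> : V \<rightarrow> R\<close>. It is a polynomial ring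
  \<open>V[x\<^sub>0, \<dots>, x\<^bsub>n-1\<^esub>]\<close> if evaluation at the \<open>x\<^sub>i\<close> is a bijection from the formal polynomials in the
  variables \<open>0, \<dots>, n-1\<close> (finitely supported coefficient functions on exponent vectors) onto \<open>R\<close>.
  Stating this for an arbitrary ring type \<open>R\<close> keeps the number of variables an ordinary
  natural number; in particular \<open>n = 0\<close> is allowed.
\<close>

definition formal_polys :: "nat \<Rightarrow> ((nat \<Rightarrow>\<^sub>0 nat) \<Rightarrow>\<^sub>0 'v::comm_ring_1) set" where
  "formal_polys n = {q. \<forall>m\<in>Poly_Mapping.keys q. Poly_Mapping.keys m \<subseteq> {..<n}}"

definition eval_formal ::
  "('v::comm_ring_1 \<Rightarrow> 'r::comm_ring_1) \<Rightarrow> (nat \<Rightarrow> 'r) \<Rightarrow> nat \<Rightarrow> ((nat \<Rightarrow>\<^sub>0 nat) \<Rightarrow>\<^sub>0 'v) \<Rightarrow> 'r" where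
  "eval_formal \<eta> x n q =
     (\<Sum>m\<in>Poly_Mapping.keys q. \<eta> (Poly_Mapping.lookup q m) * (\<Prod>i<n. x i ^ Poly_Mapping.lookup m i))"

definition is_polynomial_ring ::
  "('v::comm_ring_1 \<Rightarrow> 'r::comm_ring_1) \<Rightarrow> (nat \<Rightarrow> 'r) \<Rightarrow> nat \<Rightarrow> bool" where
  "is_polynomial_ring \<eta> x n \<longleftrightarrow>
     \<eta> \<in> ring_hom cls_ring cls_ring \<and> bij_betw (eval_formal \<eta> x n) (formal_polys n) UNIV"

text \<open>
  HOL-Algebra's locale \<open>module\<close> is restricted to commutative rings; modules over rings of
  differential operators need the noncommutative version. The record type \<open>module\<close> also has
  multiplicative fields \<open>mult\<close> and \<open>one\<close>, which play no role in a module.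
\<close>

locale left_module = R?: ring R + M?: abelian_group M for R :: "('a, 'b) ring_scheme" (structure) and M :: "('a, 'm, 'c) module_scheme" (structure) +
  assumes smult_closed:
      "\<lbrakk>a \<in> carrier R; x \<in> carrier M\<rbrakk> \<Longrightarrow> a \<odot>\<^bsub>M\<^esub> x \<in> carrier M"
    and smult_l_distr:
      "\<lbrakk>a \<in> carrier R; b \<in> carrier R; x \<in> carrier M\<rbrakk> \<Longrightarrow>
        (a \<oplus>\<^bsub>R\<^esub> b) \<odot>\<^bsub>M\<^esub> x = a \<odot>\<^bsub>M\<^esub> x \<oplus>\<^bsub>M\<^esub> b \<odot>\<^bsub>M\<^esub> x"
    and smult_r_distr:
      "\<lbrakk>a \<in> carrier R; x \<in> carrier M; y \<in> carrier M\<rbrakk> \<Longrightarrow>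
        a \<odot>\<^bsub>M\<^esub> (x \<oplus>\<^bsub>M\<^esub> y) = a \<odot>\<^bsub>M\<^esub> x \<oplus>\<^bsub>M\<^esub> a \<odot>\<^bsub>M\<^esub> y"
    and smult_assoc:
      "\<lbrakk>a \<in> carrier R; b \<in> carrier R; x \<in> carrier M\<rbrakk> \<Longrightarrow>
        (a \<otimes>\<^bsub>R\<^esub> b) \<odot>\<^bsub>M\<^esub> x = a \<odot>\<^bsub>M\<^esub> (b \<odot>\<^bsub>M\<^esub> x)"
    and smult_one:
      "x \<in> carrier M \<Longrightarrow> \<one>\<^bsub>R\<^esub> \<odot>\<^bsub>M\<^esub> x = x"

definition with_smult :: "('a \<Rightarrow> 'm \<Rightarrow> 'm) \<Rightarrow> ('b, 'm) module \<Rightarrow> ('a, 'm) module" where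
  "with_smult act M =
     \<lparr>carrier = carrier M, monoid.mult = monoid.mult M, one = one M, zero = zero M, add = add M, module.smult = act\<rparr>"

definition regular_module :: "'a ring \<Rightarrow> ('a, 'a) module" where
  "regular_module R =
     \<lparr>carrier = carrier R, monoid.mult = monoid.mult R, one = one R, zero = zero R, add = add R, module.smult = monoid.mult R\<rparr>"

definition quotient_module :: "('a, 'm) module \<Rightarrow> 'm set \<Rightarrow> ('a, 'm set) module" where
  "quotient_module M N =
     \<lparr>carrier = a_rcosets\<^bsub>M\<^esub> N,
      monoid.mult = undefined, one = undefined,
      zero = N,
      add = set_add M,
      module.smult = (\<lambda>a A. \<Union>x\<in>A. N +>\<^bsub>M\<^esub> (a \<odot>\<^bsub>M\<^esub> x))\<rparr>"

text \<open>
  Localization of a module \<open>M\<close> over a commutative ring \<open>R\<close> at a multiplicative set \<open>W\<close>: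
  \<open>x/s = y/t\<close> iff \<open>u (t x) = u (s y)\<close> for some \<open>u \<in> W\<close>.
\<close>

definition frac_rel ::
  "'a ring \<Rightarrow> 'a set \<Rightarrow> ('a, 'm) module \<Rightarrow> (('m \<times> 'a) \<times> ('m \<times> 'a)) set" where
  "frac_rel R W M =
     {((x, s), (y, t)). x \<in> carrier M \<and> y \<in> carrier M \<and> s \<in> W \<and> t \<in> W \<and>
        (\<exists>u\<in>W. u \<odot>\<^bsub>M\<^esub> (t \<odot>\<^bsub>M\<^esub> x) = u \<odot>\<^bsub>M\<^esub> (s \<odot>\<^bsub>M\<^esub> y))}"

definition frac ::
  "'a ring \<Rightarrow> 'a set \<Rightarrow> ('a, 'm) module \<Rightarrow> 'm \<Rightarrow> 'a \<Rightarrow> ('m \<times> 'a) set" where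
  "frac R W M x s = frac_rel R W M `` {(x, s)}"

definition localized_module ::
  "'a ring \<Rightarrow> 'a set \<Rightarrow> ('a, 'm) module \<Rightarrow> ('a, ('m \<times> 'a) set) module" where
  "localized_module R W M =
     \<lparr>carrier = (carrier M \<times> W) // frac_rel R W M,
      monoid.mult = undefined, one = undefined,
      zero = frac R W M \<zero>\<^bsub>M\<^esub> \<one>\<^bsub>R\<^esub>,
      add = (\<lambda>A B. \<Union>(x, s)\<in>A. \<Union>(y, t)\<in>B.
               frac R W M (t \<odot>\<^bsub>M\<^esub> x \<oplus>\<^bsub>M\<^esub> s \<odot>\<^bsub>M\<^esub> y) (s \<otimes>\<^bsub>R\<^esub> t)),
      module.smult = (\<lambda>a A. \<Union>(x, s)\<in>A. frac R W M (a \<odot>\<^bsub>M\<^esub> x) s)\<rparr>"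

text \<open>
  Let \<open>S\<close> be a commutative \<open>V\<close>-algebra with structure map \<open>\<kappa> : V \<rightarrow> S\<close>. An element of \<open>S \<otimes>\<^sub>V S\<close> is
  represented by a list of pairs, \<open>[(r\<^sub>1,s\<^sub>1),\<dots>,(r\<^sub>k,s\<^sub>k)]\<close> standing for \<open>\<Sum> r\<^sub>i \<otimes> s\<^sub>i\<close>. All that is
  used of \<open>S \<otimes>\<^sub>V S\<close> is its product, the multiplication map to \<open>S\<close> and the action on
  \<open>End\<^sub>V(S)\<close>; each of them is computed on representatives and compatible with the relations that
  define the tensor product (see the lemmas below), so that no quotient has to be formed.
\<close>

type_synonym 's tensor_rep = "('s \<times> 's) list"

definition tensor_prod :: "'s::comm_ring_1 tensor_rep \<Rightarrow> 's tensor_rep \<Rightarrow> 's tensor_rep" where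
  "tensor_prod u v = [(r * r', s * s'). (r, s) \<leftarrow> u, (r', s') \<leftarrow> v]"

definition tensor_mult_map :: "'s::comm_ring_1 tensor_rep \<Rightarrow> 's" where
  "tensor_mult_map u = (\<Sum>(r, s)\<leftarrow>u. r * s)"

definition tensor_act :: "'s::comm_ring_1 tensor_rep \<Rightarrow> ('s \<Rightarrow> 's) \<Rightarrow> ('s \<Rightarrow> 's)" where
  "tensor_act u \<phi> = (\<lambda>x. \<Sum>(r, s)\<leftarrow>u. r * \<phi> (s * x))"

definition diag_ideal :: "'s::comm_ring_1 tensor_rep set" where
  "diag_ideal = {u. tensor_mult_map u = 0}"

primrec diag_ideal_power :: "nat \<Rightarrow> 's::comm_ring_1 tensor_rep set" where
  "diag_ideal_power 0 = UNIV"
| "diag_ideal_power (Suc n) =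
     {concat (map (\<lambda>(u, v). tensor_prod u v) ws) | ws. set ws \<subseteq> diag_ideal \<times> diag_ideal_power n}"

definition V_linear :: "('v::comm_ring_1 \<Rightarrow> 's::comm_ring_1) \<Rightarrow> ('s \<Rightarrow> 's) \<Rightarrow> bool" where
  "V_linear \<kappa> \<phi> \<longleftrightarrow> module_hom (\<lambda>c x. \<kappa> c * x) (\<lambda>c x. \<kappa> c * x) \<phi>"

definition diff_ops :: "('v::comm_ring_1 \<Rightarrow> 's::comm_ring_1) \<Rightarrow> ('s \<Rightarrow> 's) set" where
  "diff_ops \<kappa> =
     {\<phi>. V_linear \<kappa> \<phi> \<and> (\<exists>n. \<forall>u\<in>diag_ideal_power n. tensor_act u \<phi> = (\<lambda>_. 0))}"

definition diff_op_ring :: "('v::comm_ring_1 \<Rightarrow> 's::comm_ring_1) \<Rightarrow> ('s \<Rightarrow> 's) ring" where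
  "diff_op_ring \<kappa> =
     \<lparr>carrier = diff_ops \<kappa>, monoid.mult = (\<circ>), one = id,
      zero = (\<lambda>_. 0), add = (\<lambda>\<phi> \<psi> x. \<phi> x + \<psi> x)\<rparr>"

lemma tensor_maps_append:
  "tensor_mult_map (u @ v) = tensor_mult_map u + tensor_mult_map v"
  "tensor_act (u @ v) \<phi> x = tensor_act u \<phi> x + tensor_act v \<phi> x"
  by (simp_all add: tensor_mult_map_def tensor_act_def)

lemma tensor_maps_respect_relations:
  fixes \<kappa> :: "'v::comm_ring_1 \<Rightarrow> 's::comm_ring_1"
  assumes "V_linear \<kappa> \<phi>"
  shows "tensor_act [(r + r', s)] \<phi> = tensor_act [(r, s), (r', s)] \<phi>"
    and "tensor_act [(r, s + s')] \<phi> = tensor_act [(r, s), (r, s')] \<phi>"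
    and "tensor_act [(\<kappa> c * r, s)] \<phi> = tensor_act [(r, \<kappa> c * s)] \<phi>"
    and "tensor_mult_map [(r + r', s)] = tensor_mult_map [(r, s), (r', s)]"
    and "tensor_mult_map [(r, s + s')] = tensor_mult_map [(r, s), (r, s')]"
    and "tensor_mult_map [(\<kappa> c * r, s)] = tensor_mult_map [(r, \<kappa> c * s)]"
proof -
  note hom = assms[unfolded V_linear_def]
  have "\<phi> (x + y) = \<phi> x + \<phi> y" "\<phi> (\<kappa> c * x) = \<kappa> c * \<phi> x" for x y c
    using module_hom.add[OF hom] module_hom.scale[OF hom] by blast+
  then show "tensor_act [(r + r', s)] \<phi> = tensor_act [(r, s), (r', s)] \<phi>"
    and "tensor_act [(r, s + s')] \<phi> = tensor_act [(r, s), (r, s')] \<phi>"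
    and "tensor_act [(\<kappa> c * r, s)] \<phi> = tensor_act [(r, \<kappa> c * s)] \<phi>"
    by (simp_all add: tensor_act_def distrib_left distrib_right mult.assoc mult.left_commute[of "\<kappa> c" r])
qed (simp_all add: tensor_mult_map_def algebra_simps)

lemma tensor_prod_act:
  assumes "V_linear \<kappa> \<phi>"
  shows "tensor_act (tensor_prod u v) \<phi> = tensor_act u (tensor_act v \<phi>)"
proof
  fix x
  show "tensor_act (tensor_prod u v) \<phi> x = tensor_act u (tensor_act v \<phi>) x"
  proof (induction u)
    case Nil
    then show ?case by (simp add: tensor_prod_def tensor_act_def)
  next
    case (Cons rs u)
    obtain r s where rs: "rs = (r, s)" by force
    have eq: "tensor_prod (rs # u) v = tensor_prod [rs] v @ tensor_prod u v"
      by (simp add: tensor_prod_def)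
    have "tensor_act (tensor_prod [rs] v) \<phi> x = r * tensor_act v \<phi> (s * x)"
      by (induction v) (auto simp: rs tensor_prod_def tensor_act_def algebra_simps)
    with Cons.IH show ?case
      unfolding eq tensor_maps_append by (simp add: rs tensor_act_def)
  qed
qed

lemma tensor_prod_mult_map:
  "tensor_mult_map (tensor_prod u v) = tensor_mult_map u * tensor_mult_map v"
proof (induction u)
  case Nil
  then show ?case by (simp add: tensor_prod_def tensor_mult_map_def)
next
  case (Cons rs u)
  obtain r s where rs: "rs = (r, s)" by force
  have eq: "tensor_prod (rs # u) v = tensor_prod [rs] v @ tensor_prod u v"
    by (simp add: tensor_prod_def)
  have "tensor_mult_map (tensor_prod [rs] v) = r * s * tensor_mult_map v"
    by (induction v) (auto simp: rs tensor_prod_def tensor_mult_map_def algebra_simps)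
  with Cons.IH show ?case
    unfolding eq tensor_maps_append by (simp add: rs tensor_mult_map_def algebra_simps)
qed

text \<open>
  The localization \<open>W\<^sup>-\<^sup>1S\<close> as a \<open>\<D>\<^sub>S\<close>-module: the unique \<open>\<D>\<^sub>S\<close>-module structure on the given abelian group
  in which \<open>S \<subseteq> \<D>\<^sub>S\<close> acts by its usual scalar multiplication and for which \<open>S \<rightarrow> W\<^sup>-\<^sup>1S\<close> is
  \<open>\<D>\<^sub>S\<close>-linear. The extensional function spaces only normalize the values outside
  \<open>\<D>\<^sub>S\<close> and \<open>W\<^sup>-\<^sup>1S\<close>.
\<close>

abbreviation ring_localization :: "'s::comm_ring_1 set \<Rightarrow> ('s, ('s \<times> 's) set) module" where
  "ring_localization W \<equiv> localized_module cls_ring W (regular_module cls_ring)"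

abbreviation ring_frac :: "'s::comm_ring_1 set \<Rightarrow> 's \<Rightarrow> 's \<Rightarrow> ('s \<times> 's) set" where
  "ring_frac W \<equiv> frac cls_ring W (regular_module cls_ring)"

definition extends_D_action ::
  "('v::comm_ring_1 \<Rightarrow> 's::comm_ring_1) \<Rightarrow> 's set \<Rightarrow>
   (('s \<Rightarrow> 's) \<Rightarrow> ('s \<times> 's) set \<Rightarrow> ('s \<times> 's) set) \<Rightarrow> bool" where
  "extends_D_action \<kappa> W act \<longleftrightarrow>
     (let L = ring_localization W in
        act \<in> diff_ops \<kappa> \<rightarrow>\<^sub>E (carrier L \<rightarrow>\<^sub>E carrier L) \<and>
        left_module (diff_op_ring \<kappa>) (with_smult act L) \<and>
        (\<forall>s. \<forall>A\<in>carrier L. act ((*) s) A = s \<odot>\<^bsub>L\<^esub> A) \<and>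
        (\<forall>\<phi>\<in>diff_ops \<kappa>. \<forall>a. act \<phi> (ring_frac W a 1) = ring_frac W (\<phi> a) 1))"

definition D_localization ::
  "('v::comm_ring_1 \<Rightarrow> 's::comm_ring_1) \<Rightarrow> 's set \<Rightarrow> ('s \<Rightarrow> 's, ('s \<times> 's) set) module" where
  "D_localization \<kappa> W = with_smult (THE act. extends_D_action \<kappa> W act) (ring_localization W)"

text \<open>\<open>R[t]\<close> is \<open>'r poly\<close>, with \<open>\<int>\<close>-grading \<open>deg R = 0\<close>, \<open>deg t = 1\<close>.\<close>

definition poly_structure_map :: "('v \<Rightarrow> 'r::comm_ring_1) \<Rightarrow> 'v \<Rightarrow> 'r poly" where
  "poly_structure_map \<eta> c = [:\<eta> c:]"

definition poly_graded_part :: "int \<Rightarrow> 'r::comm_ring_1 poly set" where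
  "poly_graded_part d = {q. \<forall>i. poly.coeff q i \<noteq> 0 \<longrightarrow> int i = d}"

definition diff_ops_degree :: "('v::comm_ring_1 \<Rightarrow> 'r::comm_ring_1) \<Rightarrow> int \<Rightarrow> ('r poly \<Rightarrow> 'r poly) set" where
  "diff_ops_degree \<eta> d =
     {\<phi> \<in> diff_ops (poly_structure_map \<eta>). \<forall>e. \<phi> ` poly_graded_part e \<subseteq> poly_graded_part (e + d)}"

text \<open>\<open>\<int>\<^sub>p\<close> is the inverse limit of the \<open>\<int>/p\<^sup>k\<close>, with residues represented in \<open>{0..<p\<^sup>k}\<close>.\<close>

definition padic_integers :: "nat \<Rightarrow> (nat \<Rightarrow> int) set" where
  "padic_integers p =
     {\<alpha>. \<forall>k. \<alpha> k \<in> {0..<int p ^ k} \<and> \<alpha> (Suc k) mod int p ^ k = \<alpha> k}"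

definition padic_of_int :: "nat \<Rightarrow> int \<Rightarrow> (nat \<Rightarrow> int)" where
  "padic_of_int p z = (\<lambda>k. z mod int p ^ k)"

definition padic_topology :: "nat \<Rightarrow> (nat \<Rightarrow> int) topology" where
  "padic_topology p =
     subtopology (product_topology (\<lambda>k. discrete_topology {0..<int p ^ k}) UNIV) (padic_integers p)"

definition continuous_function_ring :: "nat \<Rightarrow> ((nat \<Rightarrow> int) \<Rightarrow> 'v::comm_ring_1) ring" where
  "continuous_function_ring p =
     \<lparr>carrier = {\<phi> \<in> extensional (padic_integers p).
                   continuous_map (padic_topology p) (discrete_topology UNIV) \<phi>},
      monoid.mult = (\<lambda>\<phi> \<psi>. \<lambda>\<alpha>\<in>padic_integers p. \<phi> \<alpha> * \<psi> \<alpha>),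
      one = (\<lambda>\<alpha>\<in>padic_integers p. 1),
      zero = (\<lambda>\<alpha>\<in>padic_integers p. 0),
      add = (\<lambda>\<phi> \<psi>. \<lambda>\<alpha>\<in>padic_integers p. \<phi> \<alpha> + \<psi> \<alpha>)\<rparr>"

definition point_ideal :: "nat \<Rightarrow> 'v::comm_ring_1 set \<Rightarrow> (nat \<Rightarrow> int) \<Rightarrow> ((nat \<Rightarrow> int) \<Rightarrow> 'v) set" where
  "point_ideal p \<mm> \<alpha> = {\<phi> \<in> carrier (continuous_function_ring p). \<phi> \<alpha> \<in> \<mm>}"

definition tilde_op ::
  "('v::comm_ring_1 \<Rightarrow> 'r::comm_ring_1) \<Rightarrow> nat \<Rightarrow> ((nat \<Rightarrow> int) \<Rightarrow> 'v) \<Rightarrow> 'r poly \<Rightarrow> 'r poly" where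
  "tilde_op \<eta> p \<phi> q =
     (\<Sum>a\<le>Polynomial.degree q.
        Polynomial.monom (\<eta> (\<phi> (padic_of_int p (- 1 - int a))) * poly.coeff q a) a)"

text \<open>
  \<open>H\<^sub>f\<close> is the quotient of \<open>R[t, f\<^sup>-\<^sup>1, (f-t)\<^sup>-\<^sup>1]\<close>, the localization of \<open>R[t]\<close> at all \<open>f\<^sup>i (f-t)\<^sup>j\<close>, by the
  image of \<open>R[t, f\<^sup>-\<^sup>1]\<close>, the fractions with denominator a power of \<open>f\<close>.
\<close>

definition f_minus_t :: "'r::comm_ring_1 \<Rightarrow> 'r poly" where
  "f_minus_t f = [:f:] - [:0, 1:]"

definition bs_denominators :: "'r::comm_ring_1 \<Rightarrow> 'r poly set" where
  "bs_denominators f = {[:f:] ^ i * f_minus_t f ^ j | i j. True}"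

definition bs_f_fractions :: "'r::comm_ring_1 \<Rightarrow> ('r poly \<times> 'r poly) set set" where
  "bs_f_fractions f = {ring_frac (bs_denominators f) a ([:f:] ^ i) | a i. True}"

definition bs_H ::
  "('v::comm_ring_1 \<Rightarrow> 'r::comm_ring_1) \<Rightarrow> 'r \<Rightarrow>
   ('r poly \<Rightarrow> 'r poly, ('r poly \<times> 'r poly) set set) module" where
  "bs_H \<eta> f =
     quotient_module (D_localization (poly_structure_map \<eta>) (bs_denominators f)) (bs_f_fractions f)"

definition bs_delta ::
  "('v::comm_ring_1 \<Rightarrow> 'r::comm_ring_1) \<Rightarrow> 'r \<Rightarrow> ('r poly \<times> 'r poly) set set" where
  "bs_delta \<eta> f =
     bs_f_fractions f +>\<^bsub>D_localization (poly_structure_map \<eta>) (bs_denominators f)\<^esub>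
       ring_frac (bs_denominators f) 1 (f_minus_t f)"

definition D0_span ::
  "('v::comm_ring_1 \<Rightarrow> 'r::comm_ring_1) \<Rightarrow> 'r \<Rightarrow> ('r poly \<times> 'r poly) set set \<Rightarrow>
   ('r poly \<times> 'r poly) set set set" where
  "D0_span \<eta> f h = {P \<odot>\<^bsub>bs_H \<eta> f\<^esub> h | P. P \<in> diff_ops_degree \<eta> 0}"

definition bs_N ::
  "('v::comm_ring_1 \<Rightarrow> 'r::comm_ring_1) \<Rightarrow> nat \<Rightarrow> 'r \<Rightarrow>
   ((nat \<Rightarrow> int) \<Rightarrow> 'v, ('r poly \<times> 'r poly) set set set) module" where
  "bs_N \<eta> p f =
     (let H = bs_H \<eta> f; \<delta> = bs_delta \<eta> f;
          N = quotient_module (H\<lparr>carrier := D0_span \<eta> f \<delta>\<rparr>)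
                (D0_span \<eta> f ((*) [:f:] \<odot>\<^bsub>H\<^esub> \<delta>))
      in with_smult (\<lambda>\<phi> A. tilde_op \<eta> p \<phi> \<odot>\<^bsub>N\<^esub> A) N)"

definition bernstein_sato_root ::
  "('v::comm_ring_1 \<Rightarrow> 'r::comm_ring_1) \<Rightarrow> 'v set \<Rightarrow> nat \<Rightarrow> 'r \<Rightarrow> (nat \<Rightarrow> int) \<Rightarrow> bool" where
  "bernstein_sato_root \<eta> \<mm> p f \<alpha> \<longleftrightarrow>
     \<alpha> \<in> padic_integers p \<and>
     (let C = continuous_function_ring p;
          N\<alpha> = localized_module C (carrier C - point_ideal p \<mm> \<alpha>) (bs_N \<eta> p f)
      in carrier N\<alpha> \<noteq> {\<zero>\<^bsub>N\<alpha>\<^esub>})"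

end

theory Submission
  imports Defs
begin

text \<open>
  Let \<open>R = V[x\<^sub>1, \<dots>, x\<^sub>n]\<close> and \<open>S = R[t]\<close>. The residue characteristic \<open>p\<close> lies in the maximal ideal of the
  artinian local ring \<open>V\<close>, so \<open>p^M = 0\<close> in \<open>V\<close> for some \<open>M\<close>. Consequently a differential operator on a
  \<open>V\<close>-algebra commutes with multiplication by \<open>w^(p^N)\<close>, for all elements \<open>w\<close> at once, as soon as \<open>N\<close> is
  large (\<open>diff_op_commutes_prime_powers\<close>), and on a polynomial ring a \<open>V\<close>-linear map that commutes with the
  \<open>p^N\<close>-th powers of the variables is a differential operator (\<open>diff_op_of_commutes_generators\<close>). The first
  fact gives the action on localizations: \<open>\<phi> (a/u) = (\<phi> a)/u\<close> whenever \<open>\<phi>\<close> commutes with \<open>u\<close>.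

  Fix \<open>e\<close> and put \<open>q = p^e\<close>, \<open>P = p^M\<close>. Since \<open>f^(qP)\<close> is a polynomial in the \<open>x\<^sub>i^q\<close>, every operator that is
  linear over \<open>V[x^q, t^q]\<close> commutes with \<open>f^(qP) - t^(qP)\<close>, and is therefore applied to the fraction
  \<open>1/(f - t) = (\<Sum>a<qP. t^a f^(qP-1-a)) / (f^(qP) - t^(qP))\<close> by applying it to the numerator. Let \<open>\<alpha>\<close> be a \<open>p\<close>-adic integer
  with residue \<open>s\<close> modulo \<open>q\<close>. The degrees \<open>a\<close> with \<open>-1 - a \<equiv> \<alpha>\<close> modulo \<open>q\<close> carry the coefficients \<open>f^(qi+s)\<close>, \<open>i < P\<close>.
  If some \<open>V[x^q]\<close>-linear \<open>\<phi> : R \<rightarrow> R\<close> maps \<open>f^(qi+s+1)\<close> to \<open>f^(qi+s)\<close> for all \<open>i < P\<close> (\<open>divides_power\<close>), then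
  the part of \<open>\<delta>\<^sub>0\<close> in these degrees is a multiple of \<open>f \<delta>\<^sub>0\<close>. So the indicator function of \<open>\<alpha> + p^e \<int>\<^sub>p\<close>,
  whose operator is central, annihilates \<open>N\<^sub>f\<close>, and \<open>\<alpha>\<close> is not a root (\<open>not_root_of_divides_power\<close>).

  It remains to bound the number of residues \<open>s < q\<close> without such a \<open>\<phi>\<close> independently of \<open>e\<close>, because
  \<open>p\<close>-adic integers are separated by their residues. For \<open>v\<^sub>s = (f^(qi+s))\<^sub>i\<close> consider all vectors \<open>\<psi>(v\<^sub>s)\<close>, where
  \<open>\<psi> : R \<rightarrow> R\<close> is \<open>V\<close>-linear and satisfies \<open>\<psi>(h(x^q) r) = h \<psi>(r)\<close>. They form a submodule that decreases
  with \<open>s\<close>, since multiplication by \<open>f\<close> may be absorbed into \<open>\<psi>\<close>. The coefficients of \<open>v\<^sub>s\<close> over \<open>V[x^q]\<close> have degree at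
  most \<open>P deg f\<close> after replacing \<open>x^q\<close> by \<open>x\<close>, and if they all belong to the submodule for \<open>s + 1\<close>,
  then \<open>\<phi>\<close> exists. Hence every bad \<open>s\<close> is a strict drop in a chain of \<open>V\<close>-submodules of a free module
  whose rank depends only on \<open>P\<close>, \<open>n\<close> and \<open>deg f\<close>. As \<open>V\<close> has finite length, such a chain has boundedly many
  strict drops (\<open>card_not_divides_power_bounded\<close>).
\<close>

section \<open>Artinian local rings have finite length\<close>

definition is_ideal :: "'a::comm_ring_1 set \<Rightarrow> bool" where
  "is_ideal I \<longleftrightarrow> 0 \<in> I \<and> (\<forall>a\<in>I. \<forall>b\<in>I. a + b \<in> I) \<and> (\<forall>c. \<forall>a\<in>I. c * a \<in> I)"

lemma is_idealD:
  assumes "is_ideal I"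
  shows "0 \<in> I" "\<And>a b. a \<in> I \<Longrightarrow> b \<in> I \<Longrightarrow> a + b \<in> I" "\<And>c a. a \<in> I \<Longrightarrow> c * a \<in> I"
  using assms by (auto simp: is_ideal_def)

lemma is_ideal_diff:
  assumes "is_ideal I" "a \<in> I" "b \<in> I"
  shows "a - b \<in> I"
  using is_idealD(2)[OF assms(1,2) is_idealD(3)[OF assms(1,3), of "-1"]] by simp

lemma cls_ring_simps [simp]:
  "carrier cls_ring = UNIV" "a \<otimes>\<^bsub>cls_ring\<^esub> b = a * b" "\<one>\<^bsub>cls_ring\<^esub> = 1"
  "\<zero>\<^bsub>cls_ring\<^esub> = 0" "a \<oplus>\<^bsub>cls_ring\<^esub> b = a + b"
  by (simp_all add: ring_of_type_algebra_def)

lemma ideal_cls_ring_iff: "ideal I (cls_ring :: 'a::comm_ring_1 ring) \<longleftrightarrow> is_ideal I"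
proof
  assume "ideal I (cls_ring :: 'a ring)"
  then interpret ideal I "cls_ring :: 'a ring" .
  show "is_ideal I"
    unfolding is_ideal_def
    using additive_subgroup.zero_closed[OF is_additive_subgroup]
      additive_subgroup.a_closed[OF is_additive_subgroup] I_l_closed by auto
next
  assume I: "is_ideal I"
  interpret cring "cls_ring :: 'a ring" by (rule cring_from_type_algebra)
  have inv: "inv\<^bsub>add_monoid (cls_ring :: 'a ring)\<^esub> a = - a" for a :: 'a
    using minus_equality[of "- a" a] by (simp add: a_inv_def)
  show "ideal I (cls_ring :: 'a ring)"
  proof (rule idealI)
    show "ring (cls_ring :: 'a ring)" by (rule ring_axioms)
    show "subgroup I (add_monoid (cls_ring :: 'a ring))"
    proof (rule subgroup.intro)
      show "inv\<^bsub>add_monoid (cls_ring :: 'a ring)\<^esub> a \<in> I" if "a \<in> I" for a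
        unfolding inv using is_idealD(3)[OF I that, of "-1"] by simp
    qed (use I in \<open>auto simp: is_ideal_def\<close>)
  qed (use is_idealD(3)[OF I] in \<open>simp_all add: mult.commute\<close>)
qed

lemma is_ideal_Int: "is_ideal I \<Longrightarrow> is_ideal J \<Longrightarrow> is_ideal (I \<inter> J)"
  by (simp add: is_ideal_def)

lemma is_ideal_sum:
  assumes "is_ideal I" "is_ideal J"
  shows "is_ideal {a + b | a b. a \<in> I \<and> b \<in> J}"
  unfolding is_ideal_def
proof (intro conjI ballI allI)
  show "0 \<in> {a + b | a b. a \<in> I \<and> b \<in> J}"
    using is_idealD(1)[OF assms(1)] is_idealD(1)[OF assms(2)] by force
next
  fix u v assume "u \<in> {a + b | a b. a \<in> I \<and> b \<in> J}" "v \<in> {a + b | a b. a \<in> I \<and> b \<in> J}"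
  then obtain a b a' b' where "u = a + b" "v = a' + b'" "a \<in> I" "b \<in> J" "a' \<in> I" "b' \<in> J" by auto
  moreover from this have "u + v = (a + a') + (b + b')" by (simp add: algebra_simps)
  ultimately show "u + v \<in> {a + b | a b. a \<in> I \<and> b \<in> J}"
    using is_idealD(2)[OF assms(1)] is_idealD(2)[OF assms(2)] by blast
next
  fix c u assume "u \<in> {a + b | a b. a \<in> I \<and> b \<in> J}"
  then obtain a b where "u = a + b" "a \<in> I" "b \<in> J" by auto
  moreover from this have "c * u = c * a + c * b" by (simp add: algebra_simps)
  ultimately show "c * u \<in> {a + b | a b. a \<in> I \<and> b \<in> J}"
    using is_idealD(3)[OF assms(1)] is_idealD(3)[OF assms(2)] by blast
qed

lemma is_ideal_principal: "is_ideal (range (\<lambda>c. c * a))"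
  unfolding is_ideal_def
proof (intro conjI ballI allI)
  show "0 \<in> range (\<lambda>c. c * a)" by (rule image_eqI[of _ _ 0]) auto
next
  fix u v assume "u \<in> range (\<lambda>c. c * a)" "v \<in> range (\<lambda>c. c * a)"
  then obtain c d where "u = c * a" "v = d * a" by auto
  then show "u + v \<in> range (\<lambda>c. c * a)" by (intro image_eqI[of _ _ "c + d"]) (auto simp: algebra_simps)
next
  fix c u assume "u \<in> range (\<lambda>c. c * a)"
  then obtain d where "u = d * a" by auto
  then show "c * u \<in> range (\<lambda>c. c * a)" by (intro image_eqI[of _ _ "c * d"]) (auto simp: algebra_simps)
qed

text \<open>
  Zorn's lemma. For \<open>x = 1\<close> this produces maximal ideals; for \<open>A\<close> and \<open>x\<close> inside an ideal \<open>I\<close> with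
  \<open>I/A\<close> a vector space over the residue field, it produces a hyperplane \<open>B \<inter> I\<close> of \<open>I\<close>.
\<close>

lemma exists_ideal_maximal_avoiding:
  assumes "is_ideal A" "x \<notin> A"
  obtains B where "is_ideal B" "A \<subseteq> B" "x \<notin> B"
    "\<And>B'. is_ideal B' \<Longrightarrow> B \<subseteq> B' \<Longrightarrow> x \<notin> B' \<Longrightarrow> B' = B"
proof -
  define F where "F = {B. is_ideal B \<and> A \<subseteq> B \<and> x \<notin> B}"
  have "\<exists>M\<in>F. \<forall>Y\<in>F. M \<subseteq> Y \<longrightarrow> Y = M"
  proof (rule subset_Zorn_nonempty)
    fix C assume "C \<noteq> {}" and C: "subset.chain F C"
    show "\<Union>C \<in> F"
    proof -
      have mem: "is_ideal B \<and> A \<subseteq> B \<and> x \<notin> B" if "B \<in> C" for B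
        using C that by (auto simp: subset_chain_def F_def)
      have lin: "B \<subseteq> B' \<or> B' \<subseteq> B" if "B \<in> C" "B' \<in> C" for B B'
        using C that by (auto simp: subset_chain_def)
      have "is_ideal (\<Union>C)"
        unfolding is_ideal_def
      proof (intro conjI ballI allI)
        show "0 \<in> \<Union>C" using \<open>C \<noteq> {}\<close> mem is_idealD(1) by blast
      next
        fix a b assume "a \<in> \<Union>C" "b \<in> \<Union>C"
        then obtain B B' where B: "B \<in> C" "a \<in> B" "B' \<in> C" "b \<in> B'" by auto
        with lin[of B B'] mem show "a + b \<in> \<Union>C"
          by (meson UnionI is_idealD(2) subsetD)
      next
        fix c a assume "a \<in> \<Union>C"
        then show "c * a \<in> \<Union>C" using mem is_idealD(3) by (meson UnionE UnionI)
      qed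
      with \<open>C \<noteq> {}\<close> mem show ?thesis unfolding F_def by blast
    qed
  next
    show "F \<noteq> {}" using assms by (auto simp: F_def)
  qed
  then obtain B where "B \<in> F" "\<forall>Y\<in>F. B \<subseteq> Y \<longrightarrow> Y = B" by blast
  then show ?thesis by (intro that[of B]) (auto simp: F_def)
qed

lemma local_ring_unit:
  assumes "local_ring_with (cls_ring :: 'v::comm_ring_1 ring) \<mm>" "a \<notin> \<mm>"
  shows "\<exists>b. b * a = 1"
proof (rule ccontr)
  assume no: "\<nexists>b. b * a = 1"
  then have "1 \<notin> range (\<lambda>c. c * a)" by force
  then obtain B where B: "is_ideal B" "range (\<lambda>c. c * a) \<subseteq> B" "1 \<notin> B"
    "\<And>B'. is_ideal B' \<Longrightarrow> B \<subseteq> B' \<Longrightarrow> 1 \<notin> B' \<Longrightarrow> B' = B"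
    using exists_ideal_maximal_avoiding[OF is_ideal_principal] by metis
  have one: "1 \<in> J \<Longrightarrow> is_ideal J \<Longrightarrow> J = UNIV" for J :: "'v set"
    using is_idealD(3)[of J 1] by force
  have "maximalideal B cls_ring"
  proof (rule maximalidealI)
    show "ideal B cls_ring" using B(1) by (simp add: ideal_cls_ring_iff)
    show "carrier cls_ring \<noteq> B" using B(3) by auto
    fix J assume "ideal J cls_ring" "B \<subseteq> J" "J \<subseteq> carrier cls_ring"
    then show "J = B \<or> J = carrier cls_ring" using B(4)[of J] one[of J] by (auto simp: ideal_cls_ring_iff)
  qed
  then have "B = \<mm>" using assms(1) by (simp add: local_ring_with_def)
  moreover have "a \<in> B" using B(2) by (metis mult_1 rangeI subsetD)
  ultimately show False using assms(2) by simp
qed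

lemma local_ring_max_ideal:
  assumes "local_ring_with (cls_ring :: 'v::comm_ring_1 ring) \<mm>"
  shows "is_ideal \<mm>" "1 \<notin> \<mm>"
proof -
  interpret maximalideal \<mm> "cls_ring :: 'v ring" using assms by (simp add: local_ring_with_def)
  show I: "is_ideal \<mm>" using ideal_axioms by (simp add: ideal_cls_ring_iff)
  show "1 \<notin> \<mm>" using I_notcarr is_idealD(3)[OF I, of 1] by force
qed

text \<open>
  Nakayama's lemma for a principal ideal: the factor \<open>1 - y\<close> is a unit.
\<close>

lemma local_ring_one_minus:
  assumes "local_ring_with (cls_ring :: 'v::comm_ring_1 ring) \<mm>" "y \<in> \<mm>" "a = a * y"
  shows "a = 0"
proof -
  have "1 - y \<notin> \<mm>"
    using local_ring_max_ideal[OF assms(1)] assms(2) is_idealD(2)[of \<mm> "1 - y" y] by auto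
  then obtain b where "b * (1 - y) = 1" using local_ring_unit[OF assms(1)] by blast
  moreover have "a * (1 - y) = 0" using assms(3) by (simp add: algebra_simps)
  ultimately have "a * (b * (1 - y)) = 0" by (metis mult.left_commute mult_zero_right)
  with \<open>b * (1 - y) = 1\<close> show ?thesis by simp
qed

lemma artinian_minimal_ideal:
  fixes I :: "'v::comm_ring_1 set"
  assumes "artinian_ring (cls_ring :: 'v ring)"
    and "is_ideal I" "P I"
  obtains J where "is_ideal J" "P J" "\<And>J'. is_ideal J' \<Longrightarrow> P J' \<Longrightarrow> J' \<subseteq> J \<Longrightarrow> J' = J"
proof (rule ccontr)
  assume contr: "\<not> thesis"
  note min = that
  let ?Q = "\<lambda>J :: 'v set. is_ideal J \<and> P J"
  have "\<exists>J'. ?Q J' \<and> J' \<subset> J" if "?Q J" for J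
    using contr min[of J] that by (metis psubsetI)
  then obtain g where g: "\<And>J. ?Q J \<Longrightarrow> ?Q (g J) \<and> g J \<subset> J" by metis
  define s where "s k = (g ^^ k) I" for k
  have s: "?Q (s k)" for k
    by (induction k) (use assms(2,3) g in \<open>auto simp: s_def\<close>)
  have strict: "s (Suc k) \<subset> s k" for k
    using g[OF s[of k]] by (simp add: s_def)
  have "\<exists>N. \<forall>k\<ge>N. s k = s N"
    using assms(1) s strict unfolding artinian_ring_def ideal_cls_ring_iff by blast
  then obtain N where "s (Suc N) = s N" by (meson le_SucI order_refl)
  with strict[of N] show False by simp
qed

text \<open>
  That is, \<open>\<mm> I \<noteq> I\<close>, by Nakayama's argument with minimal ideals in place of generators. If \<open>\<mm> I = I\<close>, take an ideal \<open>J\<close>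
  that is minimal with \<open>J I \<noteq> 0\<close>. It is generated by any \<open>x \<in> J\<close> with \<open>x I \<noteq> 0\<close>, and \<open>x \<mm> I = x I \<noteq> 0\<close> shows that
  already some \<open>x a\<close> with \<open>a \<in> \<mm>\<close> generates it, so \<open>x = x a c\<close> and \<open>x = 0\<close>.
\<close>

lemma max_ideal_mult_proper:
  assumes loc: "local_ring_with (cls_ring :: 'v::comm_ring_1 ring) \<mm>"
    and art: "artinian_ring (cls_ring :: 'v ring)"
    and I: "is_ideal I" "I \<noteq> {0}"
  shows "\<exists>A. is_ideal A \<and> A \<subset> I \<and> (\<forall>a\<in>\<mm>. \<forall>b\<in>I. a * b \<in> A)"
proof (rule ccontr)
  assume no: "\<not> ?thesis"
  then have gen: "I \<subseteq> A" if "is_ideal A" "\<forall>a\<in>\<mm>. \<forall>b\<in>I. a * b \<in> A" for A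
    using that is_ideal_Int[OF that(1) I(1)] is_idealD(3)[OF I(1)]
    by (metis Int_iff Int_lower2 Int_subset_iff order_refl psubsetI)
  have annih: "\<forall>b\<in>I. x * b = 0" if "\<forall>a\<in>\<mm>. \<forall>b\<in>I. x * a * b = 0" for x
    using gen[of "{b. x * b = 0}"] that by (auto simp: is_ideal_def algebra_simps)
  let ?P = "\<lambda>J. \<exists>a\<in>J. \<exists>b\<in>I. a * b \<noteq> 0"
  have "\<exists>b\<in>I. b \<noteq> 0" using I is_idealD(1) by blast
  then have PU: "?P UNIV" by (metis UNIV_I mult_1)
  have U: "is_ideal (UNIV :: 'v set)" by (simp add: is_ideal_def)
  obtain J where J: "is_ideal J" "?P J" "\<And>J'. is_ideal J' \<Longrightarrow> ?P J' \<Longrightarrow> J' \<subseteq> J \<Longrightarrow> J' = J"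
    by (rule artinian_minimal_ideal[where P = ?P, OF art U PU]) (rule that)
  obtain x b where x: "x \<in> J" "b \<in> I" "x * b \<noteq> 0" using J(2) by blast
  obtain a b' where ab: "a \<in> \<mm>" "b' \<in> I" "x * a * b' \<noteq> 0" using annih[of x] x by blast
  have "range (\<lambda>c. c * (x * a)) = J"
  proof (rule J(3)[OF is_ideal_principal])
    show "?P (range (\<lambda>c. c * (x * a)))" using ab by (metis mult_1 rangeI)
    show "range (\<lambda>c. c * (x * a)) \<subseteq> J"
    proof
      fix z assume "z \<in> range (\<lambda>c. c * (x * a))"
      then obtain c where "z = (c * a) * x" by (auto simp: algebra_simps)
      then show "z \<in> J" using is_idealD(3)[OF J(1) x(1)] by simp
    qed
  qed
  then obtain c where "x = c * (x * a)" using x(1) by blast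
  then have "x = x * (c * a)" by (simp add: algebra_simps)
  then have "x = 0"
    using local_ring_one_minus[OF loc] is_idealD(3)[OF local_ring_max_ideal(1)[OF loc] ab(1)] by blast
  with x(3) show False by simp
qed

text \<open>
  The hypothesis \<open>simple\<close> says that \<open>I/I'\<close> is a simple module. An ideal \<open>A\<close> that contains \<open>I'\<close> is determined,
  among the ideals below or above it, by \<open>A + I\<close> and by whether \<open>A \<inter> I\<close> is \<open>I\<close> or \<open>I'\<close>; a strictly
  monotone function on the ideals above \<open>I\<close> is therefore easily extended to those above \<open>I'\<close>.
\<close>

lemma ideal_extension_rank:
  assumes I: "is_ideal I" and I': "is_ideal I'" "I' \<subseteq> I"
    and simple: "\<And>A y. is_ideal A \<Longrightarrow> I' \<subseteq> A \<Longrightarrow> y \<in> A \<Longrightarrow> y \<in> I \<Longrightarrow> y \<notin> I' \<Longrightarrow> I \<subseteq> A"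
    and \<rho>: "\<And>A B. is_ideal A \<Longrightarrow> is_ideal B \<Longrightarrow> I \<subseteq> A \<Longrightarrow> A \<subset> B \<Longrightarrow> (\<rho> A :: nat) < \<rho> B"
    and A: "is_ideal A" "I' \<subseteq> A" and B: "is_ideal B" "A \<subset> B"
  defines "\<rho>' \<equiv> \<lambda>A. \<rho> {a + b | a b. a \<in> A \<and> b \<in> I} + (if I \<subseteq> A then 1 else 0)"
  shows "\<rho>' A < \<rho>' B"
proof -
  let ?S = "\<lambda>A. {a + b | a b. a \<in> A \<and> b \<in> I}"
  have SI: "is_ideal (?S A)" "is_ideal (?S B)" using A B I is_ideal_sum by blast+
  have sub: "?S A \<subseteq> ?S B" using B by blast
  have "b \<in> ?S A" if "b \<in> I" for b
    using that is_idealD(1)[OF A(1)] by force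
  then have IA: "I \<subseteq> ?S A" by blast
  have mono1: "I \<subseteq> A \<Longrightarrow> I \<subseteq> B" using B by blast
  show ?thesis
  proof (cases "?S A = ?S B")
    case False
    with \<rho>[OF SI IA] sub have "\<rho> (?S A) < \<rho> (?S B)" by blast
    with mono1 show ?thesis by (auto simp: \<rho>'_def)
  next
    case eq: True
    have "I \<subseteq> B \<and> \<not> I \<subseteq> A"
    proof (rule ccontr)
      assume c: "\<not> (I \<subseteq> B \<and> \<not> I \<subseteq> A)"
      have "B \<subseteq> A"
      proof
        fix y assume y: "y \<in> B"
        then have "y \<in> ?S B" using is_idealD(1)[OF I] by force
        then obtain a b where ab: "y = a + b" "a \<in> A" "b \<in> I" unfolding eq[symmetric] by blast
        have "y - a \<in> B" using is_ideal_diff[OF B(1) y] ab(2) B(2) by blast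
        then have "b \<in> B" using ab by simp
        have "b \<in> A"
        proof (cases "I \<subseteq> A")
          case False
          then have "\<not> I \<subseteq> B" using c by blast
          then have "b \<in> I'" using simple[OF B(1), of b] \<open>b \<in> B\<close> ab(3) A(2) B(2) by blast
          then show ?thesis using A(2) by blast
        qed (use ab in blast)
        then show "y \<in> A" using ab is_idealD(2)[OF A(1)] by blast
      qed
      with B(2) show False by blast
    qed
    with eq show ?thesis by (simp add: \<rho>'_def)
  qed
qed

text \<open>
  \<open>V\<close> has finite length. Choose \<open>I\<close> minimal such that a rank function exists on the ideals that contain
  \<open>I\<close>. If \<open>I \<noteq> 0\<close>, then \<open>\<mm> I \<noteq> I\<close>, and a hyperplane of \<open>I\<close> that contains \<open>\<mm> I\<close> contradicts minimality.
\<close>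

lemma artinian_local_ideal_rank:
  fixes \<mm> :: "'v::comm_ring_1 set"
  assumes loc: "local_ring_with (cls_ring :: 'v ring) \<mm>"
    and art: "artinian_ring (cls_ring :: 'v ring)"
  obtains \<rho> :: "'v set \<Rightarrow> nat" where "\<And>A B. is_ideal A \<Longrightarrow> is_ideal B \<Longrightarrow> A \<subset> B \<Longrightarrow> \<rho> A < \<rho> B"
proof -
  let ?P = "\<lambda>I :: 'v set. \<exists>\<rho> :: 'v set \<Rightarrow> nat.
    \<forall>A B. is_ideal A \<longrightarrow> is_ideal B \<longrightarrow> I \<subseteq> A \<longrightarrow> A \<subset> B \<longrightarrow> \<rho> A < \<rho> B"
  have U: "is_ideal (UNIV :: 'v set)" by (simp add: is_ideal_def)
  have PU: "?P UNIV" by blast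
  obtain I where I: "is_ideal I" "?P I" "\<And>J. is_ideal J \<Longrightarrow> ?P J \<Longrightarrow> J \<subseteq> I \<Longrightarrow> J = I"
    by (rule artinian_minimal_ideal[where P = ?P, OF art U PU]) (rule that)
  have "I = {0}"
  proof (rule ccontr)
    assume "I \<noteq> {0}"
    then obtain A where A: "is_ideal A" "A \<subset> I" "\<forall>a\<in>\<mm>. \<forall>b\<in>I. a * b \<in> A"
      using max_ideal_mult_proper[OF loc art I(1)] by blast
    then obtain x where x: "x \<in> I" "x \<notin> A" by blast
    obtain B where B: "is_ideal B" "A \<subseteq> B" "x \<notin> B"
      "\<And>B'. is_ideal B' \<Longrightarrow> B \<subseteq> B' \<Longrightarrow> x \<notin> B' \<Longrightarrow> B' = B"
      by (rule exists_ideal_maximal_avoiding[OF A(1) x(2)]) (rule that)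
    have simple: "I \<subseteq> C" if C: "is_ideal C" "B \<inter> I \<subseteq> C" "y \<in> C" "y \<in> I" "y \<notin> B \<inter> I" for C y
    proof -
      \<comment> \<open>modulo \<open>B\<close>, every nonzero element of \<open>I\<close> is a unit multiple of \<open>x\<close>\<close>
      have ux: "\<exists>u. \<exists>v. u * v = 1 \<and> x - u * z \<in> B" if z: "z \<in> I" "z \<notin> B" for z
      proof -
        let ?T = "{a + b | a b. a \<in> B \<and> b \<in> range (\<lambda>c. c * z)}"
        have T: "is_ideal ?T" by (rule is_ideal_sum[OF B(1) is_ideal_principal])
        have "B \<subseteq> ?T" by (force intro: image_eqI[of _ _ 0])
        moreover have "z \<in> ?T" using is_idealD(1)[OF B(1)] by (force intro: image_eqI[of _ _ 1])
        ultimately have "x \<in> ?T" using B(4)[OF T] z(2) by blast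
        then obtain a u where au: "x = a + u * z" "a \<in> B" by auto
        have "u \<notin> \<mm>"
        proof
          assume "u \<in> \<mm>"
          then have "u * z \<in> B" using A(3) z(1) B(2) by blast
          then show False using au B(3) is_idealD(2)[OF B(1)] by blast
        qed
        then obtain v where "v * u = 1" using local_ring_unit[OF loc] by blast
        with au show ?thesis by (metis add_diff_cancel_right' mult.commute)
      qed
      \<comment> \<open>so an ideal that contains one element \<open>y\<close> of \<open>I\<close> outside \<open>B\<close> contains \<open>x\<close>, and then all others\<close>
      obtain u where u: "x - u * y \<in> B" using ux C(4,5) by blast
      have "x - u * y \<in> I" using is_ideal_diff[OF I(1) x(1)] is_idealD(3)[OF I(1) C(4)] by blast
      with u C(2) have "x - u * y \<in> C" by blast
      from is_idealD(2)[OF C(1) this is_idealD(3)[OF C(1,3), of u]] have xC: "x \<in> C" by simp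
      show "I \<subseteq> C"
      proof
        fix z assume z: "z \<in> I"
        show "z \<in> C"
        proof (cases "z \<in> B")
          case False
          then obtain u v where uv: "u * v = 1" "x - u * z \<in> B" using ux z by blast
          have "x - u * z \<in> C"
            using is_ideal_diff[OF I(1) x(1)] is_idealD(3)[OF I(1) z] uv(2) C(2) by blast
          then have "x - (x - u * z) \<in> C" using is_ideal_diff[OF C(1) xC] by blast
          then have "v * (u * z) \<in> C" using is_idealD(3)[OF C(1)] by simp
          moreover have "v * (u * z) = (u * v) * z" by (simp add: algebra_simps)
          ultimately show ?thesis using uv(1) by simp
        qed (use z C(2) in blast)
      qed
    qed
    obtain \<rho> :: "'v set \<Rightarrow> nat" where
      \<rho>: "\<And>A B. is_ideal A \<Longrightarrow> is_ideal B \<Longrightarrow> I \<subseteq> A \<Longrightarrow> A \<subset> B \<Longrightarrow> \<rho> A < \<rho> B"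
      using I(2) by blast
    have "?P (B \<inter> I)"
    proof (intro exI allI impI)
      fix A C assume "is_ideal A" "is_ideal C" "B \<inter> I \<subseteq> A" "A \<subset> C"
      then show "\<rho> {a + b | a b. a \<in> A \<and> b \<in> I} + (if I \<subseteq> A then 1 else 0)
          < \<rho> {a + b | a b. a \<in> C \<and> b \<in> I} + (if I \<subseteq> C then 1 else 0)"
        by (intro ideal_extension_rank[OF I(1) is_ideal_Int[OF B(1) I(1)] _ simple \<rho>]) blast+
    qed
    then have "B \<inter> I = I" using I(3)[of "B \<inter> I"] is_ideal_Int[OF B(1) I(1)] by blast
    with x B(3) show False by blast
  qed
  with I(2) that show ?thesis
    by (metis is_idealD(1) empty_subsetI insert_subset)
qed

lemma artinian_local_nilpotent:
  assumes loc: "local_ring_with (cls_ring :: 'v::comm_ring_1 ring) \<mm>"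
    and art: "artinian_ring (cls_ring :: 'v ring)"
    and a: "a \<in> \<mm>"
  obtains M where "a ^ M = 0"
proof -
  obtain J where J: "is_ideal J" "\<exists>k. a ^ k \<in> J"
    "\<And>J'. is_ideal J' \<Longrightarrow> \<exists>k. a ^ k \<in> J' \<Longrightarrow> J' \<subseteq> J \<Longrightarrow> J' = J"
    using artinian_minimal_ideal[OF art, of UNIV "\<lambda>J. \<exists>k. a ^ k \<in> J"] by (auto simp: is_ideal_def)
  then obtain k where k: "a ^ k \<in> J" by blast
  have "range (\<lambda>c. c * a ^ Suc k) = J"
  proof (rule J(3)[OF is_ideal_principal])
    show "\<exists>j. a ^ j \<in> range (\<lambda>c. c * a ^ Suc k)" by (metis mult_1 rangeI)
    show "range (\<lambda>c. c * a ^ Suc k) \<subseteq> J"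
      using is_idealD(3)[OF J(1) k] by (auto simp flip: mult.assoc)
  qed
  then obtain c where "a ^ k = c * a ^ Suc k" using k by blast
  then have "a ^ k = a ^ k * (c * a)" by (simp add: algebra_simps)
  then have "a ^ k = 0"
    using local_ring_one_minus[OF loc] is_idealD(3)[OF local_ring_max_ideal(1)[OF loc] a] by blast
  with that show ?thesis by blast
qed

lemma residue_characteristic:
  assumes loc: "local_ring_with (cls_ring :: 'v::comm_ring_1 ring) \<mm>"
    and p: "p = ring_characteristic ((cls_ring :: 'v ring) Quot \<mm>)" "p > 0"
  shows "prime p" "of_nat p \<in> \<mm>"
proof -
  interpret cring "cls_ring :: 'v ring" by (rule cring_from_type_algebra)
  interpret maximalideal \<mm> "cls_ring :: 'v ring" using loc by (simp add: local_ring_with_def)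
  interpret Q: Ring.field "(cls_ring :: 'v ring) Quot \<mm>"
    using maximalideal_axioms by (rule maximalideal.quotient_is_field[OF _ cring_axioms])
  have pw: "\<one>\<^bsub>(cls_ring :: 'v ring) Quot \<mm>\<^esub> [^]\<^bsub>add_monoid ((cls_ring :: 'v ring) Quot \<mm>)\<^esub> k = \<mm> +>\<^bsub>cls_ring\<^esub> of_nat k"
    for k :: nat
  proof (induction k)
    case 0
    have "\<mm> +>\<^bsub>cls_ring\<^esub> (\<zero>\<^bsub>cls_ring :: 'v ring\<^esub>) = \<mm>" by (rule a_coset_add_zero) (rule a_subset)
    then show ?case by (simp add: FactRing_def)
  next
    case (Suc k)
    have "(\<mm> +>\<^bsub>cls_ring\<^esub> of_nat k) <+>\<^bsub>cls_ring\<^esub> (\<mm> +>\<^bsub>cls_ring\<^esub> (1 :: 'v)) = \<mm> +>\<^bsub>cls_ring\<^esub> (of_nat k \<oplus>\<^bsub>cls_ring\<^esub> 1)"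
      by (rule a_rcos_sum) auto
    with Suc show ?case by (simp add: FactRing_def add.commute)
  qed
  have zero: "\<mm> +>\<^bsub>cls_ring\<^esub> a = \<mm> \<longleftrightarrow> a \<in> \<mm>" for a :: 'v
    using a_rcos_const[of a] a_rcos_self[of a] by auto
  have iff: "of_nat k \<in> \<mm> \<longleftrightarrow> p dvd k" for k
  proof -
    have "\<one>\<^bsub>(cls_ring :: 'v ring) Quot \<mm>\<^esub> [^]\<^bsub>add_monoid ((cls_ring :: 'v ring) Quot \<mm>)\<^esub> k = \<one>\<^bsub>add_monoid ((cls_ring :: 'v ring) Quot \<mm>)\<^esub> \<longleftrightarrow> p dvd k"
      unfolding p(1) ring_characteristic_def
      by (rule group.pow_eq_id[OF Q.add.is_group]) simp
    then show ?thesis unfolding pw using zero by (simp add: FactRing_def)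
  qed
  show "of_nat p \<in> \<mm>" by (simp add: iff)
  have I: "is_ideal \<mm>" "1 \<notin> \<mm>" using local_ring_max_ideal[OF loc] .
  show "prime p"
  proof (rule prime_natI)
    show "p \<ge> 2"
    proof (rule ccontr)
      assume "\<not> p \<ge> 2"
      with p(2) have "p = 1" by simp
      then show False using iff[of 1] I by simp
    qed
    fix k j assume "p dvd k * j"
    then have *: "of_nat k * of_nat j \<in> \<mm>" by (simp add: iff flip: of_nat_mult)
    have "of_nat k \<in> \<mm> \<or> of_nat j \<in> \<mm>"
    proof (rule ccontr)
      assume c: "\<not> ?thesis"
      obtain b where b: "b * (of_nat k :: 'v) = 1" using local_ring_unit[OF loc] c by blast
      have "b * (of_nat k * of_nat j) \<in> \<mm>" using is_idealD(3)[OF I(1) *] .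
      then have "of_nat j \<in> \<mm>" using b by (simp flip: mult.assoc)
      with c show False by blast
    qed
    then show "p dvd k \<or> p dvd j" by (simp add: iff)
  qed
qed


section \<open>Powers in rings where \<open>p\<close> is nilpotent\<close>

lemma dvd_power_diff: "(d :: 'a::comm_ring_1) dvd a - b \<Longrightarrow> d dvd a ^ m - b ^ m"
  by (metis dvd_mult2 power_diff_sumr2)

lemma binomial_mod_square:
  fixes b c :: "'a::comm_ring_1"
  shows "c\<^sup>2 dvd (b + c) ^ m - b ^ m - of_nat m * b ^ (m - 1) * c"
proof (induction m)
  case (Suc m)
  then obtain h where h: "(b + c) ^ m = b ^ m + of_nat m * b ^ (m - 1) * c + c\<^sup>2 * h"
    by (auto simp: algebra_simps elim!: dvdE)
  have b: "of_nat m * b ^ (m - 1) * b = of_nat m * b ^ m" by (cases m) (auto simp: algebra_simps)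
  have "(b + c) ^ Suc m - b ^ Suc m - of_nat (Suc m) * b ^ (Suc m - 1) * c
    = (of_nat m * b ^ (m - 1) * b - of_nat m * b ^ m) * c + c\<^sup>2 * (b * h + of_nat m * b ^ (m - 1) + c * h)"
    by (simp add: h algebra_simps power2_eq_square)
  then show ?case unfolding b by simp
qed simp

lemma prime_dvd_power_sum:
  fixes a b :: "'a::comm_ring_1"
  assumes "prime p"
  shows "of_nat p dvd (a + b) ^ p ^ N - a ^ p ^ N - b ^ p ^ N"
proof (induction N)
  case (Suc N)
  let ?A = "a ^ p ^ N" and ?B = "b ^ p ^ N"
  have p: "p > 0" using assms by (rule prime_gt_0_nat)
  have "(\<Sum>k\<le>p. of_nat (p choose k) * ?A ^ k * ?B ^ (p - k))
      = ?B ^ p + ?A ^ p + (\<Sum>k\<in>{0<..<p}. of_nat (p choose k) * ?A ^ k * ?B ^ (p - k))"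
  proof -
    have "{..p} = insert 0 (insert p {0<..<p})" using p by auto
    then show ?thesis using p by simp
  qed
  then have "(?A + ?B) ^ p - ?A ^ p - ?B ^ p = (\<Sum>k\<in>{0<..<p}. of_nat (p choose k) * ?A ^ k * ?B ^ (p - k))"
    by (simp add: binomial_ring)
  moreover have "of_nat p dvd \<dots>"
  proof (rule dvd_sum)
    fix k assume "k \<in> {0<..<p}"
    then have "p dvd (p choose k)" using assms by (intro dvd_choose_prime) auto
    then show "of_nat p dvd of_nat (p choose k) * ?A ^ k * ?B ^ (p - k)"
      by (auto elim!: dvdE simp: mult.assoc)
  qed
  ultimately have 1: "of_nat p dvd (?A + ?B) ^ p - ?A ^ p - ?B ^ p" by simp
  have "of_nat p dvd (a + b) ^ p ^ N - (?A + ?B)" using Suc by (simp add: algebra_simps)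
  then have 2: "of_nat p dvd ((a + b) ^ p ^ N) ^ p - (?A + ?B) ^ p" by (rule dvd_power_diff)
  have "((a + b) ^ p ^ N) ^ p - ?A ^ p - ?B ^ p
      = (((a + b) ^ p ^ N) ^ p - (?A + ?B) ^ p) + ((?A + ?B) ^ p - ?A ^ p - ?B ^ p)" by simp
  then have "of_nat p dvd ((a + b) ^ p ^ N) ^ p - ?A ^ p - ?B ^ p" using 1 2 by (simp only: dvd_add)
  then show ?case by (simp add: power_mult mult.commute[of p] flip: power_mult)
qed simp

text \<open>
  In \<open>(b + c)^(p^M)\<close> the term linear in \<open>c\<close> vanishes, so each passage to \<open>p^M\<close>-th powers squares the known
  divisor of the difference.
\<close>

lemma power_dvd_prime_power_diff:
  fixes a b :: "'a::comm_ring_1"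
  assumes "(of_nat p :: 'a) ^ M = 0"
  shows "(a - b) ^ 2 ^ j dvd a ^ p ^ (M * j) - b ^ p ^ (M * j)"
proof (induction j)
  case (Suc j)
  let ?A = "a ^ p ^ (M * j)" and ?B = "b ^ p ^ (M * j)"
  have "(?A - ?B)\<^sup>2 dvd (?B + (?A - ?B)) ^ p ^ M - ?B ^ p ^ M - of_nat (p ^ M) * ?B ^ (p ^ M - 1) * (?A - ?B)"
    by (rule binomial_mod_square)
  then have "(?A - ?B)\<^sup>2 dvd ?A ^ p ^ M - ?B ^ p ^ M" using assms by simp
  moreover have "((a - b) ^ 2 ^ j)\<^sup>2 dvd (?A - ?B)\<^sup>2" using Suc by (rule dvd_power_same)
  ultimately have "((a - b) ^ 2 ^ j)\<^sup>2 dvd ?A ^ p ^ M - ?B ^ p ^ M" by (rule dvd_trans[rotated])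
  then show ?case by (simp add: power_add mult.commute flip: power_mult)
qed simp

lemma prime_dvd_power_of_sum:
  fixes g :: "'b \<Rightarrow> 'a::comm_ring_1"
  assumes "prime p"
  shows "of_nat p dvd (\<Sum>a\<in>A. g a) ^ p ^ e - (\<Sum>a\<in>A. g a ^ p ^ e)"
proof (induction A rule: infinite_finite_induct)
  case (insert a A)
  let ?q = "p ^ e"
  have "(\<Sum>a\<in>insert a A. g a) ^ ?q - (\<Sum>a\<in>insert a A. g a ^ ?q)
      = ((g a + sum g A) ^ ?q - g a ^ ?q - sum g A ^ ?q) + (sum g A ^ ?q - (\<Sum>a\<in>A. g a ^ ?q))"
    using insert.hyps by simp
  then show ?case using prime_dvd_power_sum[OF assms, of "g a" "sum g A" e] insert.IH by (simp only: dvd_add)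
qed (use assms in \<open>simp_all add: power_0_left prime_gt_0_nat\<close>)

text \<open>
  Each \<open>p\<close>-th power improves a congruence modulo \<open>p^k\<close> to one modulo \<open>p^(k+1)\<close>.
\<close>

lemma prime_power_dvd_power_diff:
  fixes a b :: "'a::comm_ring_1"
  assumes "of_nat p dvd a - b"
  shows "of_nat p ^ Suc k dvd a ^ p ^ k - b ^ p ^ k"
proof (induction k)
  case (Suc k)
  let ?A = "a ^ p ^ k" and ?B = "b ^ p ^ k"
  let ?c = "?A - ?B"
  have sq: "?c\<^sup>2 dvd (?B + ?c) ^ p - ?B ^ p - of_nat p * ?B ^ (p - 1) * ?c"
    by (rule binomial_mod_square)
  have "of_nat p ^ Suc (Suc k) dvd (of_nat p ^ Suc k :: 'a)\<^sup>2"
    unfolding power_mult[symmetric] by (rule le_imp_power_dvd) simp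
  also have "\<dots> dvd ?c\<^sup>2" using Suc by (rule dvd_power_same)
  finally have 1: "of_nat p ^ Suc (Suc k) dvd (?B + ?c) ^ p - ?B ^ p - of_nat p * ?B ^ (p - 1) * ?c"
    using sq dvd_trans by blast
  have "of_nat p * of_nat p ^ Suc k dvd of_nat p * ?c" using Suc by (rule mult_dvd_mono[OF dvd_refl])
  then have "of_nat p ^ Suc (Suc k) dvd (of_nat p * ?c) * ?B ^ (p - 1)" by simp
  then have 2: "of_nat p ^ Suc (Suc k) dvd of_nat p * ?B ^ (p - 1) * ?c" by (simp add: mult_ac)
  have "of_nat p ^ Suc (Suc k) dvd ?A ^ p - ?B ^ p" using dvd_add[OF 1 2] by simp
  then show ?case by (simp add: mult.commute flip: power_mult)
qed (use assms in simp)

section \<open>Differential operators and prime powers\<close>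

text \<open>
  The ring \<open>S[Y]\<close> acts on the maps \<open>S \<rightarrow> S\<close>: constants multiply the values and \<open>Y\<close> multiplies the argument by \<open>w\<close>.
  Thus \<open>w - Y\<close> acts as the commutator with \<open>w\<close>, and identities between polynomials become identities
  between iterated commutators.
\<close>

definition poly_act :: "'s::comm_ring_1 \<Rightarrow> 's poly \<Rightarrow> ('s \<Rightarrow> 's) \<Rightarrow> 's \<Rightarrow> 's" where
  "poly_act w g \<phi> y = (\<Sum>i\<le>Polynomial.degree g. poly.coeff g i * \<phi> (w ^ i * y))"

lemma poly_act_upto:
  assumes "Polynomial.degree g \<le> m"
  shows "poly_act w g \<phi> y = (\<Sum>i\<le>m. poly.coeff g i * \<phi> (w ^ i * y))"
  unfolding poly_act_def
  by (rule sum.mono_neutral_left) (use assms in \<open>auto simp: coeff_eq_0\<close>)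

lemma poly_act_0 [simp]: "poly_act w 0 \<phi> y = 0"
  by (simp add: poly_act_def)

lemma poly_act_pCons [simp]: "poly_act w (pCons a g) \<phi> y = a * \<phi> y + poly_act w g \<phi> (w * y)"
proof -
  have "poly_act w (pCons a g) \<phi> y
      = (\<Sum>i\<le>Suc (Polynomial.degree g). poly.coeff (pCons a g) i * \<phi> (w ^ i * y))"
    by (rule poly_act_upto) (simp add: degree_pCons_le)
  also have "\<dots> = a * \<phi> y + (\<Sum>i\<le>Polynomial.degree g. poly.coeff g i * \<phi> (w ^ i * (w * y)))"
    by (subst sum.atMost_Suc_shift) (simp add: algebra_simps)
  finally show ?thesis by (simp add: poly_act_def)
qed

lemma poly_act_add: "poly_act w (g + h) \<phi> y = poly_act w g \<phi> y + poly_act w h \<phi> y"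
proof -
  let ?m = "max (Polynomial.degree g) (Polynomial.degree h)"
  have "Polynomial.degree (g + h) \<le> ?m" by (rule degree_add_le_max)
  then show ?thesis
    by (simp add: poly_act_upto[of _ ?m] distrib_right sum.distrib)
qed

lemma poly_act_smult: "poly_act w (Polynomial.smult a g) \<phi> y = a * poly_act w g \<phi> y"
  by (subst poly_act_upto[of _ "Polynomial.degree g"])
    (auto simp: degree_smult_le poly_act_def sum_distrib_left mult.assoc)

lemma poly_act_mult: "poly_act w (g * h) \<phi> = poly_act w g (poly_act w h \<phi>)"
proof
  show "poly_act w (g * h) \<phi> y = poly_act w g (poly_act w h \<phi>) y" for y
    by (induction g arbitrary: y) (simp_all add: poly_act_add poly_act_smult)
qed

lemma poly_act_monom: "poly_act w (Polynomial.monom a i) \<phi> y = a * \<phi> (w ^ i * y)"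
  by (induction i arbitrary: y) (simp_all add: monom_0 monom_Suc algebra_simps)

lemma poly_act_zero_fun [simp]: "poly_act w g (\<lambda>_. 0) = (\<lambda>_. 0)"
  by (auto simp: poly_act_def)

lemma poly_act_power_diff:
  "poly_act w ([:w:] ^ Q - [:0, 1:] ^ Q) \<phi> y = w ^ Q * \<phi> y - \<phi> (w ^ Q * y)"
proof -
  have "[:w:] ^ Q - [:0, 1:] ^ Q = Polynomial.monom (w ^ Q) 0 + Polynomial.monom (-1) Q"
    by (simp add: poly_const_pow monom_0 monom_altdef)
  then show ?thesis by (simp add: poly_act_add poly_act_monom)
qed

definition ad :: "'s::comm_ring_1 \<Rightarrow> ('s \<Rightarrow> 's) \<Rightarrow> 's \<Rightarrow> 's" where
  "ad w \<phi> = (\<lambda>y. w * \<phi> y - \<phi> (w * y))"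

lemma ad_eq_poly_act: "ad w \<phi> = poly_act w ([:w:] - [:0, 1:]) \<phi>"
  by (rule ext) (simp add: ad_def)

lemma ad_power_eq_poly_act: "(ad w ^^ k) \<phi> = poly_act w (([:w:] - [:0, 1:]) ^ k) \<phi>"
proof (induction k)
  case 0
  then show ?case by (simp add: one_pCons fun_eq_iff)
next
  case (Suc k)
  then show ?case by (simp only: funpow.simps comp_apply power_Suc poly_act_mult ad_eq_poly_act)
qed

lemma ad_zero [simp]: "ad w (\<lambda>_. 0) = (\<lambda>_. 0)"
  by (simp add: ad_def)

lemma ad_commute: "ad v (ad w \<phi>) = ad w (ad v \<phi>)"
  by (simp add: ad_def fun_eq_iff algebra_simps)

lemma ad_power_commute: "(ad v ^^ k) (ad w \<phi>) = ad w ((ad v ^^ k) \<phi>)"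
  by (induction k) (simp_all add: ad_commute)

text \<open>
  Grothendieck's recursive description of the operators killed by \<open>J^m\<close>.
\<close>

primrec diff_order_less :: "nat \<Rightarrow> ('s::comm_ring_1 \<Rightarrow> 's) set" where
  "diff_order_less 0 = {\<lambda>_. 0}"
| "diff_order_less (Suc m) = {\<phi>. \<forall>w. ad w \<phi> \<in> diff_order_less m}"

lemma diff_order_less_zero [simp]: "(\<lambda>_. 0) \<in> diff_order_less m"
  by (induction m) simp_all

lemma diff_order_less_add:
  "\<phi> \<in> diff_order_less m \<Longrightarrow> \<psi> \<in> diff_order_less m \<Longrightarrow> (\<lambda>y. \<phi> y + \<psi> y) \<in> diff_order_less m"
proof (induction m arbitrary: \<phi> \<psi>)
  case (Suc m)
  have "ad w (\<lambda>y. \<phi> y + \<psi> y) = (\<lambda>y. ad w \<phi> y + ad w \<psi> y)" for w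
    by (simp add: ad_def algebra_simps)
  with Suc show ?case by simp
qed simp

lemma diff_order_less_lmult:
  "\<phi> \<in> diff_order_less m \<Longrightarrow> (\<lambda>y. r * \<phi> y) \<in> diff_order_less m"
proof (induction m arbitrary: \<phi>)
  case (Suc m)
  have "ad w (\<lambda>y. r * \<phi> y) = (\<lambda>y. r * ad w \<phi> y)" for w
    by (simp add: ad_def algebra_simps)
  with Suc show ?case by simp
qed simp

lemma diff_order_less_rmult:
  "\<phi> \<in> diff_order_less m \<Longrightarrow> (\<lambda>y. \<phi> (r * y)) \<in> diff_order_less m"
proof (induction m arbitrary: \<phi>)
  case (Suc m)
  have "ad w (\<lambda>y. \<phi> (r * y)) = (\<lambda>y. ad w \<phi> (r * y))" for w
    by (simp add: ad_def algebra_simps)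
  with Suc show ?case by simp
qed simp

lemma diff_order_less_Suc: "\<phi> \<in> diff_order_less m \<Longrightarrow> \<phi> \<in> diff_order_less (Suc m)"
  by (induction m arbitrary: \<phi>) auto

lemma diff_order_less_mono: "m \<le> m' \<Longrightarrow> \<phi> \<in> diff_order_less m \<Longrightarrow> \<phi> \<in> diff_order_less m'"
  by (induction rule: dec_induct) (use diff_order_less_Suc in blast)+

lemma diff_order_less_comp:
  fixes \<phi> \<psi> :: "'s::comm_ring_1 \<Rightarrow> 's"
  assumes "\<phi> \<in> diff_order_less m" "\<psi> \<in> diff_order_less m'" "\<And>a b. \<phi> (a + b) = \<phi> a + \<phi> b"
  shows "\<phi> \<circ> \<psi> \<in> diff_order_less (m + m')"
  using assms
proof (induction "m + m'" arbitrary: m m' \<phi> \<psi>)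
  case 0
  then show ?case by auto
next
  case (Suc k)
  interpret additive \<phi> by unfold_locales (rule Suc.prems(3))
  consider "m = 0" | "m' = 0" | l l' where "m = Suc l" "m' = Suc l'"
    by (meson not0_implies_Suc)
  then show ?case
  proof cases
    case 1
    then have "\<phi> \<circ> \<psi> = (\<lambda>_. 0)" using Suc.prems(1) by auto
    then show ?thesis by simp
  next
    case 2
    then have "\<phi> \<circ> \<psi> = (\<lambda>_. 0)" using Suc.prems(2) zero by auto
    then show ?thesis by simp
  next
    case 3
    have "ad w (\<phi> \<circ> \<psi>) \<in> diff_order_less k" for w
    proof -
      have "ad w (\<phi> \<circ> \<psi>) = (\<lambda>y. (ad w \<phi> \<circ> \<psi>) y + (\<phi> \<circ> ad w \<psi>) y)"
        by (simp add: ad_def diff)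
      moreover have "ad w \<phi> (a + b) = ad w \<phi> a + ad w \<phi> b" for a b
        by (simp add: ad_def add algebra_simps)
      moreover have "k = l + m'" "k = m + l'" using 3 Suc.hyps(2) by auto
      ultimately have "ad w \<phi> \<circ> \<psi> \<in> diff_order_less k" "\<phi> \<circ> ad w \<psi> \<in> diff_order_less k"
        using Suc.hyps(1)[of l m' "ad w \<phi>" \<psi>] Suc.hyps(1)[of m l' \<phi> "ad w \<psi>"] Suc.prems 3
        by simp_all
      from diff_order_less_add[OF this] show ?thesis
        by (simp add: ad_def diff)
    qed
    then show ?thesis using Suc.hyps(2)[symmetric] by simp
  qed
qed

lemma V_linear_iff:
  "V_linear \<kappa> \<phi> \<longleftrightarrow> Modules.module (\<lambda>c x. \<kappa> c * x) \<and> (\<forall>a b. \<phi> (a + b) = \<phi> a + \<phi> b) \<and> (\<forall>c a. \<phi> (\<kappa> c * a) = \<kappa> c * \<phi> a)"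
  unfolding V_linear_def module_hom_def module_hom_axioms_def by auto

lemma V_linear_additive: "V_linear \<kappa> \<phi> \<Longrightarrow> additive \<phi>"
  by (simp add: V_linear_iff additive_def)

lemma V_linear_ad: "V_linear \<kappa> \<phi> \<Longrightarrow> V_linear \<kappa> (ad w \<phi>)"
  by (simp add: V_linear_iff ad_def distrib_left right_diff_distrib mult.left_commute[of w "\<kappa> _"])

lemma tensor_act_Cons:
  "tensor_act [] \<phi> x = 0" "tensor_act ((r, s) # u) \<phi> x = r * \<phi> (s * x) + tensor_act u \<phi> x"
  "tensor_mult_map [] = 0" "tensor_mult_map ((r, s) # u) = r * s + tensor_mult_map u"
  by (simp_all add: tensor_act_def tensor_mult_map_def)

lemma tensor_act_ad: "tensor_act v (ad w \<phi>) x = w * tensor_act v \<phi> x - tensor_act v \<phi> (w * x)"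
  by (induction v) (auto simp: tensor_act_def ad_def algebra_simps)

text \<open>
  If \<open>v \<in> J^m\<close> kills all commutators of \<open>\<phi>\<close> with ring elements, then \<open>v \<cdot> \<phi>\<close> is \<open>S\<close>-linear, and \<open>J\<close> kills \<open>S\<close>-linear maps.
  Conversely, the commutator with \<open>w\<close> is the action of \<open>w \<otimes> 1 - 1 \<otimes> w \<in> J\<close>.
\<close>

lemma diag_ideal_power_iff_diff_order:
  fixes \<phi> :: "'s::comm_ring_1 \<Rightarrow> 's"
  assumes "V_linear \<kappa> \<phi>"
  shows "(\<forall>u\<in>diag_ideal_power m. tensor_act u \<phi> = (\<lambda>_. 0)) \<longleftrightarrow> \<phi> \<in> diff_order_less m"
  using assms
proof (induction m arbitrary: \<phi>)
  case 0
  have "\<phi> = (\<lambda>_. 0)" if "\<forall>u. tensor_act u \<phi> = (\<lambda>_. 0)"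
    using spec[OF that, of "[(1, 1)]"] by (simp add: tensor_act_def)
  moreover have "tensor_act u (\<lambda>_. 0 :: 's) = (\<lambda>_. 0)" for u :: "('s \<times> 's) list"
    by (induction u) (auto simp: tensor_act_def fun_eq_iff)
  ultimately show ?case by auto
next
  case (Suc m)
  show ?case
  proof
    assume kill: "\<forall>u\<in>diag_ideal_power (Suc m). tensor_act u \<phi> = (\<lambda>_. 0)"
    have "tensor_act v (ad w \<phi>) = (\<lambda>_. 0)" if "v \<in> diag_ideal_power m" for w v
    proof -
      let ?d = "[(w, 1), (- 1, w)]"
      have "?d \<in> diag_ideal" by (simp add: diag_ideal_def tensor_mult_map_def)
      then have "tensor_prod ?d v \<in> diag_ideal_power (Suc m)"
        using that by (auto intro!: exI[of _ "[(?d, v)]"])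
      then have "tensor_act ?d (tensor_act v \<phi>) = (\<lambda>_. 0)"
        using kill tensor_prod_act[OF Suc.prems] by metis
      moreover have "tensor_act ?d (tensor_act v \<phi>) = tensor_act v (ad w \<phi>)"
        by (rule ext) (simp add: tensor_act_ad, simp add: tensor_act_def[of ?d])
      ultimately show ?thesis by simp
    qed
    then show "\<phi> \<in> diff_order_less (Suc m)"
      using Suc.IH[OF V_linear_ad[OF Suc.prems]] by simp
  next
    assume "\<phi> \<in> diff_order_less (Suc m)"
    then have ad0: "tensor_act v (ad w \<phi>) = (\<lambda>_. 0)" if "v \<in> diag_ideal_power m" for w v
      using Suc.IH[OF V_linear_ad[OF Suc.prems]] that by auto
    have "tensor_act (tensor_prod a v) \<phi> x = 0" if "a \<in> diag_ideal" "v \<in> diag_ideal_power m" for a v x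
    proof -
      have lin: "tensor_act v \<phi> (s * x) = s * tensor_act v \<phi> x" for s x
        using tensor_act_ad[of v s \<phi> x] ad0[OF that(2), of s] by simp
      have "tensor_act a (tensor_act v \<phi>) x = tensor_mult_map a * tensor_act v \<phi> x"
        by (induction a) (auto simp: tensor_act_Cons lin distrib_right mult.assoc)
      then show ?thesis using that(1) by (simp add: tensor_prod_act[OF Suc.prems] diag_ideal_def)
    qed
    then have zero: "\<forall>(a, v)\<in>diag_ideal \<times> diag_ideal_power m. \<forall>x. tensor_act (tensor_prod a v) \<phi> x = 0"
      by blast
    have "tensor_act (concat (map (\<lambda>(a, v). tensor_prod a v) ws)) \<phi> x = 0"
      if "set ws \<subseteq> diag_ideal \<times> diag_ideal_power m" for ws x
      using that zero by (induction ws) (auto simp: tensor_maps_append, simp add: tensor_act_def)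
    then show "\<forall>u\<in>diag_ideal_power (Suc m). tensor_act u \<phi> = (\<lambda>_. 0)" by (auto simp: fun_eq_iff)
  qed
qed

lemma diff_ops_iff: "\<phi> \<in> diff_ops \<kappa> \<longleftrightarrow> V_linear \<kappa> \<phi> \<and> (\<exists>m. \<phi> \<in> diff_order_less m)"
  unfolding diff_ops_def using diag_ideal_power_iff_diff_order by auto

text \<open>
  If \<open>\<phi>\<close> is killed by \<open>J^m\<close>, then \<open>(w - Y)^m\<close> kills \<open>\<phi>\<close>, and this polynomial divides \<open>w^Q - Y^Q\<close> for
  \<open>Q = p^(M m)\<close>. The exponent does not depend on \<open>w\<close>.
\<close>

lemma diff_op_commutes_prime_powers:
  fixes \<kappa> :: "'v::comm_ring_1 \<Rightarrow> 's::comm_ring_1"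
  assumes "\<phi> \<in> diff_ops \<kappa>" and "(of_nat p :: 's) ^ M = 0"
  obtains N where "\<And>w y. \<phi> (w ^ p ^ N * y) = w ^ p ^ N * \<phi> y"
proof -
  obtain m where "\<phi> \<in> diff_order_less m" using assms(1) by (auto simp: diff_ops_iff)
  then have ad0: "(ad w ^^ m) \<phi> = (\<lambda>_. 0)" for w
    by (induction m arbitrary: \<phi>) (simp_all add: funpow_Suc_right del: funpow.simps)
  \<comment> \<open>one squaring of the divisor per factor \<open>p^M\<close> gives the exponent \<open>2^m\<close>, which exceeds \<open>m\<close>\<close>
  let ?Q = "p ^ (M * m)"
  have "\<phi> (w ^ ?Q * y) = w ^ ?Q * \<phi> y" for w y
  proof -
    have "(of_nat p :: 's poly) ^ M = [:of_nat p ^ M:]" by (simp add: of_nat_poly poly_const_pow)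
    then have "(of_nat p :: 's poly) ^ M = 0" by (simp add: assms(2))
    then have "([:w:] - [:0, 1:]) ^ 2 ^ m dvd [:w:] ^ ?Q - [:0, 1:] ^ ?Q"
      by (rule power_dvd_prime_power_diff)
    then have "([:w:] - [:0, 1:]) ^ m dvd [:w:] ^ ?Q - [:0, 1:] ^ ?Q"
      by (rule power_le_dvd) simp
    then obtain g where "[:w:] ^ ?Q - [:0, 1:] ^ ?Q = g * ([:w:] - [:0, 1:]) ^ m"
      by (metis dvdE mult.commute)
    then have "poly_act w ([:w:] ^ ?Q - [:0, 1:] ^ ?Q) \<phi> = poly_act w g ((ad w ^^ m) \<phi>)"
      by (simp only: poly_act_mult ad_power_eq_poly_act)
    then have "poly_act w ([:w:] ^ ?Q - [:0, 1:] ^ ?Q) \<phi> y = 0" by (simp only: ad0 poly_act_zero_fun)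
    then show ?thesis by (simp only: poly_act_power_diff) simp
  qed
  then show ?thesis by (rule that)
qed

text \<open>
  Modulo \<open>p\<close>, the polynomials \<open>(w - Y)^Q\<close> and \<open>w^Q - Y^Q\<close> agree, and the latter kills \<open>\<phi>\<close>. Hence \<open>(w - Y)^(Q M)\<close> kills it
  as well, because \<open>p^M = 0\<close>.
\<close>

lemma ad_nilpotent_of_commutes:
  fixes \<phi> :: "'s::comm_ring_1 \<Rightarrow> 's"
  assumes "prime p" "(of_nat p :: 's) ^ M = 0"
    and comm: "\<And>y. \<phi> (w ^ p ^ N * y) = w ^ p ^ N * \<phi> y"
  shows "(ad w ^^ (p ^ N * M)) \<phi> = (\<lambda>_. 0)"
proof -
  let ?Q = "p ^ N" and ?l = "[:w:] - [:0, 1:]"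
  let ?A = "[:w:] ^ ?Q - [:0, 1:] ^ ?Q"
  have "of_nat p dvd (?l + [:0, 1:]) ^ ?Q - ?l ^ ?Q - [:0, 1:] ^ ?Q"
    by (rule prime_dvd_power_sum[OF assms(1)])
  moreover have "a - b - c = a - c - b" for a b c :: "'s poly" by simp
  ultimately have "of_nat p dvd ?A - ?l ^ ?Q" by (simp only: diff_add_cancel)
  then obtain c where "?A - ?l ^ ?Q = of_nat p * c" by (elim dvdE)
  moreover have "b - of_nat p * (- c) = a" if "a - b = of_nat p * c" for a b :: "'s poly"
    using that by (simp add: algebra_simps)
  ultimately have "?l ^ ?Q - of_nat p * (- c) = ?A" by blast
  then obtain c where c: "?l ^ ?Q - of_nat p * c = ?A" by blast
  have "(of_nat p :: 's poly) ^ M = [:of_nat p ^ M:]" by (simp add: of_nat_poly poly_const_pow)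
  then have "(of_nat p * c) ^ M = 0" by (simp add: assms(2) power_mult_distrib)
  moreover have "?A dvd (?l ^ ?Q) ^ M - (of_nat p * c) ^ M"
    by (rule dvd_power_diff) (simp only: c dvd_refl)
  ultimately have "?A dvd ?l ^ (?Q * M)" by (simp add: power_mult)
  then obtain g where g: "?l ^ (?Q * M) = g * ?A" by (metis dvdE mult.commute)
  have "poly_act w ?A \<phi> = (\<lambda>_. 0)"
    by (rule ext) (simp only: poly_act_power_diff comm diff_self)
  then show ?thesis by (simp only: ad_power_eq_poly_act g poly_act_mult poly_act_zero_fun)
qed

text \<open>
  Induction on the sum of the nilpotency exponents: the commutator of \<open>\<phi>\<close> with a generator lowers one of
  them, and the elements whose commutator with \<open>\<phi>\<close> has order less than \<open>m\<close> form a subalgebra.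
\<close>

lemma diff_order_less_generators:
  fixes \<kappa> :: "'v::comm_ring_1 \<Rightarrow> 's::comm_ring_1"
  assumes lin: "V_linear \<kappa> \<phi>" and fin: "finite E" "E \<noteq> {}"
    and gen: "\<And>A. range \<kappa> \<subseteq> A \<Longrightarrow> E \<subseteq> A \<Longrightarrow> (\<And>a b. a \<in> A \<Longrightarrow> b \<in> A \<Longrightarrow> a + b \<in> A) \<Longrightarrow>
      (\<And>a b. a \<in> A \<Longrightarrow> b \<in> A \<Longrightarrow> a * b \<in> A) \<Longrightarrow> A = UNIV"
    and nil: "\<And>w. w \<in> E \<Longrightarrow> (ad w ^^ k w) \<phi> = (\<lambda>_. 0)"
  shows "\<phi> \<in> diff_order_less (sum k E)"
  using lin nil
proof (induction "sum k E" arbitrary: k \<phi>)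
  case 0
  then obtain w where "w \<in> E" "k w = 0" using fin by auto
  then have "\<phi> = (\<lambda>_. 0)" using "0.prems"(2)[of w] by simp
  then show ?case by simp
next
  case (Suc m)
  show ?case
  proof (cases "\<exists>w\<in>E. k w = 0")
    case True
    then have "\<phi> = (\<lambda>_. 0)" using Suc.prems(2) by fastforce
    then show ?thesis by simp
  next
    case False
    have E: "ad w \<phi> \<in> diff_order_less m" if w: "w \<in> E" for w
    proof -
      let ?k = "k(w := k w - 1)"
      have pos: "k w > 0" using False w by auto
      have "sum k E = k w + sum k (E - {w})" using fin(1) w by (rule sum.remove)
      moreover have "sum ?k E = ?k w + sum ?k (E - {w})" using fin(1) w by (rule sum.remove)
      moreover have "sum ?k (E - {w}) = sum k (E - {w})" by (rule sum.cong) auto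
      ultimately have m: "m = sum ?k E" using Suc.hyps(2) pos by simp
      have "(ad z ^^ ?k z) (ad w \<phi>) = (\<lambda>_. 0)" if "z \<in> E" for z
      proof (cases "z = w")
        case True
        then have "(ad z ^^ ?k z) (ad w \<phi>) = (ad w ^^ Suc (k w - 1)) \<phi>"
          by (simp only: funpow_Suc_right comp_apply fun_upd_same)
        then show ?thesis using pos Suc.prems(2)[OF w] by simp
      next
        case False
        then show ?thesis using Suc.prems(2)[OF that] by (simp add: ad_power_commute)
      qed
      then have "ad w \<phi> \<in> diff_order_less (sum ?k E)"
        using Suc.hyps(1)[OF m] V_linear_ad[OF Suc.prems(1)] by blast
      then show ?thesis using m by simp
    qed
    interpret additive \<phi> using Suc.prems(1) by (rule V_linear_additive)
    have "{w. ad w \<phi> \<in> diff_order_less m} = UNIV"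
    proof (rule gen)
      have "ad (\<kappa> c) \<phi> = (\<lambda>_. 0)" for c
        using Suc.prems(1) by (simp add: V_linear_iff ad_def)
      then show "range \<kappa> \<subseteq> {w. ad w \<phi> \<in> diff_order_less m}" by auto
      show "E \<subseteq> {w. ad w \<phi> \<in> diff_order_less m}" using E by blast
    next
      fix a b assume ab: "a \<in> {w. ad w \<phi> \<in> diff_order_less m}" "b \<in> {w. ad w \<phi> \<in> diff_order_less m}"
      have "ad (a + b) \<phi> = (\<lambda>y. ad a \<phi> y + ad b \<phi> y)"
        by (simp add: ad_def add algebra_simps)
      then show "a + b \<in> {w. ad w \<phi> \<in> diff_order_less m}" using ab diff_order_less_add by simp
      have "ad (a * b) \<phi> = (\<lambda>y. a * ad b \<phi> y + ad a \<phi> (b * y))"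
        by (simp add: ad_def algebra_simps)
      then show "a * b \<in> {w. ad w \<phi> \<in> diff_order_less m}"
        using ab diff_order_less_add[OF diff_order_less_lmult diff_order_less_rmult] by simp
    qed
    then have "\<phi> \<in> diff_order_less (Suc m)" by auto
    then show ?thesis using Suc.hyps(2) by simp
  qed
qed

lemma diff_op_of_commutes_generators:
  fixes \<kappa> :: "'v::comm_ring_1 \<Rightarrow> 's::comm_ring_1"
  assumes "prime p" "(of_nat p :: 's) ^ M = 0"
    and lin: "V_linear \<kappa> \<phi>" and fin: "finite E" "E \<noteq> {}"
    and gen: "\<And>A. range \<kappa> \<subseteq> A \<Longrightarrow> E \<subseteq> A \<Longrightarrow> (\<And>a b. a \<in> A \<Longrightarrow> b \<in> A \<Longrightarrow> a + b \<in> A) \<Longrightarrow>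
      (\<And>a b. a \<in> A \<Longrightarrow> b \<in> A \<Longrightarrow> a * b \<in> A) \<Longrightarrow> A = UNIV"
    and comm: "\<And>w y. w \<in> E \<Longrightarrow> \<phi> (w ^ p ^ N * y) = w ^ p ^ N * \<phi> y"
  shows "\<phi> \<in> diff_ops \<kappa>"
proof -
  have nil: "(ad w ^^ (p ^ N * M)) \<phi> = (\<lambda>_. 0)" if "w \<in> E" for w
    by (rule ad_nilpotent_of_commutes[OF assms(1,2)]) (rule comm[OF that])
  have "\<phi> \<in> diff_order_less (sum (\<lambda>_. p ^ N * M) E)"
    by (rule diff_order_less_generators[OF lin fin gen nil])
  with lin show ?thesis by (auto simp: diff_ops_iff)
qed

lemma mult_in_diff_ops:
  assumes "Modules.module (\<lambda>c x. \<kappa> c * x)"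
  shows "(*) s \<in> diff_ops \<kappa>"
proof -
  have "ad w ((*) s) = (\<lambda>_. 0)" for w by (simp add: ad_def algebra_simps)
  then have "(*) s \<in> diff_order_less (Suc 0)" by simp
  moreover have "V_linear \<kappa> ((*) s)" using assms by (simp add: V_linear_iff distrib_left mult.left_commute)
  ultimately show ?thesis unfolding diff_ops_iff by blast
qed

lemma diff_ops_comp:
  assumes "\<phi> \<in> diff_ops \<kappa>" "\<psi> \<in> diff_ops \<kappa>"
  shows "\<phi> \<circ> \<psi> \<in> diff_ops \<kappa>"
proof -
  obtain m m' where "\<phi> \<in> diff_order_less m" "\<psi> \<in> diff_order_less m'"
    using assms by (auto simp: diff_ops_iff)
  then have "\<phi> \<circ> \<psi> \<in> diff_order_less (m + m')"
    using assms(1) by (intro diff_order_less_comp) (auto simp: diff_ops_iff V_linear_iff)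
  then show ?thesis using assms by (auto simp: diff_ops_iff V_linear_iff)
qed

lemma diff_ops_add:
  assumes "\<phi> \<in> diff_ops \<kappa>" "\<psi> \<in> diff_ops \<kappa>"
  shows "(\<lambda>y. \<phi> y + \<psi> y) \<in> diff_ops \<kappa>"
proof -
  obtain m m' where "\<phi> \<in> diff_order_less m" "\<psi> \<in> diff_order_less m'"
    using assms by (auto simp: diff_ops_iff)
  then have "(\<lambda>y. \<phi> y + \<psi> y) \<in> diff_order_less (max m m')"
    by (intro diff_order_less_add) (auto elim: diff_order_less_mono[rotated])
  moreover have "V_linear \<kappa> (\<lambda>y. \<phi> y + \<psi> y)"
    using assms by (simp add: diff_ops_iff V_linear_iff distrib_left ac_simps)
  ultimately show ?thesis unfolding diff_ops_iff by blast
qed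

lemma diff_op_ring_is_ring:
  fixes \<kappa> :: "'v::comm_ring_1 \<Rightarrow> 's::comm_ring_1"
  assumes mod: "Modules.module (\<lambda>c x. \<kappa> c * x)"
  shows "ring (diff_op_ring \<kappa>)"
proof (rule ringI)
  have "(id :: 's \<Rightarrow> 's) = (*) 1" by (rule ext) simp
  then have id: "(id :: 's \<Rightarrow> 's) \<in> diff_ops \<kappa>" by (metis mult_in_diff_ops[OF mod])
  have "(\<lambda>_. 0 :: 's) = (*) 0" by (rule ext) simp
  then have zero: "(\<lambda>_. 0 :: 's) \<in> diff_ops \<kappa>" by (metis mult_in_diff_ops[OF mod])
  show "abelian_group (diff_op_ring \<kappa>)"
  proof (rule abelian_groupI)
    fix \<phi> assume "\<phi> \<in> carrier (diff_op_ring \<kappa>)"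
    then have \<phi>: "\<phi> \<in> diff_ops \<kappa>" by (simp add: diff_op_ring_def)
    have "(*) (- 1) \<circ> \<phi> \<in> diff_ops \<kappa>" by (rule diff_ops_comp[OF mult_in_diff_ops[OF mod] \<phi>])
    then show "\<exists>\<psi>\<in>carrier (diff_op_ring \<kappa>). \<psi> \<oplus>\<^bsub>diff_op_ring \<kappa>\<^esub> \<phi> = \<zero>\<^bsub>diff_op_ring \<kappa>\<^esub>"
      by (intro bexI[of _ "(*) (- 1) \<circ> \<phi>"]) (auto simp: diff_op_ring_def)
  qed (auto simp: diff_op_ring_def diff_ops_add zero add.assoc add.commute)
  show "Group.monoid (diff_op_ring \<kappa>)"
    by (rule monoidI) (auto simp: diff_op_ring_def id diff_ops_comp comp_assoc)
qed (auto simp: diff_op_ring_def diff_ops_iff V_linear_iff)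


section \<open>Differential operators act on localizations\<close>

lemma abelian_group_of_comm_group:
  assumes "comm_group G" "carrier M = carrier G" "add M = monoid.mult G" "zero M = one G"
  shows "abelian_group M"
proof -
  interpret comm_group G by fact
  show ?thesis
  proof (rule abelian_groupI)
    show "\<exists>y\<in>carrier M. y \<oplus>\<^bsub>M\<^esub> x = \<zero>\<^bsub>M\<^esub>" if "x \<in> carrier M" for x
      using l_inv_ex[of x] that by (simp add: assms(2-4))
  qed (simp_all add: assms(2-4) m_assoc, simp add: m_comm)
qed

lemma with_smult_simps [simp]:
  "carrier (with_smult act M) = carrier M" "add (with_smult act M) = add M"
  "zero (with_smult act M) = zero M" "module.smult (with_smult act M) = act"
  by (simp_all add: with_smult_def)

lemma diff_op_ring_simps [simp]:
  "carrier (diff_op_ring \<kappa>) = diff_ops \<kappa>" "monoid.mult (diff_op_ring \<kappa>) \<phi> \<psi> = \<phi> \<circ> \<psi>"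
  "one (diff_op_ring \<kappa>) = id" "zero (diff_op_ring \<kappa>) = (\<lambda>_. 0)"
  "add (diff_op_ring \<kappa>) \<phi> \<psi> = (\<lambda>y. \<phi> y + \<psi> y)"
  by (simp_all add: diff_op_ring_def)

text \<open>
  A multiplicative set without zero divisors, so that \<open>a/u = b/v\<close> simply means \<open>v a = u b\<close>.
\<close>

locale regular_denominators =
  fixes W :: "'s::comm_ring_1 set"
  assumes one_mem: "1 \<in> W"
    and mult_mem: "u \<in> W \<Longrightarrow> v \<in> W \<Longrightarrow> u * v \<in> W"
    and cancel: "u \<in> W \<Longrightarrow> u * a = u * b \<Longrightarrow> a = b"
begin

abbreviation "L \<equiv> ring_localization W"
abbreviation "fr \<equiv> ring_frac W"

lemma frac_rel_iff:
  "((a, u), (b, v)) \<in> frac_rel cls_ring W (regular_module cls_ring) \<longleftrightarrow> u \<in> W \<and> v \<in> W \<and> v * a = u * b"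
proof -
  have "(\<exists>w\<in>W. w * (v * a) = w * (u * b)) \<longleftrightarrow> v * a = u * b"
    by (metis cancel one_mem)
  then show ?thesis by (auto simp: frac_rel_def regular_module_def)
qed

lemma mem_fr: "(b, v) \<in> fr a u \<longleftrightarrow> u \<in> W \<and> v \<in> W \<and> v * a = u * b"
  by (simp add: frac_def frac_rel_iff)

lemma fr_eq_iff:
  assumes "u \<in> W" "v \<in> W"
  shows "fr a u = fr b v \<longleftrightarrow> v * a = u * b"
proof
  assume "fr a u = fr b v"
  moreover have "(b, v) \<in> fr b v" using assms by (simp add: mem_fr)
  ultimately have "(b, v) \<in> fr a u" by simp
  then show "v * a = u * b" by (simp only: mem_fr)
next
  assume eq: "v * a = u * b"
  have "w * a = u * c \<longleftrightarrow> w * b = v * c" for c w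
  proof -
    have vu: "v * (w * a) = u * (w * b)" using eq by (metis mult.left_commute)
    have "w * a = u * c \<longleftrightarrow> v * (w * a) = v * (u * c)" by (metis cancel assms(2))
    also have "\<dots> \<longleftrightarrow> u * (w * b) = u * (v * c)" unfolding vu by (metis mult.left_commute)
    also have "\<dots> \<longleftrightarrow> w * b = v * c" by (metis cancel assms(1))
    finally show ?thesis .
  qed
  then show "fr a u = fr b v" using assms by (auto simp: mem_fr set_eq_iff)
qed

lemma carrier_L: "carrier L = {fr a u | a u. u \<in> W}"
  by (auto simp: localized_module_def quotient_def frac_def regular_module_def)

lemma fr_closed [simp]: "u \<in> W \<Longrightarrow> fr a u \<in> carrier L"
  by (auto simp: carrier_L)

lemma zero_L: "\<zero>\<^bsub>L\<^esub> = fr 0 1"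
  by (simp add: localized_module_def regular_module_def)

lemma add_L:
  assumes "u \<in> W" "v \<in> W"
  shows "fr a u \<oplus>\<^bsub>L\<^esub> fr b v = fr (v * a + u * b) (u * v)"
proof -
  have eq: "fr (v' * a' + u' * b') (u' * v') = fr (v * a + u * b) (u * v)"
    if "(a', u') \<in> fr a u" "(b', v') \<in> fr b v" for a' u' b' v'
  proof -
    from that have m: "u' \<in> W" "v' \<in> W" "u' * a = u * a'" "v' * b = v * b'" by (auto simp: mem_fr)
    have "u * v * (v' * a' + u' * b') = v * v' * (u * a') + u * u' * (v * b')" by (simp add: algebra_simps)
    also have "\<dots> = u' * v' * (v * a + u * b)" unfolding m(3,4)[symmetric] by (simp add: algebra_simps)
    finally show ?thesis using assms m(1,2) by (simp add: fr_eq_iff mult_mem)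
  qed
  have "fr a u \<oplus>\<^bsub>L\<^esub> fr b v = (\<Union>(a', u')\<in>fr a u. \<Union>(b', v')\<in>fr b v. fr (v' * a' + u' * b') (u' * v'))"
    by (simp add: localized_module_def regular_module_def)
  also have "\<dots> = (\<Union>(a', u')\<in>fr a u. \<Union>(b', v')\<in>fr b v. fr (v * a + u * b) (u * v))"
    using eq by (intro SUP_cong refl) (auto split: prod.splits)
  also have "\<dots> = fr (v * a + u * b) (u * v)"
  proof -
    have "(a, u) \<in> fr a u" "(b, v) \<in> fr b v" using assms by (simp_all add: mem_fr)
    then show ?thesis by auto
  qed
  finally show ?thesis .
qed

lemma smult_L:
  assumes "u \<in> W"
  shows "c \<odot>\<^bsub>L\<^esub> fr a u = fr (c * a) u"
proof -
  have eq: "fr (c * a') u' = fr (c * a) u" if "(a', u') \<in> fr a u" for a' u'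
    using that assms by (auto simp: mem_fr fr_eq_iff mult.left_commute)
  have "c \<odot>\<^bsub>L\<^esub> fr a u = (\<Union>(a', u')\<in>fr a u. fr (c * a') u')"
    by (simp add: localized_module_def regular_module_def)
  also have "\<dots> = (\<Union>(a', u')\<in>fr a u. fr (c * a) u)"
    using eq by (intro SUP_cong refl) auto
  also have "\<dots> = fr (c * a) u"
  proof -
    have "(a, u) \<in> fr a u" using assms by (simp add: mem_fr)
    then show ?thesis by auto
  qed
  finally show ?thesis .
qed

lemma add_L_same:
  assumes "u \<in> W"
  shows "fr a u \<oplus>\<^bsub>L\<^esub> fr b u = fr (a + b) u"
  using assms by (simp add: add_L fr_eq_iff mult_mem algebra_simps)

lemma fr_expand: "u \<in> W \<Longrightarrow> v \<in> W \<Longrightarrow> fr (v * a) (v * u) = fr a u"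
  by (simp add: fr_eq_iff mult_mem algebra_simps)

lemma abelian_group_L: "abelian_group L"
proof (rule abelian_groupI)
  fix A B C assume "A \<in> carrier L" "B \<in> carrier L" "C \<in> carrier L"
  then obtain a u b v c w where [simp]: "A = fr a u" "B = fr b v" "C = fr c w" "u \<in> W" "v \<in> W" "w \<in> W"
    by (auto simp: carrier_L)
  show "A \<oplus>\<^bsub>L\<^esub> B \<oplus>\<^bsub>L\<^esub> C = A \<oplus>\<^bsub>L\<^esub> (B \<oplus>\<^bsub>L\<^esub> C)"
    by (simp add: add_L fr_eq_iff mult_mem algebra_simps)
next
  fix A B assume "A \<in> carrier L" "B \<in> carrier L"
  then obtain a u b v where [simp]: "A = fr a u" "B = fr b v" "u \<in> W" "v \<in> W"
    by (auto simp: carrier_L)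
  show "A \<oplus>\<^bsub>L\<^esub> B \<in> carrier L" by (simp add: add_L mult_mem)
  show "A \<oplus>\<^bsub>L\<^esub> B = B \<oplus>\<^bsub>L\<^esub> A" by (simp add: add_L fr_eq_iff mult_mem algebra_simps)
next
  fix A assume "A \<in> carrier L"
  then obtain a u where [simp]: "A = fr a u" "u \<in> W" by (auto simp: carrier_L)
  show "\<zero>\<^bsub>L\<^esub> \<oplus>\<^bsub>L\<^esub> A = A" by (simp add: zero_L add_L one_mem)
  have "fr (- a) u \<oplus>\<^bsub>L\<^esub> A = \<zero>\<^bsub>L\<^esub>" by (simp add: add_L_same zero_L fr_eq_iff one_mem)
  then show "\<exists>B\<in>carrier L. B \<oplus>\<^bsub>L\<^esub> A = \<zero>\<^bsub>L\<^esub>" by (intro bexI[of _ "fr (- a) u"]) simp_all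
qed (simp add: zero_L one_mem)

lemma power_mem: "u \<in> W \<Longrightarrow> u ^ k \<in> W"
  by (induction k) (simp_all add: one_mem mult_mem)

text \<open>
  A fraction may be written with a denominator that commutes with the given operator, and the operator
  can then be applied to the numerator.
\<close>

definition D_act :: "('v::comm_ring_1 \<Rightarrow> 's) \<Rightarrow> ('s \<Rightarrow> 's) \<Rightarrow> ('s \<times> 's) set \<Rightarrow> ('s \<times> 's) set" where
  "D_act \<kappa> = (\<lambda>\<phi>\<in>diff_ops \<kappa>. \<lambda>A\<in>carrier L.
     THE B. \<exists>u\<in>W. \<exists>a. (\<forall>y. \<phi> (u * y) = u * \<phi> y) \<and> A = fr a u \<and> B = fr (\<phi> a) u)"

lemma D_act_fr:
  assumes "\<phi> \<in> diff_ops \<kappa>" "u \<in> W" "\<And>y. \<phi> (u * y) = u * \<phi> y"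
  shows "D_act \<kappa> \<phi> (fr a u) = fr (\<phi> a) u"
proof -
  have "(THE B. \<exists>v\<in>W. \<exists>b. (\<forall>y. \<phi> (v * y) = v * \<phi> y) \<and> fr a u = fr b v \<and> B = fr (\<phi> b) v) = fr (\<phi> a) u"
  proof (rule the_equality)
    fix B assume "\<exists>v\<in>W. \<exists>b. (\<forall>y. \<phi> (v * y) = v * \<phi> y) \<and> fr a u = fr b v \<and> B = fr (\<phi> b) v"
    then obtain v b where v: "v \<in> W" "\<And>y. \<phi> (v * y) = v * \<phi> y" "fr a u = fr b v" "B = fr (\<phi> b) v"
      by blast
    then have "v * a = u * b" using assms(2) by (simp add: fr_eq_iff)
    then have "v * \<phi> a = u * \<phi> b" using v(2) assms(3) by metis
    then show "B = fr (\<phi> a) u" using v(1,4) assms(2) by (simp add: fr_eq_iff)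
  qed (use assms in blast)
  then show ?thesis using assms(1,2) by (simp add: D_act_def)
qed

text \<open>
  Sufficiently high \<open>p\<close>-powers of all denominators commute with both operators.
\<close>

lemma common_denominator:
  fixes \<kappa> :: "'v::comm_ring_1 \<Rightarrow> 's"
  assumes nil: "(of_nat p :: 's) ^ M = 0" "p > 0"
    and "\<phi> \<in> diff_ops \<kappa>" "\<psi> \<in> diff_ops \<kappa>" "A \<in> carrier L" "B \<in> carrier L"
  obtains u a b where "u \<in> W" "A = fr a u" "B = fr b u"
    "\<And>y. \<phi> (u * y) = u * \<phi> y" "\<And>y. \<psi> (u * y) = u * \<psi> y"
proof -
  obtain a v b w where AB: "A = fr a v" "B = fr b w" and [simp]: "v \<in> W" "w \<in> W"
    using assms by (auto simp: carrier_L)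
  obtain N where N: "\<And>w y. \<phi> (w ^ p ^ N * y) = w ^ p ^ N * \<phi> y"
    using diff_op_commutes_prime_powers[OF assms(3) nil(1)] by blast
  obtain N' where N': "\<And>w y. \<psi> (w ^ p ^ N' * y) = w ^ p ^ N' * \<psi> y"
    using diff_op_commutes_prime_powers[OF assms(4) nil(1)] by blast
  \<comment> \<open>a \<open>p^(N + N')\<close>-th power is a \<open>p^N\<close>-th power and a \<open>p^N'\<close>-th power\<close>
  let ?Q = "p ^ (N + N')"
  define u where "u = (v * w) ^ ?Q"
  define u' where "u' = (v * w) ^ (?Q - 1)"
  have u': "u' \<in> W" by (simp add: u'_def power_mem mult_mem)
  have u: "u = u' * (v * w)"
    unfolding u_def u'_def using nil(2) by (metis power_minus_mult zero_less_power)
  show ?thesis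
  proof
    show "u \<in> W" by (simp add: u_def power_mem mult_mem)
    have "A = fr ((u' * w) * a) ((u' * w) * v)" unfolding AB by (simp add: fr_expand mult_mem u')
    then show "A = fr (u' * w * a) u" by (simp add: u algebra_simps)
    have "B = fr ((u' * v) * b) ((u' * v) * w)" unfolding AB by (simp add: fr_expand mult_mem u')
    then show "B = fr (u' * v * b) u" by (simp add: u algebra_simps)
    have "u = ((v * w) ^ p ^ N') ^ p ^ N" by (simp add: u_def power_add mult.commute flip: power_mult)
    then show "\<phi> (u * y) = u * \<phi> y" for y using N by simp
    have "u = ((v * w) ^ p ^ N) ^ p ^ N'" by (simp add: u_def power_add flip: power_mult)
    then show "\<psi> (u * y) = u * \<psi> y" for y using N' by simp
  qed
qed

lemma left_module_D_act:
  fixes \<kappa> :: "'v::comm_ring_1 \<Rightarrow> 's"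
  assumes nil: "(of_nat p :: 's) ^ M = 0" "p > 0" and mod: "Modules.module (\<lambda>c x. \<kappa> c * x)"
  shows "left_module (diff_op_ring \<kappa>) (with_smult (D_act \<kappa>) L)"
proof (intro left_module.intro left_module_axioms.intro)
  let ?D = "diff_op_ring \<kappa>" and ?M = "with_smult (D_act \<kappa>) L"
  show "ring (?D)" using mod by (rule diff_op_ring_is_ring)
  show "abelian_group (?M)"
    by (rule abelian_group_of_comm_group[OF abelian_group.a_comm_group[OF abelian_group_L]]) simp_all
  note common = common_denominator[OF nil]
  show "\<phi> \<odot>\<^bsub>?M\<^esub> A \<in> carrier (?M)"
    if "\<phi> \<in> carrier (?D)" "A \<in> carrier (?M)" for \<phi> A
  proof -
    from that have d: "\<phi> \<in> diff_ops \<kappa>" "A \<in> carrier L" by simp_all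
    from common[OF d(1) d(1) d(2) d(2)] obtain u a where "u \<in> W" "A = fr a u" "\<And>y. \<phi> (u * y) = u * \<phi> y"
      by metis
    with d show ?thesis by (simp add: D_act_fr)
  qed
  show "(\<phi> \<oplus>\<^bsub>?D\<^esub> \<psi>) \<odot>\<^bsub>?M\<^esub> A
      = \<phi> \<odot>\<^bsub>?M\<^esub> A \<oplus>\<^bsub>?M\<^esub> \<psi> \<odot>\<^bsub>?M\<^esub> A"
    if "\<phi> \<in> carrier (?D)" "\<psi> \<in> carrier (?D)" "A \<in> carrier (?M)"
    for \<phi> \<psi> A
  proof -
    from that have d: "\<phi> \<in> diff_ops \<kappa>" "\<psi> \<in> diff_ops \<kappa>" "A \<in> carrier L" by simp_all
    from common[OF d(1) d(2) d(3) d(3)] obtain u a where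
      "u \<in> W" "A = fr a u" "\<And>y. \<phi> (u * y) = u * \<phi> y" "\<And>y. \<psi> (u * y) = u * \<psi> y"
      by metis
    with d diff_ops_add[OF d(1,2)] show ?thesis
      by (simp add: D_act_fr add_L_same distrib_left)
  qed
  show "\<phi> \<odot>\<^bsub>?M\<^esub> (A \<oplus>\<^bsub>?M\<^esub> B)
      = \<phi> \<odot>\<^bsub>?M\<^esub> A \<oplus>\<^bsub>?M\<^esub> \<phi> \<odot>\<^bsub>?M\<^esub> B"
    if "\<phi> \<in> carrier (?D)" "A \<in> carrier (?M)"
      "B \<in> carrier (?M)" for \<phi> A B
  proof -
    from that have d: "\<phi> \<in> diff_ops \<kappa>" "A \<in> carrier L" "B \<in> carrier L" by simp_all
    from common[OF d(1) d(1) d(2) d(3)] obtain u a b where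
      "u \<in> W" "A = fr a u" "B = fr b u" "\<And>y. \<phi> (u * y) = u * \<phi> y"
      by metis
    moreover have "\<phi> (a + b) = \<phi> a + \<phi> b" using d(1) by (simp add: diff_ops_iff V_linear_iff)
    ultimately show ?thesis using d(1) by (simp add: D_act_fr add_L_same)
  qed
  show "(\<phi> \<otimes>\<^bsub>?D\<^esub> \<psi>) \<odot>\<^bsub>?M\<^esub> A
      = \<phi> \<odot>\<^bsub>?M\<^esub> (\<psi> \<odot>\<^bsub>?M\<^esub> A)"
    if "\<phi> \<in> carrier (?D)" "\<psi> \<in> carrier (?D)" "A \<in> carrier (?M)"
    for \<phi> \<psi> A
  proof -
    from that have d: "\<phi> \<in> diff_ops \<kappa>" "\<psi> \<in> diff_ops \<kappa>" "A \<in> carrier L" by simp_all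
    from common[OF d(1) d(2) d(3) d(3)] obtain u a where
      "u \<in> W" "A = fr a u" "\<And>y. \<phi> (u * y) = u * \<phi> y" "\<And>y. \<psi> (u * y) = u * \<psi> y"
      by metis
    with d diff_ops_comp[OF d(1,2)] show ?thesis by (simp add: D_act_fr)
  qed
  have id: "id \<in> diff_ops \<kappa>"
  proof -
    have "id = (*) (1 :: 's)" by (rule ext) simp
    then show ?thesis using mult_in_diff_ops[OF mod] by metis
  qed
  show "\<one>\<^bsub>?D\<^esub> \<odot>\<^bsub>?M\<^esub> A = A"
    if "A \<in> carrier (?M)" for A
    using that by (auto simp: carrier_L D_act_fr[OF id])
qed

lemma extends_D_action_D_act:
  fixes \<kappa> :: "'v::comm_ring_1 \<Rightarrow> 's"
  assumes nil: "(of_nat p :: 's) ^ M = 0" "p > 0" and mod: "Modules.module (\<lambda>c x. \<kappa> c * x)"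
  shows "extends_D_action \<kappa> W (D_act \<kappa>)"
proof -
  interpret left_module "diff_op_ring \<kappa>" "with_smult (D_act \<kappa>) L"
    by (rule left_module_D_act[OF assms])
  have "D_act \<kappa> \<phi> A \<in> carrier L" if "\<phi> \<in> diff_ops \<kappa>" "A \<in> carrier L" for \<phi> A
    using smult_closed that by simp
  then have "D_act \<kappa> \<in> diff_ops \<kappa> \<rightarrow>\<^sub>E (carrier L \<rightarrow>\<^sub>E carrier L)"
    by (auto simp: D_act_def PiE_iff extensional_def)
  moreover have "D_act \<kappa> ((*) s) A = s \<odot>\<^bsub>L\<^esub> A" if "A \<in> carrier L" for s A
    using that mult_in_diff_ops[OF mod, of s] by (auto simp: carrier_L D_act_fr smult_L mult.left_commute)
  moreover have "D_act \<kappa> \<phi> (fr a 1) = fr (\<phi> a) 1" if "\<phi> \<in> diff_ops \<kappa>" for \<phi> a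
    using that by (simp add: D_act_fr one_mem)
  ultimately show ?thesis
    unfolding extends_D_action_def Let_def using left_module_axioms by blast
qed

lemma extends_D_action_unique:
  fixes \<kappa> :: "'v::comm_ring_1 \<Rightarrow> 's"
  assumes nil: "(of_nat p :: 's) ^ M = 0" "p > 0" and mod: "Modules.module (\<lambda>c x. \<kappa> c * x)"
    and act: "extends_D_action \<kappa> W act"
  shows "act = D_act \<kappa>"
proof -
  have PiE: "act \<in> diff_ops \<kappa> \<rightarrow>\<^sub>E (carrier L \<rightarrow>\<^sub>E carrier L)"
    and lm: "left_module (diff_op_ring \<kappa>) (with_smult act L)"
    and mul: "\<And>s A. A \<in> carrier L \<Longrightarrow> act ((*) s) A = s \<odot>\<^bsub>L\<^esub> A"
    and ext: "\<And>\<phi> a. \<phi> \<in> diff_ops \<kappa> \<Longrightarrow> act \<phi> (fr a 1) = fr (\<phi> a) 1"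
    using act unfolding extends_D_action_def Let_def by blast+
  interpret left_module "diff_op_ring \<kappa>" "with_smult act L" by (rule lm)
  note mul_op = mult_in_diff_ops[OF mod]
  have "act \<phi> A = D_act \<kappa> \<phi> A" if \<phi>: "\<phi> \<in> diff_ops \<kappa>" and A: "A \<in> carrier L" for \<phi> A
  proof -
    obtain u a where u: "u \<in> W" "A = fr a u" "\<And>y. \<phi> (u * y) = u * \<phi> y"
      using common_denominator[OF nil \<phi> \<phi> A A] by metis
    have "act \<phi> A \<in> carrier L" using smult_closed \<phi> A by simp
    then obtain b v where b: "act \<phi> A = fr b v" "v \<in> W" by (auto simp: carrier_L)
    \<comment> \<open>\<open>\<phi>\<close> commutes with \<open>u\<close> and \<open>u A = a/1\<close>, so \<open>u (\<phi> A) = \<phi> (u A) = \<phi> a / 1\<close>\<close>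
    have "fr (u * b) v = act ((*) u) (act \<phi> A)" using b by (simp add: mul smult_L)
    also have "\<dots> = act ((*) u \<circ> \<phi>) A" using smult_assoc[of "(*) u" \<phi> A] \<phi> A mul_op by simp
    also have "(*) u \<circ> \<phi> = \<phi> \<circ> (*) u" using u(3) by auto
    also have "act (\<phi> \<circ> (*) u) A = act \<phi> (act ((*) u) A)" using smult_assoc[of \<phi> "(*) u" A] \<phi> A mul_op by simp
    also have "act ((*) u) A = fr (u * a) u" using u A by (simp add: mul smult_L)
    also have "\<dots> = fr a 1" using u(1) one_mem by (simp add: fr_eq_iff)
    also have "act \<phi> (fr a 1) = fr (\<phi> a) 1" by (rule ext[OF \<phi>])
    finally have "u * b = v * \<phi> a" using b(2) one_mem by (simp add: fr_eq_iff)
    then show ?thesis using b u \<phi> by (simp add: D_act_fr fr_eq_iff)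
  qed
  note eq = this
  have PiE': "D_act \<kappa> \<in> diff_ops \<kappa> \<rightarrow>\<^sub>E (carrier L \<rightarrow>\<^sub>E carrier L)"
    using extends_D_action_D_act[OF nil mod] unfolding extends_D_action_def Let_def by blast
  show ?thesis
  proof (rule PiE_ext[OF PiE PiE'])
    fix \<phi> assume \<phi>: "\<phi> \<in> diff_ops \<kappa>"
    show "act \<phi> = D_act \<kappa> \<phi>"
      by (rule PiE_ext[OF PiE_mem[OF PiE \<phi>] PiE_mem[OF PiE' \<phi>]]) (rule eq[OF \<phi>])
  qed
qed

lemma D_localization_eq:
  fixes \<kappa> :: "'v::comm_ring_1 \<Rightarrow> 's"
  assumes nil: "(of_nat p :: 's) ^ M = 0" "p > 0" and mod: "Modules.module (\<lambda>c x. \<kappa> c * x)"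
  shows "D_localization \<kappa> W = with_smult (D_act \<kappa>) L"
proof -
  have "(THE act. extends_D_action \<kappa> W act) = D_act \<kappa>"
    by (rule the_equality) (use extends_D_action_D_act[OF assms] extends_D_action_unique[OF assms] in blast)+
  then show ?thesis by (simp add: D_localization_def)
qed

end

section \<open>Quotients of modules over noncommutative rings\<close>

lemma a_repr_independence_add:
  assumes "abelian_subgroup N M" "n \<in> N" "x \<in> carrier M"
  shows "N +>\<^bsub>M\<^esub> (n \<oplus>\<^bsub>M\<^esub> x) = N +>\<^bsub>M\<^esub> x"
proof -
  interpret abelian_subgroup N M by (rule assms)
  have "n \<oplus>\<^bsub>M\<^esub> x \<in> N +>\<^bsub>M\<^esub> x" using assms by (auto simp: a_r_coset_def')
  then show ?thesis using a_repr_independence'[of "n \<oplus>\<^bsub>M\<^esub> x" x] assms(3) by simp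
qed

lemma quotient_module_smult:
  assumes "left_module R M" and sub: "additive_subgroup N M"
    and stable: "\<And>a x. a \<in> carrier R \<Longrightarrow> x \<in> N \<Longrightarrow> a \<odot>\<^bsub>M\<^esub> x \<in> N"
    and a: "a \<in> carrier R" and x: "x \<in> carrier M"
  shows "a \<odot>\<^bsub>quotient_module M N\<^esub> (N +>\<^bsub>M\<^esub> x) = N +>\<^bsub>M\<^esub> (a \<odot>\<^bsub>M\<^esub> x)"
proof -
  interpret left_module R M by fact
  interpret N: abelian_subgroup N M
    by (rule abelian_subgroupI3[OF sub]) (rule M.abelian_group_axioms)
  have "N +>\<^bsub>M\<^esub> (a \<odot>\<^bsub>M\<^esub> y) = N +>\<^bsub>M\<^esub> (a \<odot>\<^bsub>M\<^esub> x)" if "y \<in> N +>\<^bsub>M\<^esub> x" for y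
  proof -
    from that obtain n where n: "n \<in> N" "y = n \<oplus>\<^bsub>M\<^esub> x" by (auto simp: a_r_coset_def')
    then have "a \<odot>\<^bsub>M\<^esub> y = a \<odot>\<^bsub>M\<^esub> n \<oplus>\<^bsub>M\<^esub> a \<odot>\<^bsub>M\<^esub> x"
      using a x N.a_Hcarr smult_r_distr by simp
    then show ?thesis
      using a_repr_independence_add[OF N.abelian_subgroup_axioms stable[OF a n(1)]] smult_closed[OF a x] by simp
  qed
  note eq = ballI[OF this]
  have "(\<Union>y\<in>N +>\<^bsub>M\<^esub> x. N +>\<^bsub>M\<^esub> (a \<odot>\<^bsub>M\<^esub> y)) = N +>\<^bsub>M\<^esub> (a \<odot>\<^bsub>M\<^esub> x)"
    by (rule UN_constant_eq[OF N.a_rcos_self[OF x] eq])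
  then show ?thesis by (simp add: quotient_module_def)
qed

lemma quotient_module_carrier:
  "carrier (quotient_module M N) = {N +>\<^bsub>M\<^esub> x | x. x \<in> carrier M}"
  by (auto simp: quotient_module_def A_RCOSETS_def')

lemma quotient_left_module:
  assumes "left_module R M" and sub: "additive_subgroup N M"
    and stable: "\<And>a x. a \<in> carrier R \<Longrightarrow> x \<in> N \<Longrightarrow> a \<odot>\<^bsub>M\<^esub> x \<in> N"
  shows "left_module R (quotient_module M N)"
proof -
  interpret left_module R M by fact
  interpret N: abelian_subgroup N M
    by (rule abelian_subgroupI3[OF sub]) (rule M.abelian_group_axioms)
  let ?Q = "quotient_module M N"
  note smult = quotient_module_smult[OF assms]
  have add: "(N +>\<^bsub>M\<^esub> x) \<oplus>\<^bsub>?Q\<^esub> (N +>\<^bsub>M\<^esub> y) = N +>\<^bsub>M\<^esub> (x \<oplus>\<^bsub>M\<^esub> y)"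
    if "x \<in> carrier M" "y \<in> carrier M" for x y
    using N.a_rcos_sum[OF that] by (simp add: quotient_module_def)
  show ?thesis
  proof (intro left_module.intro left_module_axioms.intro)
    show "ring R" by (rule R.ring_axioms)
    show "abelian_group ?Q"
      by (rule abelian_group_of_comm_group[OF N.a_factorgroup_is_comm_group])
        (simp_all add: quotient_module_def A_FactGroup_def FactGroup_def A_RCOSETS_def set_add_def)
  qed (auto simp: quotient_module_carrier smult add smult_closed smult_l_distr smult_r_distr
      smult_assoc smult_one)
qed

text \<open>
  The module \<open>R\<^sub>0 \<delta> / R\<^sub>0 r \<delta>\<close>. If \<open>u \<delta> \<in> R\<^sub>0 r \<delta>\<close> for a central \<open>u\<close>, then \<open>u P \<delta> = P u \<delta>\<close> shows that \<open>u\<close>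
  annihilates it.
\<close>

lemma cyclic_subquotient:
  fixes R (structure) and H (structure)
  assumes "left_module R H" and R0: "subring R0 R" and \<delta>: "\<delta> \<in> carrier H" and r: "r \<in> R0"
  defines "C \<equiv> {P \<odot>\<^bsub>H\<^esub> \<delta> | P. P \<in> R0}" and "Z \<equiv> {P \<odot>\<^bsub>H\<^esub> (r \<odot>\<^bsub>H\<^esub> \<delta>) | P. P \<in> R0}"
  defines "Q \<equiv> quotient_module (H\<lparr>carrier := C\<rparr>) Z"
  shows cyclic_subquotient_closed: "a \<in> R0 \<Longrightarrow> A \<in> carrier Q \<Longrightarrow> a \<odot>\<^bsub>Q\<^esub> A \<in> carrier Q"
    and cyclic_subquotient_zero_closed: "\<zero>\<^bsub>Q\<^esub> \<in> carrier Q"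
    and cyclic_subquotient_annihilated:
      "u \<in> R0 \<Longrightarrow> (\<And>P. P \<in> R0 \<Longrightarrow> u \<otimes>\<^bsub>R\<^esub> P = P \<otimes>\<^bsub>R\<^esub> u) \<Longrightarrow> P0 \<in> R0 \<Longrightarrow>
        u \<odot>\<^bsub>H\<^esub> \<delta> = P0 \<odot>\<^bsub>H\<^esub> (r \<odot>\<^bsub>H\<^esub> \<delta>) \<Longrightarrow> A \<in> carrier Q \<Longrightarrow> u \<odot>\<^bsub>Q\<^esub> A = \<zero>\<^bsub>Q\<^esub>"
proof -
  interpret left_module R H by (rule assms(1))
  note subR0 = subringE[OF R0]
  let ?R = "R\<lparr>carrier := R0\<rparr>" and ?H = "H\<lparr>carrier := C\<rparr>"
  have R0R: "P \<in> R0 \<Longrightarrow> P \<in> carrier R" for P using subR0(1) by blast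
  let ?S = "\<lambda>y. {P \<odot>\<^bsub>H\<^esub> y | P. P \<in> R0}"
  have sub: "additive_subgroup (?S y) H" if y: "y \<in> carrier H" for y
  proof (rule additive_subgroupI, rule M.add.subgroupI)
    show "(?S y) \<subseteq> carrier H" using y R0R smult_closed by auto
    show "(?S y) \<noteq> {}" using subR0(3) by auto
    fix z assume "z \<in> (?S y)"
    then obtain P where P: "z = P \<odot>\<^bsub>H\<^esub> y" "P \<in> R0" by auto
    have m: "\<ominus>\<^bsub>R\<^esub> P \<in> R0" using P(2) by (rule subR0(5))
    have "\<ominus>\<^bsub>R\<^esub> P \<odot>\<^bsub>H\<^esub> y \<oplus>\<^bsub>H\<^esub> P \<odot>\<^bsub>H\<^esub> y = \<zero>\<^bsub>R\<^esub> \<odot>\<^bsub>H\<^esub> y"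
      using smult_l_distr[of "\<ominus>\<^bsub>R\<^esub> P" P y] R0R[OF P(2)] R0R[OF m] y by (simp add: R.l_neg)
    moreover have "\<zero>\<^bsub>R\<^esub> \<odot>\<^bsub>H\<^esub> y = \<zero>\<^bsub>H\<^esub>"
    proof -
      have "\<zero>\<^bsub>R\<^esub> \<odot>\<^bsub>H\<^esub> y \<oplus>\<^bsub>H\<^esub> \<zero>\<^bsub>R\<^esub> \<odot>\<^bsub>H\<^esub> y = \<zero>\<^bsub>R\<^esub> \<odot>\<^bsub>H\<^esub> y \<oplus>\<^bsub>H\<^esub> \<zero>\<^bsub>H\<^esub>"
        using smult_l_distr[of "\<zero>\<^bsub>R\<^esub>" "\<zero>\<^bsub>R\<^esub>" y] y smult_closed[of "\<zero>\<^bsub>R\<^esub>" y] by simp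
      then show ?thesis using M.add.l_cancel smult_closed[of "\<zero>\<^bsub>R\<^esub>" y] y by simp
    qed
    ultimately have "\<ominus>\<^bsub>H\<^esub> z = \<ominus>\<^bsub>R\<^esub> P \<odot>\<^bsub>H\<^esub> y"
      using M.minus_equality smult_closed R0R P m y by simp
    then show "\<ominus>\<^bsub>H\<^esub> z \<in> (?S y)"
      using m by auto
  next
    fix z z' assume "z \<in> (?S y)" "z' \<in> (?S y)"
    then obtain P P' where P: "z = P \<odot>\<^bsub>H\<^esub> y" "P \<in> R0" "z' = P' \<odot>\<^bsub>H\<^esub> y" "P' \<in> R0" by auto
    then have "z \<oplus>\<^bsub>H\<^esub> z' = (P \<oplus>\<^bsub>R\<^esub> P') \<odot>\<^bsub>H\<^esub> y" using y R0R smult_l_distr by simp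
    with P(2,4) subR0(7) show "z \<oplus>\<^bsub>H\<^esub> z' \<in> (?S y)" by force
  qed
  have stab: "a \<odot>\<^bsub>H\<^esub> z \<in> (?S y)"
    if "a \<in> R0" "z \<in> (?S y)" "y \<in> carrier H" for a y z
  proof -
    from that obtain P where P: "z = P \<odot>\<^bsub>H\<^esub> y" "P \<in> R0" by auto
    then have "a \<odot>\<^bsub>H\<^esub> z = (a \<otimes>\<^bsub>R\<^esub> P) \<odot>\<^bsub>H\<^esub> y" using that R0R smult_assoc by simp
    with P(2) that(1) subR0(6) show ?thesis by force
  qed
  have CH: "C \<subseteq> carrier H" using \<delta> R0R smult_closed by (auto simp: C_def)
  have ZC: "Z \<subseteq> C"
  proof
    fix z assume "z \<in> Z"
    then obtain P where "P \<in> R0" "z = P \<odot>\<^bsub>H\<^esub> (r \<odot>\<^bsub>H\<^esub> \<delta>)" by (auto simp: Z_def)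
    then have "z = (P \<otimes>\<^bsub>R\<^esub> r) \<odot>\<^bsub>H\<^esub> \<delta>" "P \<otimes>\<^bsub>R\<^esub> r \<in> R0" using r R0R smult_assoc \<delta> subR0(6) by auto
    then show "z \<in> C" by (auto simp: C_def)
  qed
  have rd: "r \<odot>\<^bsub>H\<^esub> \<delta> \<in> carrier H" using r R0R \<delta> smult_closed by blast
  have subC: "additive_subgroup C H" unfolding C_def by (rule sub[OF \<delta>])
  have subZ: "additive_subgroup Z H" unfolding Z_def by (rule sub[OF rd])
  have "left_module ?R ?H"
  proof (intro left_module.intro left_module_axioms.intro)
    show "ring ?R" using R0 R.ring_axioms by (simp add: R.subring_is_ring)
    interpret C: additive_subgroup C H by (rule subC)
    show "abelian_group ?H"
    proof (rule abelian_groupI)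
      show "\<exists>y\<in>carrier ?H. y \<oplus>\<^bsub>?H\<^esub> x = \<zero>\<^bsub>?H\<^esub>" if "x \<in> carrier ?H" for x
        using that CH C.a_inv_closed
        by (intro bexI[of _ "\<ominus>\<^bsub>H\<^esub> x"]) (auto simp: M.l_neg subset_iff)
    qed (use CH in \<open>auto simp: M.a_ac subset_iff C.a_closed C.zero_closed\<close>)
    show "a \<odot>\<^bsub>?H\<^esub> z \<in> carrier ?H" if "a \<in> carrier ?R" "z \<in> carrier ?H" for a z
      using stab[OF _ _ \<delta>] that by (simp add: C_def)
  qed (use CH R0R in \<open>auto simp: smult_l_distr smult_r_distr smult_assoc smult_one subset_iff\<close>)
  moreover have subZC: "additive_subgroup Z ?H"
  proof (rule additive_subgroupI)
    have "subgroup Z (add_monoid H\<lparr>carrier := C\<rparr>)"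
      using M.add.subgroup_incl[OF additive_subgroup.a_subgroup[OF subZ] additive_subgroup.a_subgroup[OF subC] ZC] .
    then show "subgroup Z (add_monoid ?H)" by simp
  qed
  moreover have stabZ: "a \<odot>\<^bsub>?H\<^esub> z \<in> Z" if "a \<in> carrier ?R" "z \<in> Z" for a z
    using stab[OF _ _ rd] that by (simp add: Z_def)
  ultimately interpret Q: left_module ?R Q
    unfolding Q_def by (rule quotient_left_module)
  have smult: "a \<odot>\<^bsub>Q\<^esub> (Z +>\<^bsub>?H\<^esub> z) = Z +>\<^bsub>?H\<^esub> (a \<odot>\<^bsub>H\<^esub> z)" if "a \<in> R0" "z \<in> C" for a z
    using quotient_module_smult[OF \<open>left_module ?R ?H\<close> subZC stabZ, of a z] that
    by (simp add: Q_def)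
  show "a \<in> R0 \<Longrightarrow> A \<in> carrier Q \<Longrightarrow> a \<odot>\<^bsub>Q\<^esub> A \<in> carrier Q" using Q.smult_closed by simp
  show "\<zero>\<^bsub>Q\<^esub> \<in> carrier Q" by simp
  assume u: "u \<in> R0" and central: "\<And>P. P \<in> R0 \<Longrightarrow> u \<otimes>\<^bsub>R\<^esub> P = P \<otimes>\<^bsub>R\<^esub> u"
    and P0: "P0 \<in> R0" "u \<odot>\<^bsub>H\<^esub> \<delta> = P0 \<odot>\<^bsub>H\<^esub> (r \<odot>\<^bsub>H\<^esub> \<delta>)" and A: "A \<in> carrier Q"
  from A obtain z where z: "A = Z +>\<^bsub>?H\<^esub> z" "z \<in> C" by (auto simp: Q_def quotient_module_carrier)
  then obtain P where P: "P \<in> R0" "z = P \<odot>\<^bsub>H\<^esub> \<delta>" by (auto simp: C_def)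
  have "u \<odot>\<^bsub>H\<^esub> z = (P \<otimes>\<^bsub>R\<^esub> u) \<odot>\<^bsub>H\<^esub> \<delta>"
    using P u R0R \<delta> central[OF P(1)] smult_assoc[of u P \<delta>] by simp
  also have "\<dots> = P \<odot>\<^bsub>H\<^esub> (P0 \<odot>\<^bsub>H\<^esub> (r \<odot>\<^bsub>H\<^esub> \<delta>))" using P u R0R \<delta> P0(2) smult_assoc by simp
  also have "\<dots> \<in> Z" using stab[OF P(1) _ rd] P0(1) by (auto simp: Z_def)
  finally have "u \<odot>\<^bsub>H\<^esub> z \<in> Z" .
  then have "Z +>\<^bsub>?H\<^esub> (u \<odot>\<^bsub>H\<^esub> z) = Z"
    using abelian_subgroup.a_rcos_const[OF abelian_subgroupI3[OF subZC]] \<open>left_module ?R ?H\<close>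
    by (simp add: left_module_def)
  then show "u \<odot>\<^bsub>Q\<^esub> A = \<zero>\<^bsub>Q\<^esub>"
    using smult[OF u z(2)] z(1) by (simp add: Q_def quotient_module_def)
qed


section \<open>Length of submodules of free modules\<close>

definition is_submodule :: "('i \<Rightarrow> 'v::comm_ring_1) set \<Rightarrow> bool" where
  "is_submodule A \<longleftrightarrow> (\<lambda>_. 0) \<in> A \<and> (\<forall>a\<in>A. \<forall>b\<in>A. (\<lambda>i. a i + b i) \<in> A) \<and> (\<forall>c. \<forall>a\<in>A. (\<lambda>i. c * a i) \<in> A)"

lemma is_submoduleD:
  assumes "is_submodule A"
  shows "(\<lambda>_. 0) \<in> A" "\<And>a b. a \<in> A \<Longrightarrow> b \<in> A \<Longrightarrow> (\<lambda>i. a i + b i) \<in> A"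
    "\<And>c a. a \<in> A \<Longrightarrow> (\<lambda>i. c * a i) \<in> A" "\<And>a b. a \<in> A \<Longrightarrow> b \<in> A \<Longrightarrow> (\<lambda>i. a i - b i) \<in> A"
proof -
  show 1: "(\<lambda>_. 0) \<in> A" "\<And>a b. a \<in> A \<Longrightarrow> b \<in> A \<Longrightarrow> (\<lambda>i. a i + b i) \<in> A"
    "\<And>c a. a \<in> A \<Longrightarrow> (\<lambda>i. c * a i) \<in> A"
    using assms by (simp_all add: is_submodule_def)
  show "(\<lambda>i. a i - b i) \<in> A" if "a \<in> A" "b \<in> A" for a b
    using 1(2)[OF that(1) 1(3)[OF that(2), of "- 1"]] by simp
qed

text \<open>
  Induction on the number of coordinates. A submodule is determined, within a comparable pair, by its ideal
  of entries at \<open>j\<close> together with its members that vanish at \<open>j\<close>.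
\<close>

lemma submodule_rank:
  fixes \<rho> :: "'v::comm_ring_1 set \<Rightarrow> nat"
  assumes \<rho>: "\<And>A B. is_ideal A \<Longrightarrow> is_ideal B \<Longrightarrow> A \<subset> B \<Longrightarrow> \<rho> A < \<rho> B" and "finite I"
  shows "\<exists>rk :: ('i \<Rightarrow> 'v) set \<Rightarrow> nat. \<forall>A B. is_submodule A \<longrightarrow> is_submodule B \<longrightarrow> A \<subset> B \<longrightarrow>
    (\<forall>a\<in>B. \<forall>i. i \<notin> I \<longrightarrow> a i = 0) \<longrightarrow> rk A < rk B"
  using \<open>finite I\<close>
proof (induction I)
  case empty
  have "A = B" if "is_submodule A" "A \<subseteq> B" "\<forall>a\<in>B. \<forall>i. i \<notin> {} \<longrightarrow> a i = 0" for A B :: "('i \<Rightarrow> 'v) set"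
  proof -
    have "B \<subseteq> {\<lambda>_. 0}" using that(3) by auto
    with that(2) is_submoduleD(1)[OF that(1)] show ?thesis by blast
  qed
  then show ?case by blast
next
  case (insert j I)
  then obtain rk :: "('i \<Rightarrow> 'v) set \<Rightarrow> nat" where
    rk: "\<And>A B. is_submodule A \<Longrightarrow> is_submodule B \<Longrightarrow> A \<subset> B \<Longrightarrow>
      (\<forall>a\<in>B. \<forall>i. i \<notin> I \<longrightarrow> a i = 0) \<Longrightarrow> rk A < rk B" by blast
  define lead where "lead A = (\<lambda>a. a j) ` A" for A :: "('i \<Rightarrow> 'v) set"
  define ker where "ker A = {a \<in> A. a j = 0}" for A :: "('i \<Rightarrow> 'v) set"
  have lead: "is_ideal (lead A)" if A: "is_submodule A" for A
    unfolding is_ideal_def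
  proof (intro conjI ballI allI)
    show "0 \<in> lead A" using is_submoduleD(1)[OF A] by (force simp: lead_def)
    show "a + b \<in> lead A" if "a \<in> lead A" "b \<in> lead A" for a b
      using that is_submoduleD(2)[OF A] by (force simp: lead_def)
    show "c * a \<in> lead A" if "a \<in> lead A" for c a
      using that is_submoduleD(3)[OF A] by (force simp: lead_def)
  qed
  have ker: "is_submodule (ker A)" if "is_submodule A" for A
    using that by (auto simp: is_submodule_def ker_def)
  have "\<rho> (lead A) + rk (ker A) < \<rho> (lead B) + rk (ker B)"
    if A: "is_submodule A" and B: "is_submodule B" and AB: "A \<subset> B"
      and supp: "\<forall>a\<in>B. \<forall>i. i \<notin> insert j I \<longrightarrow> a i = 0" for A B
  proof -
    have l: "lead A = lead B \<or> \<rho> (lead A) < \<rho> (lead B)"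
      using \<rho>[OF lead[OF A] lead[OF B]] AB by (auto simp: lead_def)
    have "\<forall>a\<in>ker B. \<forall>i. i \<notin> I \<longrightarrow> a i = 0" using supp by (auto simp: ker_def)
    note suppk = this
    have "ker A \<subseteq> ker B" using AB by (auto simp: ker_def)
    then have k: "ker A = ker B \<or> rk (ker A) < rk (ker B)"
      using rk[OF ker[OF A] ker[OF B] _ suppk] by blast
    have "\<not> (lead A = lead B \<and> ker A = ker B)"
    proof
      assume eq: "lead A = lead B \<and> ker A = ker B"
      have "B \<subseteq> A"
      proof
        fix b assume b: "b \<in> B"
        then have "b j \<in> lead B" by (auto simp: lead_def)
        then have "b j \<in> lead A" using eq by simp
        then obtain a where a: "a \<in> A" "b j = a j" by (auto simp: lead_def)
        have "(\<lambda>i. b i - a i) \<in> ker B" using is_submoduleD(4)[OF B b] a AB by (auto simp: ker_def)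
        then have "(\<lambda>i. b i - a i) \<in> ker A" using eq by simp
        then have "(\<lambda>i. b i - a i) \<in> A" by (simp add: ker_def)
        from is_submoduleD(2)[OF A this a(1)] show "b \<in> A" by simp
      qed
      with AB show False by blast
    qed
    with l k show ?thesis by auto
  qed
  then show ?case by (intro exI[of _ "\<lambda>A. \<rho> (lead A) + rk (ker A)"]) blast
qed

lemma card_strict_drops:
  fixes r :: "nat \<Rightarrow> nat"
  assumes "\<And>s. r (Suc s) \<le> r s" "\<And>s. s < q \<Longrightarrow> bad s \<Longrightarrow> r (Suc s) < r s"
  shows "card {s. s < q \<and> bad s} + r q \<le> r 0"
  using assms(2)
proof (induction q)
  case (Suc q)
  have split: "{s. s < Suc q \<and> bad s} = {s. s < q \<and> bad s} \<union> (if bad q then {q} else {})"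
    by (auto simp: less_Suc_eq)
  have IH: "card {s. s < q \<and> bad s} + r q \<le> r 0" using Suc by simp
  show ?case
  proof (cases "bad q")
    case True
    then have "card {s. s < Suc q \<and> bad s} = Suc (card {s. s < q \<and> bad s})" unfolding split by simp
    with IH Suc.prems[of q] True show ?thesis by simp
  next
    case False
    then have "card {s. s < Suc q \<and> bad s} = card {s. s < q \<and> bad s}" unfolding split by simp
    with IH assms(1)[of q] show ?thesis by simp
  qed
qed simp

section \<open>Polynomial rings\<close>

locale polynomial_ring =
  fixes \<eta> :: "'v::comm_ring_1 \<Rightarrow> 'r::comm_ring_1" and x :: "nat \<Rightarrow> 'r" and n :: nat
  assumes is_poly: "is_polynomial_ring \<eta> x n"
begin

lemma eta [simp]: "\<eta> 0 = 0" "\<eta> 1 = 1" "\<eta> (a + b) = \<eta> a + \<eta> b" "\<eta> (a * b) = \<eta> a * \<eta> b"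
proof -
  have h: "\<eta> \<in> ring_hom cls_ring cls_ring" using is_poly by (simp add: is_polynomial_ring_def)
  show add: "\<eta> (a + b) = \<eta> a + \<eta> b" for a b using ring_hom_add[OF h, of a b] by simp
  show "\<eta> (a * b) = \<eta> a * \<eta> b" using ring_hom_mult[OF h, of a b] by simp
  show "\<eta> 1 = 1" using ring_hom_one[OF h] by simp
  show "\<eta> 0 = 0" using add[of 0 0] by simp
qed

lemma eta_power: "\<eta> (a ^ k) = \<eta> a ^ k"
  by (induction k) simp_all

lemma eta_of_nat: "\<eta> (of_nat k) = of_nat k"
  by (induction k) simp_all

lemma eta_module: "Modules.module (\<lambda>c r. \<eta> c * r)"
  by unfold_locales (simp_all add: algebra_simps)

definition exps :: "(nat \<Rightarrow>\<^sub>0 nat) set" where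
  "exps = {m. Poly_Mapping.keys m \<subseteq> {..<n}}"

definition mon :: "(nat \<Rightarrow>\<^sub>0 nat) \<Rightarrow> 'r" where
  "mon m = (\<Prod>i<n. x i ^ Poly_Mapping.lookup m i)"

lemma exps_iff: "m \<in> exps \<longleftrightarrow> (\<forall>i\<ge>n. Poly_Mapping.lookup m i = 0)"
proof -
  have "m \<in> exps \<longleftrightarrow> (\<forall>i. Poly_Mapping.lookup m i \<noteq> 0 \<longrightarrow> i < n)"
    by (simp only: exps_def mem_Collect_eq subset_iff in_keys_iff lessThan_iff)
  then show ?thesis by (metis not_le)
qed

lemma exps_add: "m \<in> exps \<Longrightarrow> m' \<in> exps \<Longrightarrow> m + m' \<in> exps"
  by (simp add: exps_iff lookup_add)

lemma zero_exps [simp]: "0 \<in> exps"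
  by (simp add: exps_iff)

lemma mon_zero [simp]: "mon 0 = 1"
  by (simp add: mon_def)

lemma mon_add: "mon (m + m') = mon m * mon m'"
  by (simp add: mon_def lookup_add power_add prod.distrib)

definition coef :: "'r \<Rightarrow> (nat \<Rightarrow>\<^sub>0 nat) \<Rightarrow> 'v" where
  "coef r = Poly_Mapping.lookup (inv_into (formal_polys n) (eval_formal \<eta> x n) r)"

definition supp :: "'r \<Rightarrow> (nat \<Rightarrow>\<^sub>0 nat) set" where
  "supp r = {m. coef r m \<noteq> 0}"

lemma formal_bij: "bij_betw (eval_formal \<eta> x n) (formal_polys n) UNIV"
  using is_poly by (simp add: is_polynomial_ring_def)

lemma coef_not_supp: "m \<notin> supp r \<Longrightarrow> coef r m = 0"
  by (simp add: supp_def)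

lemma finite_supp: "finite (supp r)" and supp_subset: "supp r \<subseteq> exps"
  and expansion: "r = (\<Sum>m\<in>supp r. \<eta> (coef r m) * mon m)"
proof -
  let ?q = "inv_into (formal_polys n) (eval_formal \<eta> x n) r"
  have keys: "supp r = Poly_Mapping.keys ?q"
    by (auto simp: supp_def coef_def in_keys_iff)
  have img: "r \<in> eval_formal \<eta> x n ` formal_polys n" using formal_bij by (simp add: bij_betw_def)
  then have "?q \<in> formal_polys n" by (rule inv_into_into)
  then show "supp r \<subseteq> exps" unfolding keys by (auto simp: formal_polys_def exps_def)
  show "finite (supp r)" unfolding keys by simp
  have "eval_formal \<eta> x n ?q = r" using img by (rule f_inv_into_f)
  then show "r = (\<Sum>m\<in>supp r. \<eta> (coef r m) * mon m)"
    unfolding keys by (simp add: eval_formal_def coef_def mon_def)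
qed

lemma expansion_upto:
  assumes "finite A" "supp r \<subseteq> A"
  shows "r = (\<Sum>m\<in>A. \<eta> (coef r m) * mon m)"
proof -
  have "(\<Sum>m\<in>supp r. \<eta> (coef r m) * mon m) = (\<Sum>m\<in>A. \<eta> (coef r m) * mon m)"
    by (rule sum.mono_neutral_left) (use assms in \<open>auto simp: supp_def\<close>)
  then show ?thesis using expansion[of r] by simp
qed

lemma coef_sum_mono:
  assumes "finite A" "A \<subseteq> exps"
  shows "coef (\<Sum>m\<in>A. \<eta> (c m) * mon m) k = (if k \<in> A then c k else 0)"
proof -
  let ?f = "\<lambda>k. if k \<in> A then c k else 0"
  let ?q = "Abs_poly_mapping ?f"
  have "{k. ?f k \<noteq> 0} \<subseteq> A" by auto
  then have fin: "finite {k. ?f k \<noteq> 0}" using assms(1) finite_subset by blast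
  then have lookup: "Poly_Mapping.lookup ?q = ?f" by (rule lookup_Abs_poly_mapping)
  have keys: "Poly_Mapping.keys ?q \<subseteq> A" by (auto simp: in_keys_iff lookup split: if_splits)
  have q: "?q \<in> formal_polys n" using keys assms(2) by (auto simp: formal_polys_def exps_def)
  have "eval_formal \<eta> x n ?q = (\<Sum>m\<in>Poly_Mapping.keys ?q. \<eta> (?f m) * mon m)"
    by (simp add: eval_formal_def lookup mon_def)
  also have "\<dots> = (\<Sum>m\<in>A. \<eta> (?f m) * mon m)"
  proof (rule sum.mono_neutral_left[OF assms(1) keys], rule ballI)
    fix m assume "m \<in> A - Poly_Mapping.keys ?q"
    then have "Poly_Mapping.lookup ?q m = 0" by (metis DiffD2 in_keys_iff)
    then have "?f m = 0" by (simp only: lookup)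
    then show "\<eta> (?f m) * mon m = 0" by simp
  qed
  also have "\<dots> = (\<Sum>m\<in>A. \<eta> (c m) * mon m)" by (rule sum.cong) auto
  finally have "inv_into (formal_polys n) (eval_formal \<eta> x n) (\<Sum>m\<in>A. \<eta> (c m) * mon m) = ?q"
    using formal_bij q by (auto simp: bij_betw_def intro: inv_into_f_eq)
  then show ?thesis by (simp add: coef_def lookup)
qed

lemma coef_add: "coef (r + s) m = coef r m + coef s m"
proof -
  let ?A = "supp r \<union> supp s"
  have A: "finite ?A" "?A \<subseteq> exps" using finite_supp supp_subset by auto
  have "r = (\<Sum>m\<in>?A. \<eta> (coef r m) * mon m)" "s = (\<Sum>m\<in>?A. \<eta> (coef s m) * mon m)"
    using A by (auto intro!: expansion_upto)
  then have "r + s = (\<Sum>m\<in>?A. \<eta> (coef r m) * mon m) + (\<Sum>m\<in>?A. \<eta> (coef s m) * mon m)" by simp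
  also have "\<dots> = (\<Sum>m\<in>?A. \<eta> (coef r m + coef s m) * mon m)"
    by (simp add: distrib_right sum.distrib)
  finally have eq: "r + s = (\<Sum>m\<in>?A. \<eta> (coef r m + coef s m) * mon m)" .
  show ?thesis unfolding eq coef_sum_mono[OF A] by (auto simp: coef_not_supp)
qed

lemma coef_smult: "coef (\<eta> c * r) m = c * coef r m"
proof -
  have A: "finite (supp r)" "supp r \<subseteq> exps" by (rule finite_supp supp_subset)+
  have "\<eta> c * r = \<eta> c * (\<Sum>m\<in>supp r. \<eta> (coef r m) * mon m)" using expansion[of r] by simp
  also have "\<dots> = (\<Sum>m\<in>supp r. \<eta> (c * coef r m) * mon m)"
    by (simp add: sum_distrib_left mult.assoc)
  finally have eq: "\<eta> c * r = (\<Sum>m\<in>supp r. \<eta> (c * coef r m) * mon m)" .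
  show ?thesis unfolding eq coef_sum_mono[OF A] by (auto simp: coef_not_supp)
qed

lemma coef_zero [simp]: "coef 0 m = 0"
  using coef_smult[of 0 0 m] by simp

lemma coef_mono: "k \<in> exps \<Longrightarrow> coef (mon k) m = (if m = k then 1 else 0)"
  using coef_sum_mono[of "{k}" "\<lambda>_. 1" m] by simp

lemma coef_inject: "coef r = coef s \<Longrightarrow> r = s"
  using expansion[of r] expansion[of s] by (simp add: supp_def)

definition lin_ext :: "((nat \<Rightarrow>\<^sub>0 nat) \<Rightarrow> 'r) \<Rightarrow> 'r \<Rightarrow> 'r" where
  "lin_ext g r = (\<Sum>m\<in>supp r. \<eta> (coef r m) * g m)"

lemma lin_ext_upto:
  assumes "finite A" "supp r \<subseteq> A"
  shows "lin_ext g r = (\<Sum>m\<in>A. \<eta> (coef r m) * g m)"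
  unfolding lin_ext_def
  by (rule sum.mono_neutral_left) (use assms in \<open>auto simp: supp_def\<close>)

lemma V_linear_lin_ext: "V_linear \<eta> (lin_ext g)"
  unfolding V_linear_iff
proof (intro conjI allI)
  show "lin_ext g (r + s) = lin_ext g r + lin_ext g s" for r s
  proof -
    let ?A = "supp r \<union> supp s"
    have "supp (r + s) \<subseteq> ?A" by (auto simp: supp_def coef_add)
    then show ?thesis
      using finite_supp by (simp add: lin_ext_upto[of ?A] coef_add distrib_right sum.distrib)
  qed
  show "lin_ext g (\<eta> c * r) = \<eta> c * lin_ext g r" for c r
  proof -
    have "supp (\<eta> c * r) \<subseteq> supp r" by (auto simp: supp_def coef_smult)
    then show ?thesis
      using finite_supp by (simp add: lin_ext_upto[of "supp r"] coef_smult sum_distrib_left mult.assoc)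
  qed
qed (rule eta_module)

lemma lin_ext_mono:
  assumes "m \<in> exps"
  shows "lin_ext g (mon m) = g m"
proof -
  have "supp (mon m) \<subseteq> {m}" using assms by (auto simp: supp_def coef_mono)
  then show ?thesis using lin_ext_upto[of "{m}" "mon m" g] assms by (simp add: coef_mono)
qed

lemma V_linear_expansion:
  assumes "V_linear \<eta> \<phi>"
  shows "\<phi> r = (\<Sum>m\<in>supp r. \<eta> (coef r m) * \<phi> (mon m))"
proof -
  interpret additive \<phi> using assms by (rule V_linear_additive)
  have "\<phi> r = \<phi> (\<Sum>m\<in>supp r. \<eta> (coef r m) * mon m)" using expansion[of r] by simp
  also have "\<dots> = (\<Sum>m\<in>supp r. \<phi> (\<eta> (coef r m) * mon m))" by (rule sum)
  also have "\<dots> = (\<Sum>m\<in>supp r. \<eta> (coef r m) * \<phi> (mon m))"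
    using assms by (simp add: V_linear_iff)
  finally show ?thesis .
qed

lemma V_linear_eqI:
  assumes "V_linear \<eta> \<phi>" "V_linear \<eta> \<psi>" "\<And>m. m \<in> exps \<Longrightarrow> \<phi> (mon m) = \<psi> (mon m)"
  shows "\<phi> r = \<psi> r"
  unfolding V_linear_expansion[OF assms(1), of r] V_linear_expansion[OF assms(2), of r]
  by (rule sum.cong) (use assms(3) supp_subset[of r] in auto)

lemma V_linear_mult_right: "V_linear \<eta> \<phi> \<Longrightarrow> V_linear \<eta> (\<lambda>r. \<phi> (h * r))"
  by (simp add: V_linear_iff distrib_left mult.left_commute[of h])

lemma V_linear_mult_left: "V_linear \<eta> \<phi> \<Longrightarrow> V_linear \<eta> (\<lambda>r. h * \<phi> r)"
  by (simp add: V_linear_iff distrib_left mult.left_commute[of h])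

lemma V_linear_comp: "V_linear \<eta> \<phi> \<Longrightarrow> V_linear \<eta> \<psi> \<Longrightarrow> V_linear \<eta> (\<lambda>r. \<phi> (\<psi> r))"
  by (simp add: V_linear_iff)

lemma V_linear_id: "V_linear \<eta> (\<lambda>r. r)"
  by (simp add: V_linear_iff eta_module)

lemma V_linear_sum: "(\<And>b. b \<in> B \<Longrightarrow> V_linear \<eta> (\<phi> b)) \<Longrightarrow> V_linear \<eta> (\<lambda>r. \<Sum>b\<in>B. \<phi> b r)"
  by (simp add: V_linear_iff sum.distrib sum_distrib_left eta_module)

subsection \<open>Degrees\<close>

definition deg_le :: "nat \<Rightarrow> 'r set" where
  "deg_le d = {r. \<forall>m\<in>supp r. \<forall>i. Poly_Mapping.lookup m i \<le> d}"

lemma deg_le_zero [simp]: "0 \<in> deg_le d"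
  by (simp add: deg_le_def supp_def)

lemma deg_le_add: "r \<in> deg_le d \<Longrightarrow> s \<in> deg_le d \<Longrightarrow> r + s \<in> deg_le d"
  by (auto simp: deg_le_def supp_def coef_add) (metis add.right_neutral)

lemma deg_le_smult: "r \<in> deg_le d \<Longrightarrow> \<eta> c * r \<in> deg_le d"
proof -
  have "supp (\<eta> c * r) \<subseteq> supp r" by (auto simp: supp_def coef_smult)
  then show "r \<in> deg_le d \<Longrightarrow> \<eta> c * r \<in> deg_le d" unfolding deg_le_def by blast
qed

lemma deg_le_sum: "(\<And>a. a \<in> A \<Longrightarrow> r a \<in> deg_le d) \<Longrightarrow> (\<Sum>a\<in>A. r a) \<in> deg_le d"
  by (induction A rule: infinite_finite_induct) (simp_all add: deg_le_add)

lemma deg_le_mono: "m \<in> exps \<Longrightarrow> (\<And>i. Poly_Mapping.lookup m i \<le> d) \<Longrightarrow> mon m \<in> deg_le d"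
  by (auto simp: deg_le_def supp_def coef_mono split: if_splits)

lemma deg_le_mult:
  assumes "r \<in> deg_le d" "s \<in> deg_le d'"
  shows "r * s \<in> deg_le (d + d')"
proof -
  have "r * s = (\<Sum>m\<in>supp r. \<eta> (coef r m) * mon m) * (\<Sum>m\<in>supp s. \<eta> (coef s m) * mon m)"
    using expansion[of r] expansion[of s] by simp
  also have "\<dots> = (\<Sum>m\<in>supp r. \<Sum>m'\<in>supp s. \<eta> (coef r m * coef s m') * mon (m + m'))"
    by (simp add: sum_product mon_add algebra_simps)
  also have "\<dots> \<in> deg_le (d + d')"
  proof (intro deg_le_sum deg_le_smult deg_le_mono)
    fix m m' i assume "m \<in> supp r" "m' \<in> supp s"
    then show "m + m' \<in> exps" "Poly_Mapping.lookup (m + m') i \<le> d + d'"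
      using assms supp_subset[of r] supp_subset[of s]
      by (auto intro!: exps_add add_mono simp: deg_le_def lookup_add)
  qed
  finally show ?thesis .
qed

lemma deg_le_power: "r \<in> deg_le d \<Longrightarrow> r ^ k \<in> deg_le (k * d)"
proof (induction k)
  case 0
  then show ?case using deg_le_mono[of 0 0] by simp
next
  case (Suc k)
  then show ?case using deg_le_mult[of r d "r ^ k" "k * d"] by simp
qed

lemma deg_le_weaken: "d \<le> d' \<Longrightarrow> r \<in> deg_le d \<Longrightarrow> r \<in> deg_le d'"
  by (auto simp: deg_le_def intro: le_trans)

lemma exists_deg_le: "\<exists>d. r \<in> deg_le d"
proof -
  let ?d = "\<Sum>m\<in>supp r. \<Sum>i<n. Poly_Mapping.lookup m i"
  have "Poly_Mapping.lookup m i \<le> ?d" if "m \<in> supp r" for m i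
  proof (cases "i < n")
    case True
    have "Poly_Mapping.lookup m i \<le> (\<Sum>i<n. Poly_Mapping.lookup m i)"
      by (rule member_le_sum) (use True in auto)
    also have "\<dots> \<le> ?d" by (rule member_le_sum) (use that finite_supp in auto)
    finally show ?thesis .
  next
    case False
    then have "Poly_Mapping.lookup m i = 0" using that supp_subset[of r] by (auto simp: exps_iff subset_iff)
    then show ?thesis by simp
  qed
  then show ?thesis by (auto simp: deg_le_def)
qed

lemma finite_bounded_exps: "finite {m \<in> exps. \<forall>i. Poly_Mapping.lookup m i \<le> d}"
proof (rule finite_imageD)
  let ?F = "{g :: nat \<Rightarrow> nat. \<forall>i. (i \<in> {..<n} \<longrightarrow> g i \<in> {..d}) \<and> (i \<notin> {..<n} \<longrightarrow> g i = 0)}"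
  have "finite ?F" by (rule finite_set_of_finite_funs) auto
  moreover have "Poly_Mapping.lookup ` {m \<in> exps. \<forall>i. Poly_Mapping.lookup m i \<le> d} \<subseteq> ?F"
    by (auto simp: exps_iff)
  ultimately show "finite (Poly_Mapping.lookup ` {m \<in> exps. \<forall>i. Poly_Mapping.lookup m i \<le> d})"
    by (rule finite_subset[rotated])
qed (rule inj_onI, rule poly_mapping_eqI, simp)

subsection \<open>The subring of polynomials in the \<open>q\<close>-th powers of the variables\<close>

abbreviation times_exp :: "nat \<Rightarrow> (nat \<Rightarrow>\<^sub>0 nat) \<Rightarrow> (nat \<Rightarrow>\<^sub>0 nat)" where
  "times_exp q \<equiv> Poly_Mapping.map (\<lambda>k. q * k)"
abbreviation div_exp :: "nat \<Rightarrow> (nat \<Rightarrow>\<^sub>0 nat) \<Rightarrow> (nat \<Rightarrow>\<^sub>0 nat)" where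
  "div_exp q \<equiv> Poly_Mapping.map (\<lambda>k. k div q)"
abbreviation mod_exp :: "nat \<Rightarrow> (nat \<Rightarrow>\<^sub>0 nat) \<Rightarrow> (nat \<Rightarrow>\<^sub>0 nat)" where
  "mod_exp q \<equiv> Poly_Mapping.map (\<lambda>k. k mod q)"

lemma lookup_map_zero: "f 0 = 0 \<Longrightarrow> Poly_Mapping.lookup (Poly_Mapping.map f m) i = f (Poly_Mapping.lookup m i)"
  by (simp add: Poly_Mapping.map.rep_eq when_def)

lemma map_exps: "f 0 = 0 \<Longrightarrow> m \<in> exps \<Longrightarrow> Poly_Mapping.map f m \<in> exps"
  by (simp add: exps_iff lookup_map_zero)

lemma mod_div_exp: "mod_exp q m + times_exp q (div_exp q m) = m"
  by (rule poly_mapping_eqI) (simp add: lookup_add lookup_map_zero)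

lemma mod_times_exp_add: "mod_exp q (times_exp q k + m) = mod_exp q m"
  by (rule poly_mapping_eqI) (simp add: lookup_add lookup_map_zero)

lemma div_times_exp_add: "q > 0 \<Longrightarrow> div_exp q (times_exp q k + m) = k + div_exp q m"
  by (rule poly_mapping_eqI) (simp add: lookup_add lookup_map_zero)

lemma times_exp_add: "times_exp q (k + m) = times_exp q k + times_exp q m"
  by (rule poly_mapping_eqI) (simp add: lookup_add lookup_map_zero algebra_simps)

lemma mon_times_exp: "mon (times_exp q m) = mon m ^ q"
  by (simp add: mon_def lookup_map_zero power_mult mult.commute[of q] prod_power_distrib)

text \<open>
  The endomorphism of the \<open>V\<close>-algebra \<open>R\<close> with \<open>x\<^sub>i \<mapsto> x\<^sub>i^q\<close>. Its image is \<open>V[x\<^sub>1^q, \<dots>, x\<^sub>n^q]\<close>.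
\<close>

definition frob :: "nat \<Rightarrow> 'r \<Rightarrow> 'r" where
  "frob q = lin_ext (\<lambda>m. mon (times_exp q m))"

lemma V_linear_frob: "V_linear \<eta> (frob q)"
  unfolding frob_def by (rule V_linear_lin_ext)

lemma frob_mono: "m \<in> exps \<Longrightarrow> frob q (mon m) = mon (times_exp q m)"
  by (simp add: frob_def lin_ext_mono)

lemma frob_mult: "frob q (r * s) = frob q r * frob q s"
proof (rule V_linear_eqI[of "\<lambda>s. frob q (r * s)" "\<lambda>s. frob q r * frob q s"])
  show "V_linear \<eta> (\<lambda>s. frob q (r * s))" "V_linear \<eta> (\<lambda>s. frob q r * frob q s)"
    by (rule V_linear_mult_right[OF V_linear_frob], rule V_linear_mult_left[OF V_linear_frob])
  fix m assume m: "m \<in> exps"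
  have "frob q (mon m * r) = frob q (mon m) * frob q r"
  proof (rule V_linear_eqI[of "\<lambda>r. frob q (mon m * r)" "\<lambda>r. frob q (mon m) * frob q r"])
    show "V_linear \<eta> (\<lambda>r. frob q (mon m * r))" "V_linear \<eta> (\<lambda>r. frob q (mon m) * frob q r)"
      by (rule V_linear_mult_right[OF V_linear_frob], rule V_linear_mult_left[OF V_linear_frob])
    fix k assume k: "k \<in> exps"
    have "frob q (mon m * mon k) = mon (times_exp q (m + k))"
      unfolding mon_add[symmetric] by (rule frob_mono[OF exps_add[OF m k]])
    then show "frob q (mon m * mon k) = frob q (mon m) * frob q (mon k)"
      using m k by (simp only: frob_mono times_exp_add mon_add)
  qed
  then show "frob q (r * mon m) = frob q r * frob q (mon m)" by (simp add: mult.commute)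
qed

lemma frob_one [simp]: "frob q 1 = 1"
proof -
  have "times_exp q 0 = 0" by (rule poly_mapping_eqI) (simp add: lookup_map_zero)
  then show ?thesis using frob_mono[of 0 q] by simp
qed

lemma frob_power: "frob q (r ^ k) = frob q r ^ k"
  by (induction k) (simp_all add: frob_mult)

text \<open>
  \<open>R\<close> is free over the image of \<open>frob q\<close> on the monomials with exponents below \<open>q\<close>. This is the coefficient at the
  monomial \<open>b\<close>, pulled back along \<open>frob q\<close>.
\<close>

definition frob_coeff :: "nat \<Rightarrow> (nat \<Rightarrow>\<^sub>0 nat) \<Rightarrow> 'r \<Rightarrow> 'r" where
  "frob_coeff q b = lin_ext (\<lambda>m. if mod_exp q m = b then mon (div_exp q m) else 0)"

text \<open>
  The \<open>R\<close>-linear maps to \<open>R\<close> from \<open>R\<close> viewed as an \<open>R\<close>-module through \<open>frob q\<close>. Their values at a fixed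
  element form an ideal, as for Cartier operators in characteristic \<open>p\<close>.
\<close>

definition cartier_maps :: "nat \<Rightarrow> ('r \<Rightarrow> 'r) set" where
  "cartier_maps q = {\<psi>. V_linear \<eta> \<psi> \<and> (\<forall>h r. \<psi> (frob q h * r) = h * \<psi> r)}"

lemma frob_coeff_cartier:
  assumes "q > 0"
  shows "frob_coeff q b \<in> cartier_maps q"
proof -
  have lin: "V_linear \<eta> (frob_coeff q b)" unfolding frob_coeff_def by (rule V_linear_lin_ext)
  have "frob_coeff q b (frob q h * r) = h * frob_coeff q b r" for h r
  proof (rule V_linear_eqI[of "\<lambda>r. frob_coeff q b (frob q h * r)" "\<lambda>r. h * frob_coeff q b r"])
    show "V_linear \<eta> (\<lambda>r. frob_coeff q b (frob q h * r))" "V_linear \<eta> (\<lambda>r. h * frob_coeff q b r)"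
      by (rule V_linear_mult_right[OF lin], rule V_linear_mult_left[OF lin])
    fix m assume m: "m \<in> exps"
    have "frob_coeff q b (mon m * frob q h) = frob_coeff q b (mon m) * h"
    proof (rule V_linear_eqI[of "\<lambda>h. frob_coeff q b (mon m * frob q h)" "\<lambda>h. frob_coeff q b (mon m) * h"])
      show "V_linear \<eta> (\<lambda>h. frob_coeff q b (mon m * frob q h))"
        by (rule V_linear_comp[OF V_linear_mult_right[OF lin] V_linear_frob])
      show "V_linear \<eta> (\<lambda>h. frob_coeff q b (mon m) * h)" by (rule V_linear_mult_left[OF V_linear_id])
      fix k assume k: "k \<in> exps"
      have prod: "mon m * frob q (mon k) = mon (times_exp q k + m)"
        using k by (simp only: frob_mono mon_add mult.commute)
      have "times_exp q k + m \<in> exps" using k m by (simp add: exps_add map_exps)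
      then have "frob_coeff q b (mon m * frob q (mon k)) = (if mod_exp q m = b then mon (k + div_exp q m) else 0)"
        unfolding prod using assms by (simp only: frob_coeff_def lin_ext_mono mod_times_exp_add div_times_exp_add)
      also have "\<dots> = (if mod_exp q m = b then mon (div_exp q m) else 0) * mon k"
        by (simp add: mon_add mult.commute)
      also have "\<dots> = frob_coeff q b (mon m) * mon k" using m by (simp only: frob_coeff_def lin_ext_mono)
      finally show "frob_coeff q b (mon m * frob q (mon k)) = frob_coeff q b (mon m) * mon k" .
    qed
    then show "frob_coeff q b (frob q h * mon m) = h * frob_coeff q b (mon m)" by (simp add: mult.commute)
  qed
  with lin show ?thesis by (simp add: cartier_maps_def)
qed

definition residue_exps :: "nat \<Rightarrow> (nat \<Rightarrow>\<^sub>0 nat) set" where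
  "residue_exps q = {b \<in> exps. \<forall>i. Poly_Mapping.lookup b i \<le> q - 1}"

lemma finite_residue_exps: "finite (residue_exps q)"
  unfolding residue_exps_def by (rule finite_bounded_exps)

lemma frob_coeff_decomposition:
  assumes "q > 0"
  shows "(\<Sum>b\<in>residue_exps q. mon b * frob q (frob_coeff q b r)) = r"
proof (rule V_linear_eqI[of "\<lambda>r. \<Sum>b\<in>residue_exps q. mon b * frob q (frob_coeff q b r)" "\<lambda>r. r"])
  have lin: "V_linear \<eta> (frob_coeff q b)" for b using frob_coeff_cartier[OF assms, of b] unfolding cartier_maps_def by blast
  show "V_linear \<eta> (\<lambda>r. \<Sum>b\<in>residue_exps q. mon b * frob q (frob_coeff q b r))"
    by (rule V_linear_sum, rule V_linear_mult_left, rule V_linear_comp[OF V_linear_frob lin])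
  show "V_linear \<eta> (\<lambda>r. r)" by (rule V_linear_id)
  fix m assume m: "m \<in> exps"
  interpret additive "frob q" by (rule V_linear_additive[OF V_linear_frob])
  have mem: "mod_exp q m \<in> residue_exps q"
  proof -
    have "k mod q \<le> q - 1" for k using mod_less_divisor[OF assms, of k] by linarith
    then show ?thesis using m by (simp add: residue_exps_def map_exps lookup_map_zero)
  qed
  have "(\<Sum>b\<in>residue_exps q. mon b * frob q (frob_coeff q b (mon m)))
      = (\<Sum>b\<in>residue_exps q. if mod_exp q m = b then mon b * frob q (mon (div_exp q m)) else 0)"
    using m by (intro sum.cong) (auto simp: frob_coeff_def lin_ext_mono zero)
  also have "\<dots> = mon (mod_exp q m) * frob q (mon (div_exp q m))"
    using mem finite_residue_exps by simp
  also have "\<dots> = mon m" using m by (simp add: frob_mono map_exps mod_div_exp flip: mon_add)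
  finally show "(\<Sum>b\<in>residue_exps q. mon b * frob q (frob_coeff q b (mon m))) = mon m" .
qed

lemma frob_coeff_deg_le:
  assumes "r \<in> deg_le (q * d)" "q > 0"
  shows "frob_coeff q b r \<in> deg_le d"
  unfolding frob_coeff_def lin_ext_def
proof (intro deg_le_sum deg_le_smult)
  fix m assume m: "m \<in> supp r"
  then have "Poly_Mapping.lookup m i \<le> q * d" for i using assms(1) by (simp add: deg_le_def)
  then have "Poly_Mapping.lookup m i div q \<le> q * d div q" for i by (rule div_le_mono)
  then have "Poly_Mapping.lookup m i div q \<le> d" for i using assms(2) by simp
  moreover have "div_exp q m \<in> exps" using m supp_subset[of r] by (intro map_exps) auto
  ultimately have "mon (div_exp q m) \<in> deg_le d" by (intro deg_le_mono) (simp_all add: lookup_map_zero)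
  then show "(if mod_exp q m = b then mon (div_exp q m) else 0) \<in> deg_le d" by simp
qed

subsection \<open>Bounding the exceptional residues\<close>

text \<open>
  The operator \<open>\<phi>\<close> divides the whole vector \<open>(f^(qi+s+1))\<^sub>i\<close>, \<open>i < P\<close>, by \<open>f\<close> at once.
\<close>

definition divides_power :: "'r \<Rightarrow> nat \<Rightarrow> nat \<Rightarrow> nat \<Rightarrow> ('r \<Rightarrow> 'r) \<Rightarrow> bool" where
  "divides_power f P q s \<phi> \<longleftrightarrow> V_linear \<eta> \<phi> \<and> (\<forall>h r. \<phi> (frob q h * r) = frob q h * \<phi> r) \<and>
     (\<forall>i<P. \<phi> (f ^ (q * i + s + 1)) = f ^ (q * i + s))"

definition power_coefs :: "'r \<Rightarrow> nat \<Rightarrow> nat \<Rightarrow> nat \<Rightarrow> ('r \<Rightarrow> 'r) \<Rightarrow> nat \<times> (nat \<Rightarrow>\<^sub>0 nat) \<Rightarrow> 'v" where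
  "power_coefs f P q s \<psi> = (\<lambda>(i, m). if i < P then coef (\<psi> (f ^ (q * i + s))) m else 0)"

text \<open>
  The bound on the degree places these vectors into a free \<open>V\<close>-module of finite rank that does not depend on
  \<open>q\<close>.
\<close>

definition cartier_images :: "'r \<Rightarrow> nat \<Rightarrow> nat \<Rightarrow> nat \<Rightarrow> nat \<Rightarrow> (nat \<times> (nat \<Rightarrow>\<^sub>0 nat) \<Rightarrow> 'v) set" where
  "cartier_images f P D q s = power_coefs f P q s `
     {\<psi> \<in> cartier_maps q. \<forall>i<P. \<psi> (f ^ (q * i + s)) \<in> deg_le D}"

lemma cartier_imagesE:
  assumes "a \<in> cartier_images f P D q s"
  obtains \<psi> where "a = power_coefs f P q s \<psi>" "\<psi> \<in> cartier_maps q"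
    "\<forall>i<P. \<psi> (f ^ (q * i + s)) \<in> deg_le D"
proof -
  obtain \<psi> where "a = power_coefs f P q s \<psi>"
    "\<psi> \<in> {\<psi> \<in> cartier_maps q. \<forall>i<P. \<psi> (f ^ (q * i + s)) \<in> deg_le D}"
    using assms unfolding cartier_images_def by (rule imageE)
  then show ?thesis by (intro that[of \<psi>]) simp_all
qed

lemma cartier_imagesI:
  assumes "\<psi> \<in> cartier_maps q" "\<forall>i<P. \<psi> (f ^ (q * i + s)) \<in> deg_le D"
    "a = power_coefs f P q s \<psi>"
  shows "a \<in> cartier_images f P D q s"
  unfolding cartier_images_def assms(3) by (rule imageI) (use assms(1,2) in simp)

lemma cartier_images_submodule: "is_submodule (cartier_images f P D q s)"
  unfolding is_submodule_def
proof (intro conjI ballI allI)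
  show "(\<lambda>_. 0) \<in> cartier_images f P D q s"
    by (rule cartier_imagesI[of "\<lambda>_. 0"])
      (auto simp: cartier_maps_def V_linear_iff eta_module power_coefs_def fun_eq_iff)
next
  fix a b assume a: "a \<in> cartier_images f P D q s" and b: "b \<in> cartier_images f P D q s"
  obtain \<psi> where \<psi>: "a = power_coefs f P q s \<psi>" "\<psi> \<in> cartier_maps q"
    "\<forall>i<P. \<psi> (f ^ (q * i + s)) \<in> deg_le D" using a by (rule cartier_imagesE)
  obtain \<psi>' where \<psi>': "b = power_coefs f P q s \<psi>'" "\<psi>' \<in> cartier_maps q"
    "\<forall>i<P. \<psi>' (f ^ (q * i + s)) \<in> deg_le D" using b by (rule cartier_imagesE)
  show "(\<lambda>i. a i + b i) \<in> cartier_images f P D q s"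
  proof (rule cartier_imagesI[of "\<lambda>r. \<psi> r + \<psi>' r"])
    show "(\<lambda>r. \<psi> r + \<psi>' r) \<in> cartier_maps q"
      using \<psi>(2) \<psi>'(2) by (simp add: cartier_maps_def V_linear_iff distrib_left ac_simps)
    show "(\<lambda>i. a i + b i) = power_coefs f P q s (\<lambda>r. \<psi> r + \<psi>' r)"
      by (auto simp: \<psi>(1) \<psi>'(1) power_coefs_def coef_add fun_eq_iff)
  qed (use \<psi>(3) \<psi>'(3) in \<open>simp add: deg_le_add\<close>)
next
  fix c a assume a: "a \<in> cartier_images f P D q s"
  obtain \<psi> where \<psi>: "a = power_coefs f P q s \<psi>" "\<psi> \<in> cartier_maps q"
    "\<forall>i<P. \<psi> (f ^ (q * i + s)) \<in> deg_le D" using a by (rule cartier_imagesE)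
  show "(\<lambda>i. c * a i) \<in> cartier_images f P D q s"
  proof (rule cartier_imagesI[of "\<lambda>r. \<eta> c * \<psi> r"])
    show "(\<lambda>r. \<eta> c * \<psi> r) \<in> cartier_maps q"
      using \<psi>(2) V_linear_mult_left[of \<psi> "\<eta> c"] by (simp add: cartier_maps_def mult.left_commute)
    show "(\<lambda>i. c * a i) = power_coefs f P q s (\<lambda>r. \<eta> c * \<psi> r)"
      by (auto simp: \<psi>(1) power_coefs_def coef_smult fun_eq_iff)
  qed (use \<psi>(3) in \<open>simp add: deg_le_smult\<close>)
qed

lemma cartier_images_decreasing: "cartier_images f P D q (Suc s) \<subseteq> cartier_images f P D q s"
proof
  fix a assume a: "a \<in> cartier_images f P D q (Suc s)"
  obtain \<psi> where \<psi>: "a = power_coefs f P q (Suc s) \<psi>" "\<psi> \<in> cartier_maps q"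
    "\<forall>i<P. \<psi> (f ^ (q * i + Suc s)) \<in> deg_le D" using a by (rule cartier_imagesE)
  show "a \<in> cartier_images f P D q s"
  proof (rule cartier_imagesI[of "\<lambda>r. \<psi> (f * r)"])
    show "(\<lambda>r. \<psi> (f * r)) \<in> cartier_maps q"
      using \<psi>(2) V_linear_mult_right[of \<psi> f] by (simp add: cartier_maps_def mult.left_commute[of f])
    show "a = power_coefs f P q s (\<lambda>r. \<psi> (f * r))"
      by (auto simp: \<psi>(1) power_coefs_def fun_eq_iff)
    show "\<forall>i<P. \<psi> (f * f ^ (q * i + s)) \<in> deg_le D" using \<psi>(3) by simp
  qed
qed

text \<open>
  The coefficients \<open>frob_coeff q b\<close> of the \<open>f^(qi+s)\<close> have degree at most \<open>P d\<close>, since \<open>qi + s \<le> qP\<close>.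
  So by assumption they are images \<open>\<psi>\<^sub>b(f^(qi+s+1))\<close>, and \<open>\<phi> = (\<Sum>b. x^b frob(\<psi>\<^sub>b))\<close> reassembles \<open>f^(qi+s)\<close>.
\<close>

lemma divides_power_of_cartier_images:
  assumes f: "f \<in> deg_le d" and s: "s < q"
    and sub: "cartier_images f P (P * d) q s \<subseteq> cartier_images f P (P * d) q (Suc s)"
  shows "\<exists>\<phi>. divides_power f P q s \<phi>"
proof -
  have q: "q > 0" using s by simp
  have "\<exists>\<psi>\<in>cartier_maps q. \<forall>i<P. \<psi> (f ^ (q * i + s + 1)) = frob_coeff q b (f ^ (q * i + s))" for b
  proof -
    have "frob_coeff q b (f ^ (q * i + s)) \<in> deg_le (P * d)" if "i < P" for i
    proof (rule frob_coeff_deg_le[OF _ q])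
      have "q * i + s \<le> q * i + q" using s by simp
      also have "\<dots> = q * Suc i" by simp
      also have "\<dots> \<le> q * P" using that by (intro mult_le_mono2) simp
      finally have "(q * i + s) * d \<le> (q * P) * d" by (rule mult_le_mono1)
      then have "(q * i + s) * d \<le> q * (P * d)" by (simp only: mult.assoc)
      then show "f ^ (q * i + s) \<in> deg_le (q * (P * d))"
        by (rule deg_le_weaken) (rule deg_le_power[OF f])
    qed
    then have "power_coefs f P q s (frob_coeff q b) \<in> cartier_images f P (P * d) q s"
      by (intro cartier_imagesI[OF frob_coeff_cartier[OF q]]) auto
    then have "power_coefs f P q s (frob_coeff q b) \<in> cartier_images f P (P * d) q (Suc s)"
      using sub by blast
    then obtain \<psi> where \<psi>: "power_coefs f P q s (frob_coeff q b) = power_coefs f P q (Suc s) \<psi>" "\<psi> \<in> cartier_maps q"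
      by (rule cartier_imagesE)
    have "\<psi> (f ^ (q * i + s + 1)) = frob_coeff q b (f ^ (q * i + s))" if "i < P" for i
    proof (rule coef_inject, rule ext)
      show "coef (\<psi> (f ^ (q * i + s + 1))) m = coef (frob_coeff q b (f ^ (q * i + s))) m" for m
        using fun_cong[OF \<psi>(1), of "(i, m)"] that by (simp add: power_coefs_def)
    qed
    then show ?thesis using \<psi>(2) by blast
  qed
  then obtain \<psi> where \<psi>: "\<And>b. \<psi> b \<in> cartier_maps q"
    "\<And>b i. i < P \<Longrightarrow> \<psi> b (f ^ (q * i + s + 1)) = frob_coeff q b (f ^ (q * i + s))" by metis
  define \<phi> where "\<phi> r = (\<Sum>b\<in>residue_exps q. mon b * frob q (\<psi> b r))" for r
  have lin: "V_linear \<eta> (\<psi> b)" for b using \<psi>(1) by (simp add: cartier_maps_def)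
  have "V_linear \<eta> \<phi>"
    unfolding \<phi>_def by (rule V_linear_sum, rule V_linear_mult_left, rule V_linear_comp[OF V_linear_frob lin])
  moreover have "\<phi> (frob q h * r) = frob q h * \<phi> r" for h r
  proof -
    have "\<psi> b (frob q h * r) = h * \<psi> b r" for b using \<psi>(1) by (simp add: cartier_maps_def)
    then show ?thesis by (simp add: \<phi>_def frob_mult sum_distrib_left mult.left_commute)
  qed
  moreover have "\<phi> (f ^ (q * i + s + 1)) = f ^ (q * i + s)" if "i < P" for i
    unfolding \<phi>_def \<psi>(2)[OF that] by (rule frob_coeff_decomposition[OF q])
  ultimately show ?thesis unfolding divides_power_def by blast
qed

lemma card_not_divides_power_bounded:
  assumes loc: "local_ring_with (cls_ring :: 'v ring) \<mm>" and art: "artinian_ring (cls_ring :: 'v ring)"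
  shows "\<exists>B. \<forall>q. card {s. s < q \<and> \<not> (\<exists>\<phi>. divides_power f P q s \<phi>)} \<le> B"
proof -
  obtain d where d: "f \<in> deg_le d" using exists_deg_le by blast
  let ?D = "P * d"
  let ?I = "{..<P} \<times> {m \<in> exps. \<forall>i. Poly_Mapping.lookup m i \<le> ?D}"
  obtain \<rho> :: "'v set \<Rightarrow> nat" where \<rho>: "\<And>A B. is_ideal A \<Longrightarrow> is_ideal B \<Longrightarrow> A \<subset> B \<Longrightarrow> \<rho> A < \<rho> B"
    using artinian_local_ideal_rank[OF loc art] by metis
  have "finite ?I" by (simp add: finite_bounded_exps)
  from submodule_rank[OF \<rho> this] obtain rk :: "(nat \<times> (nat \<Rightarrow>\<^sub>0 nat) \<Rightarrow> 'v) set \<Rightarrow> nat" where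
    rk_all: "\<forall>A B. is_submodule A \<longrightarrow> is_submodule B \<longrightarrow> A \<subset> B \<longrightarrow>
      (\<forall>a\<in>B. \<forall>i. i \<notin> ?I \<longrightarrow> a i = 0) \<longrightarrow> rk A < rk B" ..
  have rk: "rk A < rk B" if "is_submodule A" "is_submodule B" "A \<subset> B"
    "\<forall>a\<in>B. \<forall>i. i \<notin> ?I \<longrightarrow> a i = 0" for A B
    using rk_all that by blast
  let ?T = "{a :: nat \<times> (nat \<Rightarrow>\<^sub>0 nat) \<Rightarrow> 'v. \<forall>i. i \<notin> ?I \<longrightarrow> a i = 0}"
  have T: "is_submodule ?T" by (simp add: is_submodule_def)
  have sT: "cartier_images f P ?D q s \<subseteq> ?T" for q s
  proof
    fix a assume "a \<in> cartier_images f P ?D q s"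
    then obtain \<psi> where \<psi>: "a = power_coefs f P q s \<psi>"
      "\<forall>i<P. \<psi> (f ^ (q * i + s)) \<in> deg_le ?D"
      by (rule cartier_imagesE)
    have "a (i, m) = 0" if "(i, m) \<notin> ?I" for i m
    proof (cases "i < P")
      case True
      then have "m \<notin> supp (\<psi> (f ^ (q * i + s)))"
        using that \<psi>(2) True supp_subset[of "\<psi> (f ^ (q * i + s))"] unfolding deg_le_def by blast
      then show ?thesis using True by (simp add: \<psi>(1) power_coefs_def coef_not_supp)
    qed (simp add: \<psi>(1) power_coefs_def)
    then show "a \<in> ?T" by auto
  qed
  have rk_le: "rk A \<le> rk B" if "is_submodule A" "is_submodule B" "A \<subseteq> B" "B \<subseteq> ?T" for A B
  proof (cases "A = B")
    case False
    then have "A \<subset> B" using that(3) by blast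
    moreover have "\<forall>a\<in>B. \<forall>i. i \<notin> ?I \<longrightarrow> a i = 0" using that(4) by blast
    ultimately show ?thesis using rk[OF that(1,2)] by (simp only: less_imp_le)
  qed simp
  have "card {s. s < q \<and> \<not> (\<exists>\<phi>. divides_power f P q s \<phi>)} \<le> rk ?T" for q
  proof -
    let ?r = "\<lambda>s. rk (cartier_images f P ?D q s)"
    have "card {s. s < q \<and> \<not> (\<exists>\<phi>. divides_power f P q s \<phi>)} + ?r q \<le> ?r 0"
    proof (rule card_strict_drops)
      show "?r (Suc s) \<le> ?r s" for s
        by (rule rk_le[OF cartier_images_submodule cartier_images_submodule cartier_images_decreasing sT])
      show "?r (Suc s) < ?r s" if "s < q" "\<not> (\<exists>\<phi>. divides_power f P q s \<phi>)" for s
      proof (rule rk[OF cartier_images_submodule cartier_images_submodule])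
        show "cartier_images f P ?D q (Suc s) \<subset> cartier_images f P ?D q s"
          using divides_power_of_cartier_images[OF d that(1)] that(2) cartier_images_decreasing by blast
        show "\<forall>a\<in>cartier_images f P ?D q s. \<forall>i. i \<notin> ?I \<longrightarrow> a i = 0" using sT by blast
      qed
    qed
    moreover have "?r 0 \<le> rk ?T" by (rule rk_le[OF cartier_images_submodule T sT order_refl])
    ultimately show ?thesis by simp
  qed
  then show ?thesis by blast
qed

subsection \<open>Large powers of \<open>f\<close>\<close>

text \<open>
  The \<open>q\<close>-th power of \<open>f\<close> is congruent modulo \<open>p\<close> to the sum of the \<open>q\<close>-th powers of its terms, which lies in
  the image of \<open>frob q\<close>. Raising to the power \<open>p^M\<close> turns the congruence into an equality.
\<close>

lemma power_in_range_frob: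
  assumes p: "prime p" and nil: "(of_nat p :: 'v) ^ M = 0"
  shows "\<exists>g. f ^ (p ^ e * p ^ M) = frob (p ^ e) g"
proof -
  let ?q = "p ^ e"
  define g where "g = (\<Sum>m\<in>supp f. \<eta> (coef f m ^ ?q) * mon m)"
  interpret additive "frob ?q" by (rule V_linear_additive[OF V_linear_frob])
  have "frob ?q g = (\<Sum>m\<in>supp f. \<eta> (coef f m ^ ?q) * frob ?q (mon m))"
    unfolding g_def sum using V_linear_frob by (simp add: V_linear_iff)
  also have "\<dots> = (\<Sum>m\<in>supp f. (\<eta> (coef f m) * mon m) ^ ?q)"
    by (rule sum.cong) (use supp_subset[of f] in \<open>auto simp: frob_mono mon_times_exp eta_power power_mult_distrib\<close>)
  finally have "of_nat p dvd f ^ ?q - frob ?q g"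
    using prime_dvd_power_of_sum[OF p, of "\<lambda>m. \<eta> (coef f m) * mon m" "supp f" e] expansion[of f] by simp
  then have "of_nat p ^ Suc M dvd (f ^ ?q) ^ p ^ M - frob ?q g ^ p ^ M" by (rule prime_power_dvd_power_diff)
  moreover have "(of_nat p :: 'r) ^ M = 0" using arg_cong[OF nil, of \<eta>] by (simp add: eta_power eta_of_nat)
  ultimately have "(f ^ ?q) ^ p ^ M = frob ?q g ^ p ^ M" by simp
  then show ?thesis by (metis frob_power power_mult)
qed

end


section \<open>\<open>p\<close>-adic integers\<close>

lemma padic_range:
  assumes "\<alpha> \<in> padic_integers p"
  shows "0 \<le> \<alpha> k" "\<alpha> k < int p ^ k"
  using assms by (auto simp: padic_integers_def)

lemma padic_mod:
  assumes "\<alpha> \<in> padic_integers p" "j \<le> k"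
  shows "\<alpha> k mod int p ^ j = \<alpha> j"
  using assms(2)
proof (induction rule: dec_induct)
  case base
  then show ?case using padic_range[OF assms(1), of j] by simp
next
  case (step k)
  have "\<alpha> (Suc k) mod int p ^ j = \<alpha> (Suc k) mod int p ^ k mod int p ^ j"
    using step.hyps by (simp add: mod_mod_cancel le_imp_power_dvd)
  also have "\<alpha> (Suc k) mod int p ^ k = \<alpha> k" using assms(1) by (simp add: padic_integers_def)
  finally show ?case using step.IH by simp
qed

lemma padic_eq_below:
  assumes "\<alpha> \<in> padic_integers p" "\<beta> \<in> padic_integers p" "\<alpha> k = \<beta> k" "j \<le> k"
  shows "\<alpha> j = \<beta> j"
  using padic_mod[OF assms(1,4)] padic_mod[OF assms(2,4)] assms(3) by metis

lemma padic_of_int_mem: "p > 0 \<Longrightarrow> padic_of_int p z \<in> padic_integers p"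
  by (simp add: padic_of_int_def padic_integers_def mod_mod_cancel le_imp_power_dvd)

lemma topspace_padic: "topspace (padic_topology p) = padic_integers p"
  by (auto simp: padic_topology_def padic_integers_def)

lemma continuous_map_padic_residue:
  "continuous_map (padic_topology p) (discrete_topology UNIV) (\<lambda>\<alpha>. g (\<alpha> k))"
proof -
  have "continuous_map (product_topology (\<lambda>k. discrete_topology {0..<int p ^ k}) UNIV)
      (discrete_topology {0..<int p ^ k}) (\<lambda>\<alpha>. \<alpha> k)"
    by (rule continuous_map_product_projection) simp
  moreover have "continuous_map (discrete_topology {0..<int p ^ k}) (discrete_topology UNIV) g"
    by simp
  ultimately have "continuous_map (product_topology (\<lambda>k. discrete_topology {0..<int p ^ k}) UNIV)
      (discrete_topology UNIV) (g \<circ> (\<lambda>\<alpha>. \<alpha> k))"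
    by (rule continuous_map_compose)
  then show ?thesis
    unfolding padic_topology_def comp_def by (rule continuous_map_from_subtopology)
qed

lemma padic_locally_constant:
  assumes cont: "continuous_map (padic_topology p) (discrete_topology UNIV) u"
    and \<alpha>: "\<alpha> \<in> padic_integers p"
  shows "\<exists>k. \<forall>\<beta>\<in>padic_integers p. \<beta> k = \<alpha> k \<longrightarrow> u \<beta> = u \<alpha>"
proof -
  let ?T = "product_topology (\<lambda>k. discrete_topology {0..<int p ^ k}) UNIV"
  have "openin (padic_topology p) {\<beta> \<in> padic_integers p. u \<beta> = u \<alpha>}"
    using openin_continuous_map_preimage[OF cont, of "{u \<alpha>}"] by (simp add: topspace_padic)
  then obtain U where U: "openin ?T U" "{\<beta> \<in> padic_integers p. u \<beta> = u \<alpha>} = U \<inter> padic_integers p"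
    unfolding padic_topology_def openin_subtopology by blast
  then have "\<alpha> \<in> U" using \<alpha> by blast
  then obtain V where V: "finite {i. V i \<noteq> {0..<int p ^ i}}" "\<alpha> \<in> Pi\<^sub>E UNIV V" "Pi\<^sub>E UNIV V \<subseteq> U"
    using U(1) unfolding openin_product_topology_alt by auto
  obtain k where k: "\<And>i. V i \<noteq> {0..<int p ^ i} \<Longrightarrow> i \<le> k"
    using V(1) by (metis (mono_tags, lifting) finite_nat_set_iff_bounded_le mem_Collect_eq)
  have "u \<beta> = u \<alpha>" if \<beta>: "\<beta> \<in> padic_integers p" "\<beta> k = \<alpha> k" for \<beta>
  proof -
    have "\<beta> i \<in> V i" for i
    proof (cases "V i = {0..<int p ^ i}")
      case True
      then show ?thesis using padic_range[OF \<beta>(1), of i] by simp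
    next
      case False
      then have "\<beta> i = \<alpha> i" using padic_eq_below[OF \<beta>(1) \<alpha> \<beta>(2)] k by blast
      then show ?thesis using V(2) by auto
    qed
    then have "\<beta> \<in> U" using V(3) by auto
    then show ?thesis using U(2) \<beta>(1) by blast
  qed
  then show ?thesis by blast
qed

text \<open>
  Compactness of \<open>\<int>\<^sub>p\<close> by bisection: if \<open>u\<close> depended on arbitrarily high residues, the same would hold on some
  residue class modulo each \<open>p^k\<close>, compatibly in \<open>k\<close>, so \<open>u\<close> would not be continuous at the limit of these classes.
\<close>

lemma padic_uniformly_locally_constant:
  assumes cont: "continuous_map (padic_topology p) (discrete_topology UNIV) u"
  shows "\<exists>N. \<forall>\<alpha>\<in>padic_integers p. \<forall>\<beta>\<in>padic_integers p. \<alpha> N = \<beta> N \<longrightarrow> u \<alpha> = u \<beta>"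
proof (rule ccontr)
  define good where "good k r N \<longleftrightarrow> (\<forall>\<alpha>\<in>padic_integers p. \<forall>\<beta>\<in>padic_integers p.
    \<alpha> k = r \<longrightarrow> \<beta> k = r \<longrightarrow> \<alpha> N = \<beta> N \<longrightarrow> u \<alpha> = u \<beta>)" for k r N
  assume contr: "\<not> ?thesis"
  have step: "\<exists>r'. (r' \<in> {0..<int p ^ Suc k} \<and> (\<forall>N. \<not> good (Suc k) r' N)) \<and> r' mod int p ^ k = r"
    if bad: "r \<in> {0..<int p ^ k} \<and> (\<forall>N. \<not> good k r N)" for r k
  proof (rule ccontr)
    let ?S = "{r' \<in> {0..<int p ^ Suc k}. r' mod int p ^ k = r}"
    assume "\<not> ?thesis"
    then have "\<forall>r'\<in>?S. \<exists>N. good (Suc k) r' N" by blast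
    then obtain N where N: "\<And>r'. r' \<in> ?S \<Longrightarrow> good (Suc k) r' (N r')" by metis
    \<comment> \<open>a common bound for the finitely many subclasses makes the class itself good\<close>
    define K where "K = Suc k + (\<Sum>r'\<in>?S. N r')"
    have K: "N r' \<le> K" if "r' \<in> ?S" for r'
    proof -
      have "finite ?S" by (rule finite_subset[of _ "{0..<int p ^ Suc k}"]) auto
      then have "N r' \<le> (\<Sum>r'\<in>?S. N r')" by (intro member_le_sum[OF that]) simp_all
      then show ?thesis by (simp add: K_def)
    qed
    have "good k r K"
      unfolding good_def
    proof (intro ballI impI)
      fix \<alpha> \<beta> assume \<alpha>: "\<alpha> \<in> padic_integers p" and \<beta>: "\<beta> \<in> padic_integers p"
        and eq: "\<alpha> k = r" "\<beta> k = r" "\<alpha> K = \<beta> K"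
      have S: "\<alpha> (Suc k) \<in> ?S"
        using padic_range[OF \<alpha>, of "Suc k"] padic_mod[OF \<alpha>, of k "Suc k"] eq(1) by auto
      have "\<beta> (Suc k) = \<alpha> (Suc k)" by (rule padic_eq_below[OF \<beta> \<alpha> eq(3)[symmetric]]) (simp add: K_def)
      moreover have "\<alpha> (N (\<alpha> (Suc k))) = \<beta> (N (\<alpha> (Suc k)))" by (rule padic_eq_below[OF \<alpha> \<beta> eq(3) K[OF S]])
      ultimately show "u \<alpha> = u \<beta>" using N[OF S] \<alpha> \<beta> unfolding good_def by blast
    qed
    with bad show False by blast
  qed
  have start: "(0 :: int) \<in> {0..<int p ^ 0} \<and> (\<forall>N. \<not> good 0 0 N)"
  proof -
    have "\<alpha> 0 = 0" if "\<alpha> \<in> padic_integers p" for \<alpha>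
      using padic_range[OF that, of 0] by simp
    then show ?thesis using contr unfolding good_def by force
  qed
  obtain \<alpha> where \<alpha>: "\<And>k. \<alpha> k \<in> {0..<int p ^ k} \<and> (\<forall>N. \<not> good k (\<alpha> k) N)" "\<And>k. \<alpha> (Suc k) mod int p ^ k = \<alpha> k"
    using dependent_nat_choice[of "\<lambda>k r. r \<in> {0..<int p ^ k} \<and> (\<forall>N. \<not> good k r N)" "\<lambda>k r r'. r' mod int p ^ k = r"]
      start step by blast
  then have "\<alpha> \<in> padic_integers p" by (simp add: padic_integers_def)
  then obtain k where "\<forall>\<beta>\<in>padic_integers p. \<beta> k = \<alpha> k \<longrightarrow> u \<beta> = u \<alpha>"
    using padic_locally_constant[OF cont] by blast
  then have "good k (\<alpha> k) k" unfolding good_def by metis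
  with \<alpha>(1)[of k] show False by blast
qed

lemma neg_mod_complement:
  assumes "q > 0"
  shows "(- 1 - int a) mod int q = int (q - 1 - a mod q)"
proof -
  have lt: "a mod q < q" using assms by simp
  have "int a = int q * int (a div q) + int (a mod q)" by (metis mult_div_mod_eq of_nat_add of_nat_mult)
  then have "- 1 - int a = int (q - 1 - a mod q) + int q * (- int (a div q) - 1)"
    using lt by (simp add: of_nat_diff algebra_simps)
  then have "(- 1 - int a) mod int q = int (q - 1 - a mod q) mod int q" by (simp only: mod_mult_self2)
  also have "\<dots> = int (q - 1 - a mod q)" using assms by (simp flip: of_nat_mod)
  finally show ?thesis .
qed

section \<open>Trivial localizations\<close>

lemma localized_module_trivial:
  assumes "u \<in> W" "\<one>\<^bsub>C\<^esub> \<in> W" "\<zero>\<^bsub>N\<^esub> \<in> carrier N"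
    and closed: "\<And>t y. t \<in> W \<Longrightarrow> y \<in> carrier N \<Longrightarrow> t \<odot>\<^bsub>N\<^esub> y \<in> carrier N"
    and kill: "\<And>y. y \<in> carrier N \<Longrightarrow> u \<odot>\<^bsub>N\<^esub> y = \<zero>\<^bsub>N\<^esub>"
  shows "carrier (localized_module C W N) = {\<zero>\<^bsub>localized_module C W N\<^esub>}"
proof -
  have rel: "frac_rel C W N = (carrier N \<times> W) \<times> (carrier N \<times> W)"
  proof -
    have "\<exists>v\<in>W. v \<odot>\<^bsub>N\<^esub> (t \<odot>\<^bsub>N\<^esub> y) = v \<odot>\<^bsub>N\<^esub> (s \<odot>\<^bsub>N\<^esub> z)"
      if "y \<in> carrier N" "z \<in> carrier N" "s \<in> W" "t \<in> W" for y z s t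
      using assms(1) kill closed that by (intro bexI[of _ u]) simp_all
    then show ?thesis unfolding frac_rel_def by blast
  qed
  have "(carrier N \<times> W) // frac_rel C W N = {carrier N \<times> W}"
    unfolding rel quotient_def using assms(2,3) by fast
  moreover have "frac C W N \<zero>\<^bsub>N\<^esub> \<one>\<^bsub>C\<^esub> = carrier N \<times> W"
    unfolding frac_def rel using assms(2,3) by blast
  ultimately show ?thesis by (simp add: localized_module_def)
qed

section \<open>Operators of degree zero\<close>

text \<open>
  Degree-zero operators act on the coefficient of each \<open>t^a\<close> separately.
\<close>

definition coeffwise :: "(nat \<Rightarrow> 'r::comm_ring_1 \<Rightarrow> 'r) \<Rightarrow> 'r poly \<Rightarrow> 'r poly" where
  "coeffwise \<phi> g = (\<Sum>a\<le>Polynomial.degree g. Polynomial.monom (\<phi> a (poly.coeff g a)) a)"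

lemma coeff_coeffwise:
  assumes "\<And>a. \<phi> a 0 = 0"
  shows "poly.coeff (coeffwise \<phi> g) a = \<phi> a (poly.coeff g a)"
proof -
  have "poly.coeff (coeffwise \<phi> g) a = (\<Sum>b\<le>Polynomial.degree g. if b = a then \<phi> b (poly.coeff g b) else 0)"
    by (simp add: coeffwise_def coeff_sum coeff_monom)
  also have "\<dots> = \<phi> a (poly.coeff g a)"
    using assms by (simp add: coeff_eq_0)
  finally show ?thesis .
qed

lemma tilde_op_eq_coeffwise:
  "tilde_op \<eta> p u = coeffwise (\<lambda>a r. \<eta> (u (padic_of_int p (- 1 - int a))) * r)"
  by (simp add: tilde_op_def coeffwise_def fun_eq_iff)

lemma coeff_const_mult: "poly.coeff ([:r:] * g) a = r * poly.coeff g a"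
  by simp

lemma coeff_var_power_mult: "poly.coeff ([:0, 1:] ^ Q * g) a = (if a < Q then 0 else poly.coeff g (a - Q))"
proof -
  have "[:0, 1:] ^ Q = Polynomial.monom (1 :: 'a) Q" by (simp add: monom_altdef)
  then show ?thesis by (simp add: coeff_monom_mult)
qed

lemma const_power: "[:r:] ^ Q = [:r ^ Q:]" for r :: "'a::comm_ring_1"
  by (simp add: poly_const_pow)

lemma nonzerodivisor_mult: "nonzerodivisor v \<Longrightarrow> nonzerodivisor w \<Longrightarrow> nonzerodivisor (v * w)"
  unfolding nonzerodivisor_def by (metis mult.assoc)

lemma nonzerodivisor_power: "nonzerodivisor v \<Longrightarrow> nonzerodivisor (v ^ k)"
proof (induction k)
  case 0
  show ?case by (simp add: nonzerodivisor_def)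
next
  case (Suc k)
  then show ?case unfolding power_Suc by (intro nonzerodivisor_mult)
qed

lemma nonzerodivisor_cancel: "nonzerodivisor v \<Longrightarrow> v * a = v * b \<Longrightarrow> a = b"
  unfolding nonzerodivisor_def by (metis eq_iff_diff_eq_0 right_diff_distrib)

lemma nonzerodivisor_const: "nonzerodivisor r \<Longrightarrow> nonzerodivisor [:r:]"
  unfolding nonzerodivisor_def by (metis coeff_0 coeff_const_mult poly_eqI)

text \<open>
  As a polynomial in \<open>t\<close>, this element has leading coefficient \<open>-1\<close>.
\<close>

lemma nonzerodivisor_power_diff:
  assumes "Q > 0"
  shows "nonzerodivisor ([:r:] ^ Q - [:0, 1:] ^ Q)"
  unfolding nonzerodivisor_def
proof (intro allI impI)
  fix g assume 0: "([:r:] ^ Q - [:0, 1:] ^ Q) * g = 0"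
  have "0 = poly.coeff (([:r:] ^ Q - [:0, 1:] ^ Q) * g) (Polynomial.degree g + Q)" using 0 by simp
  also have "\<dots> = r ^ Q * poly.coeff g (Polynomial.degree g + Q) - poly.coeff g (Polynomial.degree g)"
    unfolding left_diff_distrib coeff_diff const_power coeff_const_mult coeff_var_power_mult by simp
  also have "\<dots> = - poly.coeff g (Polynomial.degree g)" using assms by (simp add: coeff_eq_0)
  finally show "g = 0" by simp
qed

lemma power_diff_factor:
  fixes f :: "'a::comm_ring_1"
  shows "[:f:] ^ Q - [:0, 1:] ^ Q = f_minus_t f * (\<Sum>a<Q. Polynomial.monom (f ^ (Q - Suc a)) a)"
proof -
  have "[:0, 1:] ^ Q - [:f:] ^ Q = ([:0, 1:] - [:f:]) * (\<Sum>a<Q. [:f:] ^ (Q - Suc a) * [:0, 1:] ^ a)"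
    by (rule power_diff_sumr2)
  also have "(\<Sum>a<Q. [:f:] ^ (Q - Suc a) * [:0, 1:] ^ a) = (\<Sum>a<Q. Polynomial.monom (f ^ (Q - Suc a)) a)"
    by (simp add: const_power monom_altdef)
  finally have eq: "[:0, 1:] ^ Q - [:f:] ^ Q = ([:0, 1:] - [:f:]) * (\<Sum>a<Q. Polynomial.monom (f ^ (Q - Suc a)) a)" .
  have "b - a = (d - c) * s" if "a - b = (c - d) * s" for a b c d s :: "'a poly"
    using arg_cong[OF that, of uminus] by (simp add: left_diff_distrib)
  from this[OF eq] show ?thesis unfolding f_minus_t_def .
qed

lemma poly_const_sum: "[:\<Sum>a\<in>A. g a:] = (\<Sum>a\<in>A. [:g a:])"
proof (induction A rule: infinite_finite_induct)
  case (insert a A)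
  have "[:g a + sum g A:] = [:g a:] + [:sum g A:]" by simp
  with insert show ?case by (simp only: sum.insert[OF insert.hyps])
qed simp_all

lemma poly_const_prod: "[:\<Prod>a\<in>A. g a:] = (\<Prod>a\<in>A. [:g a:])"
proof (induction A rule: infinite_finite_induct)
  case (insert a A)
  have "[:g a * prod g A:] = [:g a:] * [:prod g A:]" by (simp add: mult.commute)
  with insert show ?case by (simp only: prod.insert[OF insert.hyps])
qed (simp_all add: one_pCons)

context polynomial_ring
begin

abbreviation "\<kappa> \<equiv> poly_structure_map \<eta>"
abbreviation "D0 \<equiv> diff_ops_degree \<eta> 0"

lemma kappa [simp]: "\<kappa> c * g = Polynomial.smult (\<eta> c) g"
  by (simp add: poly_structure_map_def)

lemma kappa_module: "Modules.module (\<lambda>c g. \<kappa> c * g)"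
  by unfold_locales (simp_all add: smult_add_right smult_add_left, simp add: mult.commute)

lemma V_linear_kappa_iff:
  "V_linear \<kappa> \<phi> \<longleftrightarrow> (\<forall>a b. \<phi> (a + b) = \<phi> a + \<phi> b) \<and> (\<forall>c a. \<phi> (Polynomial.smult (\<eta> c) a) = Polynomial.smult (\<eta> c) (\<phi> a))"
  using kappa_module by (simp add: V_linear_iff)

lemma mon_single: "i < n \<Longrightarrow> mon (Poly_Mapping.single i 1) = x i"
proof -
  assume "i < n"
  have "mon (Poly_Mapping.single i 1) = (\<Prod>j<n. if j = i then x j else 1)"
    unfolding mon_def by (rule prod.cong) (auto simp: lookup_single when_def)
  then show ?thesis using \<open>i < n\<close> by simp
qed

lemma frob_variable: "i < n \<Longrightarrow> frob q (x i) = x i ^ q"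
proof -
  assume i: "i < n"
  have "Poly_Mapping.single i 1 \<in> exps" using i by (auto simp: exps_iff lookup_single when_def)
  then show ?thesis using frob_mono[of "Poly_Mapping.single i 1" q] mon_single[OF i] by (simp only: mon_times_exp)
qed

lemma poly_generators:
  assumes \<kappa>: "range \<kappa> \<subseteq> A" and E: "insert [:0, 1:] ((\<lambda>i. [:x i:]) ` {..<n}) \<subseteq> A"
    and add: "\<And>a b. a \<in> A \<Longrightarrow> b \<in> A \<Longrightarrow> a + b \<in> A"
    and mult: "\<And>a b. a \<in> A \<Longrightarrow> b \<in> A \<Longrightarrow> a * b \<in> A"
  shows "A = UNIV"
proof -
  have eta_mem: "[:\<eta> c:] \<in> A" for c using \<kappa> by (auto simp: poly_structure_map_def)
  have zero: "0 \<in> A" using eta_mem[of 0] by simp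
  have one: "1 \<in> A" using eta_mem[of 1] by (simp add: one_pCons)
  have sum: "(\<Sum>b\<in>B. g b) \<in> A" if "\<And>b. b \<in> B \<Longrightarrow> g b \<in> A" for B and g :: "'b \<Rightarrow> 'r poly"
    using that by (induction B rule: infinite_finite_induct) (auto intro: zero add)
  have prod: "(\<Prod>b\<in>B. g b) \<in> A" if "\<And>b. b \<in> B \<Longrightarrow> g b \<in> A" for B and g :: "'b \<Rightarrow> 'r poly"
    using that by (induction B rule: infinite_finite_induct) (auto intro: one mult)
  have power: "g ^ k \<in> A" if "g \<in> A" for g k
    using that by (induction k) (auto intro: one mult)
  have const: "[:r:] \<in> A" for r
  proof -
    have "[:mon m:] \<in> A" for m
      unfolding mon_def poly_const_prod const_power[symmetric] using E by (intro prod power) auto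
    then have "(\<Sum>m\<in>supp r. [:\<eta> (coef r m):] * [:mon m:]) \<in> A"
      by (intro sum mult eta_mem)
    also have "(\<Sum>m\<in>supp r. [:\<eta> (coef r m):] * [:mon m:]) = [:r:]"
      using arg_cong[OF expansion[of r], of "\<lambda>r. [:r:]"] by (simp add: poly_const_sum mult.commute)
    finally show ?thesis .
  qed
  have "g \<in> A" for g
  proof (induction g)
    case (pCons a g)
    have "pCons a g = [:a:] + [:0, 1:] * g" by simp
    then show ?case using const E pCons.IH by (metis add mult insert_subset)
  qed (rule zero)
  then show ?thesis by blast
qed

lemma D0_I:
  assumes "\<phi> \<in> diff_ops \<kappa>" "\<And>g a. poly.coeff (\<phi> g) a \<noteq> 0 \<Longrightarrow> poly.coeff g a \<noteq> 0"
  shows "\<phi> \<in> D0"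
  using assms by (auto simp: diff_ops_degree_def poly_graded_part_def)

lemma of_nat_poly_nilpotent:
  assumes "(of_nat p :: 'v) ^ M = 0"
  shows "(of_nat p :: 'r poly) ^ M = 0"
proof -
  have "(of_nat p :: 'r) ^ M = 0" using arg_cong[OF assms, of \<eta>] by (simp add: eta_power eta_of_nat)
  then show ?thesis by (simp add: of_nat_poly const_power)
qed

text \<open>
  The variables of \<open>S = R[t]\<close> are the \<open>x\<^sub>i\<close> and \<open>t\<close>; commuting with \<open>t^(p^N)\<close> means periodicity of the family \<open>\<phi>\<close>.
\<close>

lemma coeffwise_in_D0:
  assumes p: "prime p" "(of_nat p :: 'v) ^ M = 0"
    and lin: "\<And>a. V_linear \<eta> (\<phi> a)"
    and comm: "\<And>a i r. i < n \<Longrightarrow> \<phi> a (x i ^ p ^ N * r) = x i ^ p ^ N * \<phi> a r"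
    and per: "\<And>a. \<phi> (a + p ^ N) = \<phi> a"
  shows "coeffwise \<phi> \<in> D0"
proof -
  have zero: "\<phi> a 0 = 0" for a using additive.zero[OF V_linear_additive[OF lin]] .
  note coeff = coeff_coeffwise[of \<phi>, OF zero]
  have V: "V_linear \<kappa> (coeffwise \<phi>)"
    unfolding V_linear_kappa_iff using lin by (auto simp: V_linear_iff poly_eq_iff coeff)
  note nil = of_nat_poly_nilpotent[OF p(2)]
  have "coeffwise \<phi> \<in> diff_ops \<kappa>"
  proof (rule diff_op_of_commutes_generators[OF p(1) nil V _ _ poly_generators])
    fix w g assume "w \<in> insert [:0, 1:] ((\<lambda>i. [:x i:]) ` {..<n})"
    then consider "w = [:0, 1:]" | i where "i < n" "w = [:x i:]" by auto
    then show "coeffwise \<phi> (w ^ p ^ N * g) = w ^ p ^ N * coeffwise \<phi> g"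
    proof cases
      case 1
      have "\<phi> a r = \<phi> (a - p ^ N) r" if "\<not> a < p ^ N" for a r
        using per[of "a - p ^ N"] that by simp
      then show ?thesis unfolding 1 by (simp add: poly_eq_iff coeff coeff_var_power_mult zero)
    next
      case 2
      then show ?thesis
        unfolding 2(2) const_power by (simp add: poly_eq_iff coeff comm)
    qed
  qed auto
  then show ?thesis by (rule D0_I) (use zero in \<open>auto simp: coeff\<close>)
qed

lemma tilde_op_in_D0:
  assumes p: "prime p" "(of_nat p :: 'v) ^ M = 0"
    and u: "u \<in> carrier (continuous_function_ring p)"
  shows "tilde_op \<eta> p u \<in> D0"
proof -
  have p0: "p > 0" using p(1) by (rule prime_gt_0_nat)
  obtain N where N: "\<And>\<alpha> \<beta>. \<alpha> \<in> padic_integers p \<Longrightarrow> \<beta> \<in> padic_integers p \<Longrightarrow> \<alpha> N = \<beta> N \<Longrightarrow> u \<alpha> = u \<beta>"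
    using padic_uniformly_locally_constant[of p u] u by (auto simp: continuous_function_ring_def)
  show ?thesis
    unfolding tilde_op_eq_coeffwise
  proof (rule coeffwise_in_D0[OF p])
    show "V_linear \<eta> ((*) (\<eta> (u (padic_of_int p (- 1 - int a)))))" for a
      by (rule V_linear_mult_left[OF V_linear_id])
    show "\<eta> (u (padic_of_int p (- 1 - int a))) * (x i ^ p ^ N * r) = x i ^ p ^ N * (\<eta> (u (padic_of_int p (- 1 - int a))) * r)" for a i r
      by (rule mult.left_commute)
    have "u (padic_of_int p (- 1 - int (a + p ^ N))) = u (padic_of_int p (- 1 - int a))" for a
    proof (rule N[OF padic_of_int_mem[OF p0] padic_of_int_mem[OF p0]])
      have "- 1 - int (a + p ^ N) = - 1 - int a - int p ^ N" by simp
      then show "padic_of_int p (- 1 - int (a + p ^ N)) N = padic_of_int p (- 1 - int a) N"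
        unfolding padic_of_int_def by (simp only: minus_mod_self2)
    qed
    then show "(*) (\<eta> (u (padic_of_int p (- 1 - int (a + p ^ N))))) = (*) (\<eta> (u (padic_of_int p (- 1 - int a))))" for a
      by simp
  qed
qed

lemma D0_diff_ops: "P \<in> D0 \<Longrightarrow> P \<in> diff_ops \<kappa>"
  by (simp add: diff_ops_degree_def)

lemma const_in_D0: "(*) [:r:] \<in> D0"
proof (rule D0_I)
  show "(*) [:r:] \<in> diff_ops \<kappa>" by (rule mult_in_diff_ops[OF kappa_module])
qed auto

lemma D0_subring: "subring D0 (diff_op_ring \<kappa>)"
proof -
  interpret ring "diff_op_ring \<kappa>" by (rule diff_op_ring_is_ring[OF kappa_module])
  have comp: "P \<circ> P' \<in> D0" if "P \<in> D0" "P' \<in> D0" for P P'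
    using that diff_ops_comp[of P \<kappa> P'] by (fastforce simp: diff_ops_degree_def)
  show ?thesis
  proof (rule subringI)
    show "D0 \<subseteq> carrier (diff_op_ring \<kappa>)" using D0_diff_ops by auto
    have "(id :: 'r poly \<Rightarrow> 'r poly) = (*) [:1:]" by (rule ext) simp
    then show "\<one>\<^bsub>diff_op_ring \<kappa>\<^esub> \<in> D0" by (metis const_in_D0 diff_op_ring_simps(3))
    fix P assume P: "P \<in> D0"
    have "\<ominus>\<^bsub>diff_op_ring \<kappa>\<^esub> P = (*) [:- 1:] \<circ> P"
      by (rule minus_equality) (use P D0_diff_ops comp[OF const_in_D0 P] in auto)
    then show "\<ominus>\<^bsub>diff_op_ring \<kappa>\<^esub> P \<in> D0" using comp[OF const_in_D0 P] by simp
    fix P' assume P': "P' \<in> D0"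
    show "P \<otimes>\<^bsub>diff_op_ring \<kappa>\<^esub> P' \<in> D0" using comp[OF P P'] by simp
    have "(\<lambda>y. P y + P' y) \<in> diff_ops \<kappa>" by (rule diff_ops_add[OF D0_diff_ops[OF P] D0_diff_ops[OF P']])
    moreover have "P y + P' y \<in> poly_graded_part e" if "y \<in> poly_graded_part e" for e y
    proof -
      have "P y \<in> poly_graded_part e" "P' y \<in> poly_graded_part e"
        using P P' that by (auto simp: diff_ops_degree_def image_subset_iff)
      then show ?thesis by (auto simp: poly_graded_part_def) (metis add.right_neutral)
    qed
    ultimately show "P \<oplus>\<^bsub>diff_op_ring \<kappa>\<^esub> P' \<in> D0" by (auto simp: diff_ops_degree_def)
  qed
qed

text \<open>
  On each graded part the operator is multiplication by an element of \<open>V\<close>.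
\<close>

lemma tilde_op_central:
  assumes P: "P \<in> D0"
  shows "tilde_op \<eta> p u \<circ> P = P \<circ> tilde_op \<eta> p u"
proof
  fix g :: "'r poly"
  let ?c = "\<lambda>a. u (padic_of_int p (- 1 - int a))" and ?T = "tilde_op \<eta> p u"
  have T: "poly.coeff (?T h) a = \<eta> (?c a) * poly.coeff h a" for h a
    unfolding tilde_op_eq_coeffwise by (simp add: coeff_coeffwise)
  have lin: "V_linear \<kappa> P" using P by (simp add: diff_ops_degree_def diff_ops_iff)
  interpret P: additive P using lin by (rule V_linear_additive)
  let ?m = "\<lambda>a. Polynomial.monom (poly.coeff g a) a" and ?S = "{..Polynomial.degree g}"
  have g: "g = (\<Sum>a\<in>?S. ?m a)" by (simp add: poly_as_sum_of_monoms)
  have graded: "P (?m a) \<in> poly_graded_part (int a)" for a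
  proof -
    have "?m a \<in> poly_graded_part (int a)" by (auto simp: poly_graded_part_def coeff_monom)
    then show ?thesis using P by (auto simp: diff_ops_degree_def image_subset_iff)
  qed
  have eigen: "?T h = Polynomial.smult (\<eta> (?c a)) h" if "h \<in> poly_graded_part (int a)" for h a
  proof (rule poly_eqI)
    fix b
    show "poly.coeff (?T h) b = poly.coeff (Polynomial.smult (\<eta> (?c a)) h) b"
    proof (cases "b = a")
      case False
      then have "poly.coeff h b = 0" using that unfolding poly_graded_part_def by fastforce
      then show ?thesis by (simp add: T)
    qed (simp add: T)
  qed
  have T_sum: "?T (\<Sum>a\<in>?S. h a) = (\<Sum>a\<in>?S. ?T (h a))" for h
    by (simp add: poly_eq_iff T coeff_sum sum_distrib_left)
  have "?T (P g) = ?T (\<Sum>a\<in>?S. P (?m a))" using g P.sum[of ?m ?S] by simp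
  also have "\<dots> = (\<Sum>a\<in>?S. Polynomial.smult (\<eta> (?c a)) (P (?m a)))"
    unfolding T_sum by (intro sum.cong refl eigen graded)
  also have "\<dots> = (\<Sum>a\<in>?S. P (Polynomial.smult (\<eta> (?c a)) (?m a)))"
    using lin by (simp add: V_linear_kappa_iff)
  also have "\<dots> = P (\<Sum>a\<in>?S. Polynomial.smult (\<eta> (?c a)) (?m a))" by (rule P.sum[symmetric])
  also have "(\<Sum>a\<in>?S. Polynomial.smult (\<eta> (?c a)) (?m a)) = (\<Sum>a\<in>?S. ?T (?m a))"
    by (intro sum.cong refl eigen[symmetric]) (auto simp: poly_graded_part_def coeff_monom)
  also have "\<dots> = ?T g" using T_sum[of ?m] g by simp
  finally show "(?T \<circ> P) g = (P \<circ> ?T) g" by simp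
qed

end


section \<open>Bernstein-Sato roots\<close>

lemma f_minus_t_eq: "f_minus_t f = [:f:] ^ 1 - [:0, 1:] ^ 1"
  by (simp add: f_minus_t_def)

lemma regular_bs_denominators:
  fixes f :: "'r::comm_ring_1"
  assumes "nonzerodivisor f"
  shows "regular_denominators (bs_denominators f)"
proof
  have "([:f:] ^ 0 * f_minus_t f ^ 0 :: 'r poly) = 1" by simp
  then show "1 \<in> bs_denominators f" unfolding bs_denominators_def by (metis (mono_tags, lifting) mem_Collect_eq)
  fix u assume "u \<in> bs_denominators f"
  then obtain i j where u: "u = [:f:] ^ i * f_minus_t f ^ j" by (auto simp: bs_denominators_def)
  show "u * v \<in> bs_denominators f" if v: "v \<in> bs_denominators f" for v
  proof -
    obtain i' j' where "v = [:f:] ^ i' * f_minus_t f ^ j'" using v by (auto simp: bs_denominators_def)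
    then have "u * v = [:f:] ^ (i + i') * f_minus_t f ^ (j + j')"
      by (simp only: u power_add mult_ac)
    then show ?thesis unfolding bs_denominators_def by blast
  qed
  have "nonzerodivisor (f_minus_t f)" unfolding f_minus_t_eq by (rule nonzerodivisor_power_diff) simp
  then have "nonzerodivisor u"
    unfolding u by (intro nonzerodivisor_mult nonzerodivisor_power nonzerodivisor_const assms)
  then show "a = b" if "u * a = u * b" for a b using that by (rule nonzerodivisor_cancel)
qed

lemma bs_denominators_mem: "[:f:] ^ i \<in> bs_denominators f" "f_minus_t f \<in> bs_denominators f"
proof -
  have "[:f:] ^ i = [:f:] ^ i * f_minus_t f ^ 0" "f_minus_t f = [:f:] ^ 0 * f_minus_t f ^ 1" by simp_all
  then show "[:f:] ^ i \<in> bs_denominators f" "f_minus_t f \<in> bs_denominators f"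
    unfolding bs_denominators_def by blast+
qed

context polynomial_ring
begin

lemma bs_f_fractions_submodule:
  assumes f: "nonzerodivisor f" and p: "prime p" "(of_nat p :: 'v) ^ M = 0"
  defines "L \<equiv> D_localization \<kappa> (bs_denominators f)"
  shows "additive_subgroup (bs_f_fractions f) L"
    and "P \<in> diff_ops \<kappa> \<Longrightarrow> A \<in> bs_f_fractions f \<Longrightarrow> P \<odot>\<^bsub>L\<^esub> A \<in> bs_f_fractions f"
proof -
  let ?W = "bs_denominators f" and ?N = "bs_f_fractions f"
  interpret W: regular_denominators ?W by (rule regular_bs_denominators[OF f])
  note nil = of_nat_poly_nilpotent[OF p(2)]
  have L: "L = with_smult (W.D_act \<kappa>) (ring_localization ?W)"
    unfolding L_def by (rule W.D_localization_eq[OF nil prime_gt_0_nat[OF p(1)] kappa_module])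
  interpret L: left_module "diff_op_ring \<kappa>" L
    unfolding L by (rule W.left_module_D_act[OF nil prime_gt_0_nat[OF p(1)] kappa_module])
  note mem = bs_denominators_mem(1)[of f]
  have frN: "W.fr a ([:f:] ^ i) \<in> ?N" for a i by (auto simp: bs_f_fractions_def)
  have N_sub: "?N \<subseteq> carrier L" using mem by (auto simp: L bs_f_fractions_def)
  show "additive_subgroup ?N L"
  proof (rule additive_subgroupI, rule L.M.add.subgroupI)
    show "?N \<subseteq> carrier L" by (rule N_sub)
    show "?N \<noteq> {}" using frN by blast
    fix A assume "A \<in> ?N"
    then obtain a i where A: "A = W.fr a ([:f:] ^ i)" by (auto simp: bs_f_fractions_def)
    have "W.fr (- a) ([:f:] ^ i) \<oplus>\<^bsub>L\<^esub> A = \<zero>\<^bsub>L\<^esub>"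
      using mem[of i] by (simp add: L A W.add_L_same W.zero_L W.fr_eq_iff W.one_mem)
    then have "\<ominus>\<^bsub>L\<^esub> A = W.fr (- a) ([:f:] ^ i)"
      by (rule L.M.minus_equality) (use mem[of i] in \<open>simp_all add: L A\<close>)
    then show "\<ominus>\<^bsub>L\<^esub> A \<in> ?N" by (simp add: frN)
    fix B assume "B \<in> ?N"
    then obtain b j where B: "B = W.fr b ([:f:] ^ j)" by (auto simp: bs_f_fractions_def)
    have "A \<oplus>\<^bsub>L\<^esub> B = W.fr ([:f:] ^ j * a + [:f:] ^ i * b) ([:f:] ^ (i + j))"
      unfolding L with_smult_simps A B power_add by (rule W.add_L[OF mem mem])
    then show "A \<oplus>\<^bsub>L\<^esub> B \<in> ?N" by (simp only: frN)
  qed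
  assume P: "P \<in> diff_ops \<kappa>" and "A \<in> ?N"
  then obtain a i where A: "A = W.fr a ([:f:] ^ i)" by (auto simp: bs_f_fractions_def)
  obtain K where K: "\<And>w y. P (w ^ p ^ K * y) = w ^ p ^ K * P y"
    using diff_op_commutes_prime_powers[OF P nil] by blast
  let ?u = "([:f:] ^ i) ^ p ^ K" and ?v = "([:f:] ^ i) ^ (p ^ K - 1)"
  have uv: "?v * [:f:] ^ i = ?u"
    using prime_gt_0_nat[OF p(1)] by (metis power_minus_mult zero_less_power)
  have "A = W.fr (?v * a) (?v * [:f:] ^ i)"
    unfolding A by (rule W.fr_expand[symmetric, OF mem W.power_mem[OF mem]])
  then have "P \<odot>\<^bsub>L\<^esub> A = W.D_act \<kappa> P (W.fr (?v * a) ?u)" by (simp only: L with_smult_simps uv)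
  also have "\<dots> = W.fr (P (?v * a)) ?u" by (rule W.D_act_fr[OF P W.power_mem[OF mem] K])
  also have "\<dots> = W.fr (P (?v * a)) ([:f:] ^ (i * p ^ K))" by (simp only: power_mult)
  finally show "P \<odot>\<^bsub>L\<^esub> A \<in> ?N" by (simp only: frN)
qed

text \<open>
  Both sides may be compared after multiplication by \<open>w\<close>, which commutes with the operators and turns
  \<open>1/(f - t)\<close> into the polynomial \<open>G\<close>.
\<close>

lemma D_act_eq_of_cleared:
  assumes f: "nonzerodivisor f" and p: "prime p" "(of_nat p :: 'v) ^ M = 0"
    and P: "P \<in> diff_ops \<kappa>" and P': "P' \<in> diff_ops \<kappa>" and Q: "Q > 0"
  defines "w \<equiv> [:f:] ^ Q - [:0, 1:] ^ Q" and "G \<equiv> \<Sum>a<Q. Polynomial.monom (f ^ (Q - Suc a)) a"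
    and "L \<equiv> D_localization \<kappa> (bs_denominators f)"
  assumes comm: "\<And>y. P (w * y) = w * P y" "\<And>y. P' (w * y) = w * P' y"
    and eq: "P G = P' ([:f:] * G)"
  shows "P \<odot>\<^bsub>L\<^esub> ring_frac (bs_denominators f) 1 (f_minus_t f)
    = P' \<odot>\<^bsub>L\<^esub> ((*) [:f:] \<odot>\<^bsub>L\<^esub> ring_frac (bs_denominators f) 1 (f_minus_t f))"
proof -
  let ?W = "bs_denominators f" and ?d = "f_minus_t f"
  interpret W: regular_denominators ?W by (rule regular_bs_denominators[OF f])
  note nil = of_nat_poly_nilpotent[OF p(2)]
  have L: "L = with_smult (W.D_act \<kappa>) (ring_localization ?W)"
    unfolding L_def by (rule W.D_localization_eq[OF nil prime_gt_0_nat[OF p(1)] kappa_module])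
  interpret L: left_module "diff_op_ring \<kappa>" L
    unfolding L by (rule W.left_module_D_act[OF nil prime_gt_0_nat[OF p(1)] kappa_module])
  have d: "?d \<in> ?W" by (rule bs_denominators_mem)
  have mul: "(*) h \<in> diff_ops \<kappa>" for h by (rule mult_in_diff_ops[OF kappa_module])
  have mul_act: "(*) h \<odot>\<^bsub>L\<^esub> W.fr a u = W.fr (h * a) u" if "u \<in> ?W" for h a u
    unfolding L with_smult_simps by (rule W.D_act_fr[OF mul that]) (rule mult.left_commute)
  \<comment> \<open>clearing the denominator: \<open>w h / (f - t) = G h\<close>\<close>
  have clear: "R \<odot>\<^bsub>L\<^esub> W.fr h ?d \<in> carrier L \<and> (*) w \<odot>\<^bsub>L\<^esub> (R \<odot>\<^bsub>L\<^esub> W.fr h ?d) = W.fr (R (h * G)) 1"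
    if R: "R \<in> diff_ops \<kappa>" and c: "\<And>y. R (w * y) = w * R y" for R h
  proof
    have A: "W.fr h ?d \<in> carrier L" using d by (simp add: L)
    show "R \<odot>\<^bsub>L\<^esub> W.fr h ?d \<in> carrier L" using L.smult_closed[of R] R A by simp
    have "(*) w \<odot>\<^bsub>L\<^esub> (R \<odot>\<^bsub>L\<^esub> W.fr h ?d) = ((*) w \<circ> R) \<odot>\<^bsub>L\<^esub> W.fr h ?d"
      using L.smult_assoc[of "(*) w" R "W.fr h ?d"] R A mul by simp
    also have "(*) w \<circ> R = R \<circ> (*) w" using c by auto
    also have "(R \<circ> (*) w) \<odot>\<^bsub>L\<^esub> W.fr h ?d = R \<odot>\<^bsub>L\<^esub> ((*) w \<odot>\<^bsub>L\<^esub> W.fr h ?d)"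
      using L.smult_assoc[of R "(*) w" "W.fr h ?d"] R A mul by simp
    also have "(*) w \<odot>\<^bsub>L\<^esub> W.fr h ?d = W.fr (w * h) ?d" by (rule mul_act[OF d])
    also have "\<dots> = W.fr (h * G) 1"
      unfolding W.fr_eq_iff[OF d W.one_mem] w_def G_def power_diff_factor by (simp only: mult_ac mult_1)
    also have "R \<odot>\<^bsub>L\<^esub> W.fr (h * G) 1 = W.fr (R (h * G)) 1"
      unfolding L with_smult_simps by (rule W.D_act_fr[OF R W.one_mem]) simp
    finally show "(*) w \<odot>\<^bsub>L\<^esub> (R \<odot>\<^bsub>L\<^esub> W.fr h ?d) = W.fr (R (h * G)) 1" .
  qed
  have "(*) [:f:] \<odot>\<^bsub>L\<^esub> W.fr 1 ?d = W.fr [:f:] ?d" using mul_act[OF d, of "[:f:]" 1] by simp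
  moreover have "P \<odot>\<^bsub>L\<^esub> W.fr 1 ?d = P' \<odot>\<^bsub>L\<^esub> W.fr [:f:] ?d"
  proof -
    have 1: "P \<odot>\<^bsub>L\<^esub> W.fr 1 ?d \<in> carrier (ring_localization ?W)"
      "P' \<odot>\<^bsub>L\<^esub> W.fr [:f:] ?d \<in> carrier (ring_localization ?W)"
      using clear[OF P comm(1), of 1] clear[OF P' comm(2), of "[:f:]"] by (simp_all add: L)
    from 1(1) obtain b v where b: "P \<odot>\<^bsub>L\<^esub> W.fr 1 ?d = W.fr b v" "v \<in> ?W"
      unfolding W.carrier_L by blast
    from 1(2) obtain b' v' where b': "P' \<odot>\<^bsub>L\<^esub> W.fr [:f:] ?d = W.fr b' v'" "v' \<in> ?W"
      unfolding W.carrier_L by blast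
    have "(*) w \<odot>\<^bsub>L\<^esub> W.fr b v = W.fr (P G) 1"
      using clear[OF P comm(1), of 1] unfolding b(1) by simp
    moreover have "(*) w \<odot>\<^bsub>L\<^esub> W.fr b' v' = W.fr (P' ([:f:] * G)) 1"
      using clear[OF P' comm(2), of "[:f:]"] unfolding b'(1) by (rule conjunct2)
    ultimately have "W.fr (w * b) v = W.fr (w * b') v'"
      using eq by (simp only: mul_act[OF b(2)] mul_act[OF b'(2)])
    then have "v' * (w * b) = v * (w * b')" by (simp only: W.fr_eq_iff[OF b(2) b'(2)])
    then have "w * (v' * b) = w * (v * b')" by (simp only: mult.left_commute)
    then have "v' * b = v * b'"
      using nonzerodivisor_cancel nonzerodivisor_power_diff[OF Q, of f] unfolding w_def by blast
    then show ?thesis unfolding b(1) b'(1) using W.fr_eq_iff[OF b(2) b'(2)] by simp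
  qed
  ultimately show ?thesis by simp
qed

text \<open>
  With \<open>s\<close> the residue of \<open>\<alpha>\<close>, the operator \<open>T\<close> of the indicator function of \<open>\<alpha> + p^e \<int>\<^sub>p\<close> is the projection to the degrees
  \<open>a \<equiv> c\<close> modulo \<open>q\<close> with \<open>c = q - 1 - s\<close>, and \<open>P\<close> applies \<open>\<phi>\<close> in these degrees. There the coefficients of
  \<open>G\<close> are the \<open>f^(qi+s)\<close>, so \<open>T G = P (f G)\<close> and hence \<open>T \<delta>\<^sub>0 = P (f \<delta>\<^sub>0)\<close>.
\<close>

lemma not_root_of_divides_power:
  assumes f: "nonzerodivisor f" and p: "prime p" "(of_nat p :: 'v) ^ M = 0"
    and \<mm>: "1 \<notin> \<mm>" and \<alpha>: "\<alpha> \<in> padic_integers p"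
    and \<phi>: "divides_power f (p ^ M) (p ^ e) (nat (\<alpha> e)) \<phi>"
  shows "\<not> bernstein_sato_root \<eta> \<mm> p f \<alpha>"
proof -
  define q where "q = p ^ e"
  define s where "s = nat (\<alpha> e)"
  define Q where "Q = q * p ^ M"
  have p0: "p > 0" using p(1) by (rule prime_gt_0_nat)
  have q0: "q > 0" and Q0: "Q > 0" using p0 by (simp_all add: q_def Q_def)
  have s: "\<alpha> e = int s" "s < q"
    using padic_range[OF \<alpha>, of e] by (auto simp: s_def q_def nat_less_iff)
  have \<phi>_lin: "V_linear \<eta> \<phi>" and \<phi>_frob: "\<And>h r. \<phi> (frob q h * r) = frob q h * \<phi> r"
    and \<phi>_f: "\<And>i. i < p ^ M \<Longrightarrow> \<phi> (f ^ (q * i + s + 1)) = f ^ (q * i + s)"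
    using \<phi> unfolding divides_power_def q_def s_def by blast+
  interpret \<phi>: additive \<phi> using \<phi>_lin by (rule V_linear_additive)
  define c where "c = q - 1 - s"
  define u where "u = (\<lambda>\<beta>\<in>padic_integers p. if \<beta> e = \<alpha> e then 1 else 0 :: 'v)"
  let ?C = "continuous_function_ring p :: ((nat \<Rightarrow> int) \<Rightarrow> 'v) ring"
  have u_C: "u \<in> carrier ?C"
    using continuous_map_eq[OF continuous_map_padic_residue[of p "\<lambda>r. if r = \<alpha> e then 1 else 0" e], of u]
    by (simp add: continuous_function_ring_def u_def topspace_padic)
  have one_C: "\<one>\<^bsub>?C\<^esub> \<in> carrier ?C"
    using continuous_map_eq[OF continuous_map_padic_residue[of p "\<lambda>_. 1" 0], of "\<one>\<^bsub>?C\<^esub>"]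
    by (simp add: continuous_function_ring_def topspace_padic)
  let ?W = "carrier ?C - point_ideal p \<mm> \<alpha>"
  have u_W: "u \<in> ?W" using u_C \<mm> \<alpha> by (simp add: point_ideal_def u_def)
  have one_W: "\<one>\<^bsub>?C\<^esub> \<in> ?W"
    using one_C \<mm> \<alpha> by (simp add: point_ideal_def) (simp add: continuous_function_ring_def)
  define T where "T = tilde_op \<eta> p u"
  have T_D0: "T \<in> D0" unfolding T_def by (rule tilde_op_in_D0[OF p u_C])
  \<comment> \<open>the residue of \<open>-1 - a\<close> is that of \<open>\<alpha>\<close> exactly when \<open>a\<close> has the complementary residue \<open>c\<close>\<close>
  have T: "poly.coeff (T g) a = (if a mod q = c then poly.coeff g a else 0)" for g a
  proof -
    have "padic_of_int p (- 1 - int a) e = int (q - 1 - a mod q)"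
      unfolding padic_of_int_def using neg_mod_complement[OF q0, of a] by (simp add: q_def)
    moreover have "q - 1 - a mod q = s \<longleftrightarrow> a mod q = c"
      unfolding c_def using s(2) mod_less_divisor[OF q0, of a] by linarith
    ultimately have "u (padic_of_int p (- 1 - int a)) = (if a mod q = c then 1 else 0)"
      using padic_of_int_mem[OF p0] by (simp add: u_def s(1))
    then show ?thesis unfolding T_def tilde_op_eq_coeffwise by (simp add: coeff_coeffwise)
  qed
  define P where "P = coeffwise (\<lambda>a. if a mod q = c then \<phi> else (\<lambda>_. 0))"
  have P: "poly.coeff (P g) a = (if a mod q = c then \<phi> (poly.coeff g a) else 0)" for g a
    unfolding P_def by (subst coeff_coeffwise) (simp_all add: \<phi>.zero)
  have P_D0: "P \<in> D0"
    unfolding P_def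
  proof (rule coeffwise_in_D0[OF p])
    have "V_linear \<eta> (\<lambda>_. 0)" by (simp add: V_linear_iff eta_module)
    then show "V_linear \<eta> (if a mod q = c then \<phi> else (\<lambda>_. 0))" for a using \<phi>_lin by simp
    show "(if (a + p ^ e) mod q = c then \<phi> else (\<lambda>_. 0)) = (if a mod q = c then \<phi> else (\<lambda>_. 0))" for a
      by (simp add: q_def)
    show "(if a mod q = c then \<phi> else (\<lambda>_. 0)) (x i ^ p ^ e * r)
        = x i ^ p ^ e * (if a mod q = c then \<phi> else (\<lambda>_. 0)) r" if "i < n" for a i r
      using \<phi>_frob[of "x i" r] frob_variable[OF that, of q] by (simp add: q_def)
  qed
  let ?w = "[:f:] ^ Q - [:0, 1:] ^ Q"
  obtain g where g: "f ^ Q = frob q g" using power_in_range_frob[OF p, of f e] by (auto simp: Q_def q_def)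
  have w: "poly.coeff (?w * y) a = f ^ Q * poly.coeff y a - (if a < Q then 0 else poly.coeff y (a - Q))" for y a
    unfolding left_diff_distrib coeff_diff const_power coeff_const_mult coeff_var_power_mult ..
  have mod_Q: "(a - Q) mod q = a mod q" if "\<not> a < Q" for a
  proof -
    have "a = (a - Q) + q * p ^ M" using that by (simp add: Q_def)
    then show ?thesis by (metis mod_mult_self2)
  qed
  have T_w: "T (?w * y) = ?w * T y" for y
    by (rule poly_eqI) (simp only: T w, simp add: mod_Q)
  have P_w: "P (?w * y) = ?w * P y" for y
  proof (rule poly_eqI)
    have "\<phi> (f ^ Q * r) = f ^ Q * \<phi> r" for r unfolding g by (rule \<phi>_frob)
    then show "poly.coeff (P (?w * y)) a = poly.coeff (?w * P y) a" for a
      by (simp only: P w) (simp add: mod_Q \<phi>.diff \<phi>.zero)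
  qed
  let ?G = "\<Sum>a<Q. Polynomial.monom (f ^ (Q - Suc a)) a"
  have G: "poly.coeff ?G a = (if a < Q then f ^ (Q - Suc a) else 0)" for a
    by (simp add: coeff_sum coeff_monom)
  have "T ?G = P ([:f:] * ?G)"
  proof (rule poly_eqI)
    fix a
    have "f ^ (Q - Suc a) = \<phi> (f * f ^ (Q - Suc a))" if a: "a mod q = c" "a < Q"
    proof -
      define j where "j = a div q"
      have aj: "a = c + q * j" using a(1) unfolding j_def by (metis mod_mult_div_eq)
      have "j < p ^ M" using a(2) q0 unfolding j_def Q_def by (simp add: less_mult_imp_div_less mult.commute)
      then obtain i where i: "p ^ M = Suc (i + j)" by (metis add.commute less_imp_Suc_add)
      have "Q - Suc a = q * i + s" unfolding Q_def i aj c_def using s(2) by (simp add: algebra_simps)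
      moreover have "i < p ^ M" using i by simp
      ultimately show ?thesis using \<phi>_f[of i] by simp
    qed
    then show "poly.coeff (T ?G) a = poly.coeff (P ([:f:] * ?G)) a"
      by (simp only: T P coeff_const_mult G) (simp add: \<phi>.zero)
  qed
  note TP = D_act_eq_of_cleared[OF f p D0_diff_ops[OF T_D0] D0_diff_ops[OF P_D0] Q0 T_w P_w this]
  let ?den = "bs_denominators f"
  let ?L = "D_localization \<kappa> ?den" and ?N = "bs_f_fractions f"
  let ?A = "ring_frac ?den 1 (f_minus_t f)"
  interpret W: regular_denominators ?den by (rule regular_bs_denominators[OF f])
  note nil = of_nat_poly_nilpotent[OF p(2)]
  have L: "?L = with_smult (W.D_act \<kappa>) (ring_localization ?den)"
    by (rule W.D_localization_eq[OF nil p0 kappa_module])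
  have lmL: "left_module (diff_op_ring \<kappa>) ?L"
    unfolding L by (rule W.left_module_D_act[OF nil p0 kappa_module])
  interpret L: left_module "diff_op_ring \<kappa>" ?L by (rule lmL)
  have sub: "additive_subgroup ?N ?L" by (rule bs_f_fractions_submodule(1)[OF f p])
  have stab: "R \<odot>\<^bsub>?L\<^esub> B \<in> ?N" if "R \<in> carrier (diff_op_ring \<kappa>)" "B \<in> ?N" for R B
    using bs_f_fractions_submodule(2)[OF f p] that by simp
  let ?H = "bs_H \<eta> f" and ?\<delta> = "bs_delta \<eta> f"
  have lmH: "left_module (diff_op_ring \<kappa>) ?H"
    unfolding bs_H_def by (rule quotient_left_module[OF lmL sub stab])
  have A: "?A \<in> carrier ?L" unfolding L with_smult_simps by (rule W.fr_closed[OF bs_denominators_mem(2)])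
  have smultH: "R \<odot>\<^bsub>?H\<^esub> (?N +>\<^bsub>?L\<^esub> B) = ?N +>\<^bsub>?L\<^esub> (R \<odot>\<^bsub>?L\<^esub> B)"
    if "R \<in> diff_ops \<kappa>" "B \<in> carrier ?L" for R B
    unfolding bs_H_def by (rule quotient_module_smult[OF lmL sub stab]) (use that in simp_all)
  have \<delta>: "?\<delta> \<in> carrier ?H"
    unfolding bs_H_def bs_delta_def quotient_module_carrier using A by blast
  let ?f = "(*) [:f:]"
  have fA: "?f \<odot>\<^bsub>?L\<^esub> ?A \<in> carrier ?L" using L.smult_closed[of ?f ?A] A D0_diff_ops[OF const_in_D0] by simp
  have "T \<odot>\<^bsub>?H\<^esub> ?\<delta> = P \<odot>\<^bsub>?H\<^esub> (?f \<odot>\<^bsub>?H\<^esub> ?\<delta>)"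
    unfolding bs_delta_def
    using smultH[OF D0_diff_ops[OF T_D0] A] smultH[OF D0_diff_ops[OF const_in_D0] A]
      smultH[OF D0_diff_ops[OF P_D0] fA] TP by simp
  note T\<delta> = this
  note cyc = lmH D0_subring \<delta> const_in_D0[of f]
  let ?K = "quotient_module (?H\<lparr>carrier := D0_span \<eta> f ?\<delta>\<rparr>) (D0_span \<eta> f (?f \<odot>\<^bsub>?H\<^esub> ?\<delta>))"
  have closed: "R \<odot>\<^bsub>?K\<^esub> B \<in> carrier ?K" if "R \<in> D0" "B \<in> carrier ?K" for R B
    using cyclic_subquotient_closed[OF cyc that(1)] that(2) unfolding D0_span_def by blast
  have zero: "\<zero>\<^bsub>?K\<^esub> \<in> carrier ?K"
    using cyclic_subquotient_zero_closed[OF cyc] unfolding D0_span_def .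
  have kill: "T \<odot>\<^bsub>?K\<^esub> B = \<zero>\<^bsub>?K\<^esub>" if "B \<in> carrier ?K" for B
  proof -
    have "T \<otimes>\<^bsub>diff_op_ring \<kappa>\<^esub> R = R \<otimes>\<^bsub>diff_op_ring \<kappa>\<^esub> T" if "R \<in> D0" for R
      using tilde_op_central[OF that, of p u] by (simp add: T_def)
    from cyclic_subquotient_annihilated[OF cyc T_D0 this P_D0 T\<delta>] that show ?thesis
      unfolding D0_span_def by blast
  qed
  have N: "bs_N \<eta> p f = with_smult (\<lambda>\<phi> B. tilde_op \<eta> p \<phi> \<odot>\<^bsub>?K\<^esub> B) ?K"
    unfolding bs_N_def Let_def ..
  have "carrier (localized_module ?C ?W (bs_N \<eta> p f)) = {\<zero>\<^bsub>localized_module ?C ?W (bs_N \<eta> p f)\<^esub>}"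
  proof (rule localized_module_trivial[OF u_W one_W])
    show "\<zero>\<^bsub>bs_N \<eta> p f\<^esub> \<in> carrier (bs_N \<eta> p f)" using zero by (simp add: N)
    show "v \<odot>\<^bsub>bs_N \<eta> p f\<^esub> B \<in> carrier (bs_N \<eta> p f)" if "v \<in> ?W" "B \<in> carrier (bs_N \<eta> p f)" for v B
      using closed[OF tilde_op_in_D0[OF p, of v]] that by (simp add: N)
    show "u \<odot>\<^bsub>bs_N \<eta> p f\<^esub> B = \<zero>\<^bsub>bs_N \<eta> p f\<^esub>" if "B \<in> carrier (bs_N \<eta> p f)" for B
      using kill that by (simp add: N T_def)
  qed
  then show ?thesis unfolding bernstein_sato_root_def Let_def by blast
qed

end

text \<open>
  Finitely many \<open>p\<close>-adic integers have distinct residues modulo \<open>p^e\<close> for large \<open>e\<close>.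
\<close>

lemma finite_padic_of_bounded_residues:
  assumes R: "R \<subseteq> padic_integers p" and card: "\<And>e. card ((\<lambda>\<alpha>. \<alpha> e) ` R) \<le> B" and fin: "\<And>e. finite ((\<lambda>\<alpha>. \<alpha> e) ` R)"
  shows "finite R"
proof (rule ccontr)
  assume "infinite R"
  then obtain S where S: "S \<subseteq> R" "finite S" "card S = Suc B"
    using infinite_arbitrarily_large by blast
  have "\<forall>\<alpha>\<in>S. \<forall>\<beta>\<in>S. \<exists>k. \<alpha> \<noteq> \<beta> \<longrightarrow> \<alpha> k \<noteq> \<beta> k" by auto
  then obtain k where k: "\<And>\<alpha> \<beta>. \<alpha> \<in> S \<Longrightarrow> \<beta> \<in> S \<Longrightarrow> \<alpha> \<noteq> \<beta> \<Longrightarrow> \<alpha> (k \<alpha> \<beta>) \<noteq> \<beta> (k \<alpha> \<beta>)" by metis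
  define e where "e = (\<Sum>\<alpha>\<in>S. \<Sum>\<beta>\<in>S. k \<alpha> \<beta>)"
  have le: "k \<alpha> \<beta> \<le> e" if "\<alpha> \<in> S" "\<beta> \<in> S" for \<alpha> \<beta>
  proof -
    have "k \<alpha> \<beta> \<le> (\<Sum>\<beta>\<in>S. k \<alpha> \<beta>)" using that S(2) by (intro member_le_sum) auto
    also have "\<dots> \<le> e" unfolding e_def using that S(2) by (intro member_le_sum[of \<alpha>]) auto
    finally show ?thesis .
  qed
  have "inj_on (\<lambda>\<alpha>. \<alpha> e) S"
  proof (rule inj_onI, rule ccontr)
    fix \<alpha> \<beta> assume ab: "\<alpha> \<in> S" "\<beta> \<in> S" "\<alpha> e = \<beta> e" "\<alpha> \<noteq> \<beta>"
    have "\<alpha> (k \<alpha> \<beta>) = \<beta> (k \<alpha> \<beta>)"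
      by (rule padic_eq_below[of _ p]) (use ab R S(1) le in auto)
    with k ab show False by blast
  qed
  then have "Suc B = card ((\<lambda>\<alpha>. \<alpha> e) ` S)" using S(3) by (simp add: card_image)
  also have "\<dots> \<le> card ((\<lambda>\<alpha>. \<alpha> e) ` R)" by (rule card_mono[OF fin image_mono[OF S(1)]])
  also have "\<dots> \<le> B" by (rule card)
  finally show False by simp
qed

theorem theorem4p2:
  fixes \<mm> :: "'v::comm_ring_1 set"
    and F :: "'v \<Rightarrow> 'v"
    and p n :: nat
    and \<eta> :: "'v \<Rightarrow> 'r::comm_ring_1"
    and x :: "nat \<Rightarrow> 'r"
    and f :: 'r
  assumes "local_ring_with (cls_ring :: 'v ring) \<mm>"
    and "artinian_ring (cls_ring :: 'v ring)"
    and "p = ring_characteristic ((cls_ring :: 'v ring) Quot \<mm>)"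
    and "p > 0"
    and "F \<in> ring_hom (cls_ring :: 'v ring) (cls_ring :: 'v ring)"
    and "bij F"
    and "\<And>a :: 'v. \<mm> +>\<^bsub>cls_ring\<^esub> F a = (\<mm> +>\<^bsub>cls_ring\<^esub> a) [^]\<^bsub>cls_ring Quot \<mm>\<^esub> p"
    and "is_polynomial_ring \<eta> x n"
    and "nonzerodivisor f"
  shows "finite {\<alpha>. bernstein_sato_root \<eta> \<mm> p f \<alpha>}"
proof -
  interpret polynomial_ring \<eta> x n by unfold_locales (rule assms(8))
  note p = residue_characteristic[OF assms(1,3,4)]
  obtain M where M: "(of_nat p :: 'v) ^ M = 0"
    using artinian_local_nilpotent[OF assms(1,2) p(2)] by blast
  obtain B where B: "\<And>q. card {s. s < q \<and> \<not> (\<exists>\<phi>. divides_power f (p ^ M) q s \<phi>)} \<le> B"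
    using card_not_divides_power_bounded[OF assms(1,2)] by blast
  let ?R = "{\<alpha>. bernstein_sato_root \<eta> \<mm> p f \<alpha>}"
  have R: "?R \<subseteq> padic_integers p" by (auto simp: bernstein_sato_root_def)
  have sub: "(\<lambda>\<alpha>. \<alpha> e) ` ?R \<subseteq> int ` {s. s < p ^ e \<and> \<not> (\<exists>\<phi>. divides_power f (p ^ M) (p ^ e) s \<phi>)}"
    (is "_ \<subseteq> int ` ?S e") for e
  proof
    fix r assume "r \<in> (\<lambda>\<alpha>. \<alpha> e) ` ?R"
    then obtain \<alpha> where \<alpha>: "r = \<alpha> e" "bernstein_sato_root \<eta> \<mm> p f \<alpha>" by blast
    then have mem: "\<alpha> \<in> padic_integers p" using R by blast
    have "\<not> (\<exists>\<phi>. divides_power f (p ^ M) (p ^ e) (nat (\<alpha> e)) \<phi>)"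
      using not_root_of_divides_power[OF assms(9) p(1) M local_ring_max_ideal(2)[OF assms(1)] mem] \<alpha>(2)
      by blast
    moreover have "nat (\<alpha> e) < p ^ e" "r = int (nat (\<alpha> e))"
      using padic_range[OF mem, of e] \<alpha>(1) by (auto simp: nat_less_iff)
    ultimately show "r \<in> int ` ?S e" by blast
  qed
  show ?thesis
  proof (rule finite_padic_of_bounded_residues[OF R])
    fix e
    have fin: "finite (int ` ?S e)" by simp
    show "finite ((\<lambda>\<alpha>. \<alpha> e) ` ?R)" using sub fin by (rule finite_subset)
    have "card ((\<lambda>\<alpha>. \<alpha> e) ` ?R) \<le> card (int ` ?S e)" using fin sub by (rule card_mono)
    also have "\<dots> \<le> card (?S e)" by (rule card_image_le) simp
    also have "\<dots> \<le> B" by (rule B)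
    finally show "card ((\<lambda>\<alpha>. \<alpha> e) ` ?R) \<le> B" .
  qed
qed

end
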